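(* Let $n,d\ge 1$ be integers, $p\in(1,\infty)$, let $\Omega\subset\mathbb{R}^n$ be a bounded domain with a Lipschitz boundary and let $u_0\in W^{1,p}(\Omega,\mathbb{R}^d)$. Let $f:\overline{\Omega}\times\mathbb{R}^d\times\mathbb{R}^{nd}\to\mathbb{R}$ be a continuous function satisfying the $p$-growth condition (p-G) and such that for all $(x,u)\in\Omega\times\mathbb{R}^d$ the map $\xi\mapsto f(x,u,\xi)$ is convex. Put $F(v)=\int_\Omega f(x,v(x),\nabla v(x))\,dx$ and $\mathcal{W}=u_0+W^{1,p}_0(\Omega,\mathbb{R}^d)$, and assume that there exists $w\in\mathcal{W}$ with $F(w)<\infty$ and that $F(w)>-\infty$ for every $w\in\mathcal{W}$. Then $F$ has a minimizer in $\mathcal{W}$, i.e. there exists $u\in\mathcal{W}$ with $F(u)=\inf_{w\in\mathcal{W}}F(w)$.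
   Context: The $p$-growth condition (p-G) for $f:\overline{\Omega}\times\mathbb{R}^d\times\mathbb{R}^{z}\to\mathbb{R}$ (here $z=nd$) means: there exist $q$ with $1\le q<p$, a constant $c_0>0$, a constant $c_1\in\mathbb{R}$ and a function $c_2:\overline{\Omega}\to\mathbb{R}$ with $c_2|_\Omega\in L^1(\Omega)$ such that $$f(x,u,\xi)\ge c_0|\xi|^p+c_1|u|^q+c_2(x)\quad\text{for all }(x,u,\xi)\in\overline{\Omega}\times\mathbb{R}^d\times\mathbb{R}^z.$$ The gradient $\nabla v(x)$ of $v\in W^{1,p}(\Omega,\mathbb{R}^d)$ is regarded as an element of $\mathbb{R}^{nd}$. The functional $F$ may take the value $+\infty$. *)

theory Defs
  imports "HOL-Analysis.Analysis"
begin

text \<open>A domain is a nonempty connected open set.  Its boundary is Lipschitz if near each boundary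
  point \<open>a\<close> the set is, after a choice of axis \<open>e\<close>, the strict epigraph of a Lipschitz function
  \<open>g\<close> on the hyperplane orthogonal to \<open>e\<close>; the point of that hyperplane below \<open>x\<close> is
  \<open>x - (x \<bullet> e) e\<close>.  For a one-dimensional space the hyperplane is \<open>{0}\<close>.\<close>

definition lipschitz_boundary :: "'a::euclidean_space set \<Rightarrow> bool" where
  "lipschitz_boundary \<Omega> \<longleftrightarrow>
     (\<forall>a\<in>frontier \<Omega>. \<exists>r e g L. 0 < r \<and> norm e = 1 \<and>
        L-lipschitz_on {y. y \<bullet> e = 0} (g :: 'a \<Rightarrow> real) \<and>
        \<Omega> \<inter> ball a r = {x \<in> ball a r. g (x - (x \<bullet> e) *\<^sub>R e) < x \<bullet> e})"

definition bounded_lipschitz_domain :: "'a::euclidean_space set \<Rightarrow> bool" where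
  "bounded_lipschitz_domain \<Omega> \<longleftrightarrow>
     open \<Omega> \<and> connected \<Omega> \<and> \<Omega> \<noteq> {} \<and> bounded \<Omega> \<and> lipschitz_boundary \<Omega>"

text \<open>Elements of \<open>L\<^sup>p(\<Omega>)\<close> are represented by functions on the whole space of which only the
  values on \<open>\<Omega>\<close>, up to null sets, matter.\<close>

definition Lp_space :: "real \<Rightarrow> 'a::euclidean_space set \<Rightarrow> ('a \<Rightarrow> 'b::euclidean_space) set" where
  "Lp_space p \<Omega> = {v. v \<in> borel_measurable (lebesgue_on \<Omega>) \<and>
                       integrable (lebesgue_on \<Omega>) (\<lambda>x. norm (v x) powr p)}"

definition locally_integrable :: "'a::euclidean_space set \<Rightarrow> ('a \<Rightarrow> 'b::euclidean_space) \<Rightarrow> bool" where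
  "locally_integrable \<Omega> v \<longleftrightarrow> (\<forall>K. compact K \<and> K \<subseteq> \<Omega> \<longrightarrow> integrable (lebesgue_on K) v)"

primrec C_k :: "nat \<Rightarrow> ('a::euclidean_space \<Rightarrow> 'b::euclidean_space) \<Rightarrow> bool" where
  "C_k 0 \<phi> \<longleftrightarrow> continuous_on UNIV \<phi>"
| "C_k (Suc k) \<phi> \<longleftrightarrow> (\<forall>x. \<phi> differentiable (at x)) \<and>
     (\<forall>b\<in>Basis. C_k k (\<lambda>x. frechet_derivative \<phi> (at x) b))"

definition test_functions :: "'a::euclidean_space set \<Rightarrow> ('a \<Rightarrow> 'b::euclidean_space) set" where
  "test_functions \<Omega> =
     {\<phi>. (\<forall>k. C_k k \<phi>) \<and> compact (closure {x. \<phi> x \<noteq> 0}) \<and> closure {x. \<phi> x \<noteq> 0} \<subseteq> \<Omega>}"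

text \<open>\<open>\<real>\<^sup>n\<^sup>d\<close> is realised as the type \<^typ>\<open>real^'n^'d\<close> of matrices with rows indexed by \<open>'d\<close>,
  whose library norm is the Euclidean norm of the entries; the entry \<open>G x $ j $ i\<close> of a gradient
  is the derivative of the \<open>j\<close>-th component in the \<open>i\<close>-th direction.\<close>

definition has_weak_gradient ::
    "(real^'n) set \<Rightarrow> (real^'n \<Rightarrow> real^'d) \<Rightarrow> (real^'n \<Rightarrow> real^'n^'d) \<Rightarrow> bool" where
  "has_weak_gradient \<Omega> v G \<longleftrightarrow> locally_integrable \<Omega> v \<and> locally_integrable \<Omega> G \<and>
     (\<forall>\<phi>\<in>test_functions \<Omega>. \<forall>i j.
        (LINT x|lebesgue_on \<Omega>. v x $ j * frechet_derivative \<phi> (at x) (axis i 1)) =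
        - (LINT x|lebesgue_on \<Omega>. (G x $ j $ i) * \<phi> x))"

text \<open>The weak gradient is unique only up to null sets, so \<open>weak_gradient\<close> picks a representative;
  every integral below is independent of this choice.\<close>

definition weak_gradient ::
    "(real^'n) set \<Rightarrow> (real^'n \<Rightarrow> real^'d) \<Rightarrow> real^'n \<Rightarrow> real^'n^'d" where
  "weak_gradient \<Omega> v = (SOME G. has_weak_gradient \<Omega> v G)"

definition sobolev :: "real \<Rightarrow> (real^'n) set \<Rightarrow> (real^'n \<Rightarrow> real^'d) set" where
  "sobolev p \<Omega> = {v \<in> Lp_space p \<Omega>. \<exists>G \<in> Lp_space p \<Omega>. has_weak_gradient \<Omega> v G}"

definition sobolev_norm :: "real \<Rightarrow> (real^'n) set \<Rightarrow> (real^'n \<Rightarrow> real^'d) \<Rightarrow> real" where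
  "sobolev_norm p \<Omega> v =
     ((LINT x|lebesgue_on \<Omega>. norm (v x) powr p)
      + (LINT x|lebesgue_on \<Omega>. norm (weak_gradient \<Omega> v x) powr p)) powr (1 / p)"

text \<open>\<open>W\<^sub>0\<^sup>1\<^sup>,\<^sup>p\<close> is the closure of the test functions in \<open>W\<^sup>1\<^sup>,\<^sup>p\<close>.\<close>

definition sobolev0 :: "real \<Rightarrow> (real^'n) set \<Rightarrow> (real^'n \<Rightarrow> real^'d) set" where
  "sobolev0 p \<Omega> = {v \<in> sobolev p \<Omega>. \<exists>\<phi>. (\<forall>k::nat. \<phi> k \<in> test_functions \<Omega>) \<and>
                     (\<lambda>k. sobolev_norm p \<Omega> (\<lambda>x. v x - \<phi> k x)) \<longlonglongrightarrow> 0}"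

definition affine_sobolev0 ::
    "real \<Rightarrow> (real^'n) set \<Rightarrow> (real^'n \<Rightarrow> real^'d) \<Rightarrow> (real^'n \<Rightarrow> real^'d) set" where
  "affine_sobolev0 p \<Omega> u0 = {\<lambda>x. u0 x + h x | h. h \<in> sobolev0 p \<Omega>}"

definition p_growth ::
    "real \<Rightarrow> (real^'n) set \<Rightarrow> (real^'n \<Rightarrow> real^'d \<Rightarrow> real^'n^'d \<Rightarrow> real) \<Rightarrow> bool" where
  "p_growth p \<Omega> f \<longleftrightarrow>
     (\<exists>q c0 c1 c2. 1 \<le> q \<and> q < p \<and> 0 < c0 \<and> integrable (lebesgue_on \<Omega>) c2 \<and>
        (\<forall>x\<in>closure \<Omega>. \<forall>u \<xi>.
           f x u \<xi> \<ge> c0 * norm \<xi> powr p + c1 * norm u powr q + c2 x))"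

text \<open>The integral of a real function as an extended real, positive part minus negative part.  If
  both parts are infinite then \<open>\<infinity> - \<infinity> = \<infinity>\<close> in \<^typ>\<open>ereal\<close>; on a bounded domain with
  \<^const>\<open>p_growth\<close> the negative part of the integrand of \<open>energy\<close> is integrable for every
  function in \<^const>\<open>Lp_space\<close>, so this case does not occur.\<close>

definition extended_integral :: "'a measure \<Rightarrow> ('a \<Rightarrow> real) \<Rightarrow> ereal" where
  "extended_integral M g =
     enn2ereal (\<integral>\<^sup>+x. ennreal (g x) \<partial>M) - enn2ereal (\<integral>\<^sup>+x. ennreal (- g x) \<partial>M)"

definition energy ::
    "(real^'n) set \<Rightarrow> (real^'n \<Rightarrow> real^'d \<Rightarrow> real^'n^'d \<Rightarrow> real) \<Rightarrow> (real^'n \<Rightarrow> real^'d) \<Rightarrow> ereal" where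
  "energy \<Omega> f v = extended_integral (lebesgue_on \<Omega>) (\<lambda>x. f x (v x) (weak_gradient \<Omega> v x))"

end

theory Submission
  imports Defs "HOL-Complex_Analysis.Great_Picard"
begin

text \<open>The proof is the direct method of the calculus of variations.  The growth condition and the
  Poincare inequality on \<open>W\<^sub>0\<^sup>1\<^sup>,\<^sup>p\<close> make the energy coercive: the term of order \<open>q < p\<close> is absorbed by
  Young's inequality, so a minimizing sequence \<open>w\<^sub>k\<close> is bounded in \<open>W\<^sup>1\<^sup>,\<^sup>p\<close>.  A subsequence
  converges in \<open>L\<^sup>p\<close> and almost everywhere to some \<open>u\<close>, by Rellich's theorem.  The gradients only converge
  weakly, and convexity of \<open>f\<close> in the gradient is what makes the energy lower semicontinuous under
  such convergence.

  Weak convergence itself is avoided.  By uniform convexity of \<open>L\<^sup>p\<close>, suitable convex combinations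
  of the tails of any bounded sequence converge strongly
  (\<open>bounded_tail_combinations_cauchy\<close>).  Applied to the pairs of a function and its
  gradient this yields a limit which still belongs to \<open>u\<^sub>0 + W\<^sub>0\<^sup>1\<^sup>,\<^sup>p\<close>, because \<open>W\<^sub>0\<^sup>1\<^sup>,\<^sup>p\<close> is by
  definition closed under strong limits (\<open>sobolev0_pairs_closed\<close>).  Since \<open>f\<close> is convex only in its
  last argument, the second argument has to be frozen at \<open>u\<close> before convexity can be used on the
  combinations.  On a further subsequence, \<open>f(x, w\<^sub>k, \<nabla>w\<^sub>k) - f(x, u, \<nabla>w\<^sub>k)\<close> tends to \<open>0\<close> almost everywhere
  (\<open>integrand_difference_AE_subseq\<close>), and Fatou's lemma concludes
  (\<open>integral_lower_semicontinuity\<close>).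

  Both the Poincare inequality and Rellich's theorem follow from a single bound for the increments
  of test functions (\<open>translation_estimate\<close>): a large shift gives the former, and small shifts
  give the latter through the Riesz--Kolmogorov criterion (\<open>riesz_kolmogorov\<close>).  The energy is defined
  through a chosen weak gradient; that the choice does not matter rests on the fundamental lemma
  of the calculus of variations (\<open>fundamental_lemma_calculus_of_variations\<close>), for which smooth bump
  functions on boxes are constructed.\<close>

section \<open>Convexity and integrability of p-th powers\<close>

definition pow_integrable :: "'a measure \<Rightarrow> real \<Rightarrow> ('a \<Rightarrow> 'b::euclidean_space) \<Rightarrow> bool" where
  "pow_integrable M p g \<longleftrightarrow> g \<in> borel_measurable M \<and> integrable M (\<lambda>x. norm (g x) powr p)"

text \<open>The \<open>p\<close>-th power of the \<open>L\<^sup>p\<close> norm.  As a plain integral it inherits pointwise inequalities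
  directly; the price is that the triangle inequality only holds up to the factor \<open>2\<^sup>p\<close>, which is
  harmless for all limits below.\<close>

definition p_mass :: "'a measure \<Rightarrow> real \<Rightarrow> ('a \<Rightarrow> 'b::euclidean_space) \<Rightarrow> real" where
  "p_mass M p g = (\<integral>x. norm (g x) powr p \<partial>M)"

lemma
  assumes "pow_integrable M p g"
  shows pow_integrable_measurable: "g \<in> borel_measurable M"
    and pow_integrable_integrable: "integrable M (\<lambda>x. norm (g x) powr p)"
  using assms by (auto simp: pow_integrable_def)

lemma p_mass_nonneg [simp]: "0 \<le> p_mass M p g"
  by (simp add: p_mass_def)

lemma norm_add_powr_le:
  fixes a b :: "'b::real_normed_vector"
  assumes "0 \<le> p"
  shows "norm (a + b) powr p \<le> 2 powr p * (norm a powr p + norm b powr p)"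
proof -
  have "norm (a + b) powr p \<le> (2 * max (norm a) (norm b)) powr p"
    using assms norm_triangle_ineq[of a b] by (intro powr_mono2) auto
  also have "\<dots> = 2 powr p * max (norm a) (norm b) powr p"
    by (simp add: powr_mult)
  also have "max (norm a) (norm b) powr p \<le> norm a powr p + norm b powr p"
    by (auto simp: max_def)
  finally show ?thesis by simp
qed

lemma pow_integrable_bound:
  assumes "pow_integrable M p g" "h \<in> borel_measurable M"
    and "\<And>x. x \<in> space M \<Longrightarrow> norm (h x) powr p \<le> C * norm (g x) powr p"
  shows "pow_integrable M p h"
  unfolding pow_integrable_def
proof (intro conjI)
  show "integrable M (\<lambda>x. norm (h x) powr p)"
  proof (rule Bochner_Integration.integrable_bound[OF integrable_mult_right[OF pow_integrable_integrable[OF assms(1)], of C]])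
    show "(\<lambda>x. norm (h x) powr p) \<in> borel_measurable M" using assms(2) by measurable
    show "AE x in M. norm (norm (h x) powr p) \<le> norm (C * norm (g x) powr p)"
      using assms(3) by (intro AE_I2) (smt (verit) powr_ge_zero real_norm_def)
  qed
qed (use assms in simp)

lemma pow_integrable_add:
  assumes "0 \<le> p" "pow_integrable M p g" "pow_integrable M p h"
  shows "pow_integrable M p (\<lambda>x. g x + h x)"
  unfolding pow_integrable_def
proof (intro conjI)
  note [measurable] = pow_integrable_measurable[OF assms(2)] pow_integrable_measurable[OF assms(3)]
  show "(\<lambda>x. g x + h x) \<in> borel_measurable M" by measurable
  show "integrable M (\<lambda>x. norm (g x + h x) powr p)"
  proof (rule Bochner_Integration.integrable_bound)
    show "integrable M (\<lambda>x. 2 powr p * (norm (g x) powr p + norm (h x) powr p))"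
      by (intro integrable_mult_right Bochner_Integration.integrable_add
          pow_integrable_integrable[OF assms(2)] pow_integrable_integrable[OF assms(3)])
    show "AE x in M. norm (norm (g x + h x) powr p)
       \<le> norm (2 powr p * (norm (g x) powr p + norm (h x) powr p))"
      using norm_add_powr_le[OF assms(1)] by (intro AE_I2) (auto simp: abs_mult)
  qed measurable
qed

lemma p_mass_add_le:
  assumes "0 \<le> p" "pow_integrable M p g" "pow_integrable M p h"
  shows "p_mass M p (\<lambda>x. g x + h x) \<le> 2 powr p * (p_mass M p g + p_mass M p h)"
proof -
  note i = pow_integrable_integrable[OF assms(2)] pow_integrable_integrable[OF assms(3)]
  have "p_mass M p (\<lambda>x. g x + h x) \<le> (\<integral>x. 2 powr p * (norm (g x) powr p + norm (h x) powr p) \<partial>M)"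
    unfolding p_mass_def
    by (intro integral_mono integrable_mult_right Bochner_Integration.integrable_add i norm_add_powr_le
        assms(1) pow_integrable_integrable[OF pow_integrable_add[OF assms]])
  also have "\<dots> = 2 powr p * (p_mass M p g + p_mass M p h)"
    using i by (simp add: p_mass_def)
  finally show ?thesis .
qed

lemma pow_integrable_scaleR:
  assumes "pow_integrable M p g"
  shows "pow_integrable M p (\<lambda>x. c *\<^sub>R g x)"
  using pow_integrable_measurable[OF assms]
  by (intro pow_integrable_bound[OF assms, where C="\<bar>c\<bar> powr p"]) (auto simp: powr_mult)

lemma p_mass_scaleR: "p_mass M p (\<lambda>x. c *\<^sub>R g x) = \<bar>c\<bar> powr p * p_mass M p g"
  by (simp add: p_mass_def powr_mult)

lemma pow_integrable_diff:
  assumes "0 \<le> p" "pow_integrable M p g" "pow_integrable M p h"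
  shows "pow_integrable M p (\<lambda>x. g x - h x)"
  using pow_integrable_add[OF assms(1,2) pow_integrable_scaleR[OF assms(3), of "-1"]] by simp

lemma p_mass_minus_commute: "p_mass M p (\<lambda>x. g x - h x) = p_mass M p (\<lambda>x. h x - g x)"
  by (simp add: p_mass_def norm_minus_commute)

lemma p_mass_diff_triangle:
  assumes "0 \<le> p" "pow_integrable M p (\<lambda>x. f x - g x)" "pow_integrable M p (\<lambda>x. g x - h x)"
  shows "p_mass M p (\<lambda>x. f x - h x) \<le> 2 powr p * (p_mass M p (\<lambda>x. f x - g x) + p_mass M p (\<lambda>x. g x - h x))"
  using p_mass_add_le[OF assms] by simp

lemma pow_integrable_sum:
  assumes "0 \<le> p" "finite I" "\<And>i. i \<in> I \<Longrightarrow> pow_integrable M p (g i)"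
  shows "pow_integrable M p (\<lambda>x. \<Sum>i\<in>I. g i x)"
  using assms(2,3)
proof (induction I rule: finite_induct)
  case empty
  then show ?case by (simp add: pow_integrable_def)
next
  case (insert i I)
  have "pow_integrable M p (\<lambda>x. g i x + (\<Sum>i\<in>I. g i x))"
    using insert assms(1) by (intro pow_integrable_add) auto
  then show ?case using insert by simp
qed

text \<open>The mean value theorem, applied on the open half-line where the derivative \<open>p t\<^sup>p\<^sup>-\<^sup>1\<close> exists and
  increases strictly; at \<open>s = 0\<close> the left-hand side is \<open>(1 - p) m\<^sup>p < 0\<close>.\<close>

lemma powr_gt_tangent:
  fixes p s m :: real
  assumes p: "1 < p" and s: "0 \<le> s" and m: "0 < m" and ne: "s \<noteq> m"
  shows "m powr p + p * m powr (p - 1) * (s - m) < s powr p"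
proof (cases "s = 0")
  case True
  have "m powr (p - 1) * m = m powr p" using m by (simp add: powr_mult_base mult.commute)
  then have "m powr p + p * m powr (p - 1) * (s - m) = (1 - p) * m powr p"
    using True by (simp add: algebra_simps)
  also have "\<dots> < 0" using p m by (intro mult_neg_pos) auto
  finally show ?thesis using True by simp
next
  case False
  then have s0: "0 < s" using s by simp
  have D: "((\<lambda>t. t powr p) has_real_derivative p * t powr (p - 1)) (at t)" if "0 < t" for t
    using that by (rule has_real_derivative_powr)
  show ?thesis
  proof (cases "m < s")
    case True
    obtain z where z: "m < z" "z < s" "s powr p - m powr p = (s - m) * (p * z powr (p - 1))"
      using MVT2[OF True, of "\<lambda>t. t powr p" "\<lambda>t. p * t powr (p - 1)"] D m by auto
    have "m powr (p - 1) < z powr (p - 1)" using z m p by (intro powr_less_mono2) auto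
    then have "(s - m) * (p * m powr (p - 1)) < (s - m) * (p * z powr (p - 1))"
      using True p by (intro mult_strict_left_mono) auto
    then show ?thesis using z by (simp add: algebra_simps)
  next
    case False
    with ne have "s < m" by simp
    obtain z where z: "s < z" "z < m" "m powr p - s powr p = (m - s) * (p * z powr (p - 1))"
      using MVT2[OF \<open>s < m\<close>, of "\<lambda>t. t powr p" "\<lambda>t. p * t powr (p - 1)"] D s0 by auto
    have "z powr (p - 1) < m powr (p - 1)" using z s0 p by (intro powr_less_mono2) auto
    then have "(m - s) * (p * z powr (p - 1)) < (m - s) * (p * m powr (p - 1))"
      using \<open>s < m\<close> p by (intro mult_strict_left_mono) auto
    then show ?thesis using z by (simp add: algebra_simps)
  qed
qed

lemma powr_ge_tangent:
  fixes p s m :: real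
  assumes "1 < p" "0 \<le> s" "0 \<le> m"
  shows "m powr p + p * m powr (p - 1) * (s - m) \<le> s powr p"
  using powr_gt_tangent[of p s m] assms by (cases "m = 0 \<or> s = m") (auto simp: less_imp_le)

text \<open>Jensen's inequality for \<open>t \<mapsto> t\<^sup>p\<close>: integrate the tangent inequality at the mean value of \<open>norm g\<close>.
  It is stated for finite measures without normalisation because it is used on the domain, on a
  unit interval and on averaging measures.\<close>

lemma norm_integral_powr_le:
  fixes g :: "'a \<Rightarrow> 'b::euclidean_space"
  assumes M: "finite_measure M" and p: "1 < p" and g: "pow_integrable M p g"
  shows "integrable M g"
    and "(\<integral>x. norm (g x) \<partial>M) powr p \<le> measure M (space M) powr (p - 1) * p_mass M p g"
    and "norm (\<integral>x. g x \<partial>M) powr p \<le> measure M (space M) powr (p - 1) * p_mass M p g"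
proof -
  interpret finite_measure M by fact
  note [measurable] = pow_integrable_measurable[OF g]
  have le1: "norm (g x) \<le> 1 + norm (g x) powr p" for x
  proof (cases "norm (g x) \<le> 1")
    case False
    then have "norm (g x) powr 1 \<le> norm (g x) powr p" using p by (intro powr_mono) auto
    then show ?thesis using False by simp
  qed (use powr_ge_zero[of "norm (g x)" p] in linarith)
  have "integrable M (\<lambda>x. 1 + norm (g x) powr p)"
    using pow_integrable_integrable[OF g] by simp
  then show int: "integrable M g"
    by (rule Bochner_Integration.integrable_bound)
       (use le1 in \<open>auto intro!: AE_I2 simp: abs_of_nonneg add_nonneg_nonneg\<close>)
  define c where "c = measure M (space M)"
  define m where "m = (\<integral>x. norm (g x) \<partial>M) / c"
  have c0: "0 \<le> c" by (simp add: c_def)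
  have m0: "0 \<le> m" unfolding m_def using c0 by simp
  show *: "(\<integral>x. norm (g x) \<partial>M) powr p \<le> measure M (space M) powr (p - 1) * p_mass M p g"
  proof (cases "c = 0")
    case True
    then have "emeasure M (space M) = 0" by (simp add: c_def emeasure_eq_measure)
    then have "AE x in M. norm (g x) = 0" by (intro AE_I[of _ _ "space M"]) auto
    then have "(\<integral>x. norm (g x) \<partial>M) = (\<integral>x. 0 \<partial>M)" by (intro integral_cong_AE) auto
    then show ?thesis by simp
  next
    case False
    with c0 have cpos: "0 < c" by simp
    have "(\<integral>x. m powr p + p * m powr (p - 1) * (norm (g x) - m) \<partial>M) \<le> p_mass M p g"
      unfolding p_mass_def using int pow_integrable_integrable[OF g]
      by (intro integral_mono powr_ge_tangent p m0) auto
    moreover have "(\<integral>x. m powr p + p * m powr (p - 1) * (norm (g x) - m) \<partial>M) = c * m powr p"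
      using int cpos by (simp add: c_def[symmetric] m_def)
    moreover have "c * m powr p = (\<integral>x. norm (g x) \<partial>M) powr p / c powr (p - 1)"
      using cpos by (simp add: m_def powr_divide powr_diff field_simps)
    ultimately have "(\<integral>x. norm (g x) \<partial>M) powr p / c powr (p - 1) \<le> p_mass M p g" by simp
    then show ?thesis using cpos by (simp add: c_def[symmetric] field_simps)
  qed
  have "norm (\<integral>x. g x \<partial>M) powr p \<le> (\<integral>x. norm (g x) \<partial>M) powr p"
    using p by (intro powr_mono2) auto
  with * show "norm (\<integral>x. g x \<partial>M) powr p \<le> measure M (space M) powr (p - 1) * p_mass M p g"
    by linarith
qed

text \<open>Strictness has two sources: if the norms differ, \<open>t \<mapsto> t\<^sup>p\<close> is strictly convex; if they agree, the
  parallelogram law makes the midpoint strictly shorter.\<close>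

lemma midpoint_powr_less:
  fixes a b :: "'b::euclidean_space"
  assumes p: "1 < p" and ne: "a \<noteq> b"
  shows "norm ((1/2) *\<^sub>R (a + b)) powr p < (norm a powr p + norm b powr p) / 2"
proof -
  define m where "m = (norm a + norm b) / 2"
  have m: "0 < m" using ne by (auto simp: m_def) (metis norm_ge_zero add_nonneg_eq_0_iff add_nonneg_nonneg le_less norm_eq_zero)
  have le: "norm ((1/2) *\<^sub>R (a + b)) \<le> m" using norm_triangle_ineq[of a b] by (simp add: m_def)
  show ?thesis
  proof (cases "norm a = norm b")
    case True
    have "(norm (a + b))\<^sup>2 + (norm (a - b))\<^sup>2 = 2 * (norm a)\<^sup>2 + 2 * (norm b)\<^sup>2"
      by (simp add: power2_norm_eq_inner inner_simps inner_commute)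
    moreover have "0 < (norm (a - b))\<^sup>2" using ne by simp
    moreover have "(2 * norm a)\<^sup>2 = 2 * (norm a)\<^sup>2 + 2 * (norm b)\<^sup>2" using True by (simp add: power_mult_distrib)
    ultimately have "(norm (a + b))\<^sup>2 < (2 * norm a)\<^sup>2" by linarith
    then have "norm (a + b) < 2 * norm a" by (rule power2_less_imp_less) simp
    then have "norm ((1/2) *\<^sub>R (a + b)) powr p < norm a powr p"
      using p by (intro powr_less_mono2) auto
    then show ?thesis using True by simp
  next
    case False
    then have "norm a \<noteq> m" "norm b \<noteq> m" by (auto simp: m_def)
    define \<alpha> \<beta> where "\<alpha> = p * m powr (p - 1) * (norm a - m)" and "\<beta> = p * m powr (p - 1) * (norm b - m)"
    have "m powr p + \<alpha> < norm a powr p" "m powr p + \<beta> < norm b powr p"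
      unfolding \<alpha>_def \<beta>_def using \<open>norm a \<noteq> m\<close> \<open>norm b \<noteq> m\<close> p m by (auto intro!: powr_gt_tangent)
    moreover have "\<alpha> + \<beta> = 0"
      by (simp add: \<alpha>_def \<beta>_def m_def flip: distrib_left)
    ultimately have "m powr p < (norm a powr p + norm b powr p) / 2" by argo
    moreover have "norm ((1/2) *\<^sub>R (a + b)) powr p \<le> m powr p"
      using p le by (intro powr_mono2) auto
    ultimately show ?thesis by linarith
  qed
qed

text \<open>A pointwise form of uniform convexity that serves every \<open>p > 1\<close> at once, where Clarkson's
  inequalities would distinguish \<open>p < 2\<close> from \<open>p \<ge> 2\<close>.  All terms are homogeneous of degree \<open>p\<close>, so
  the unit sphere of the product space suffices.  There the midpoint gap \<open>D\<close> has a positive minimum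
  on the compact set \<open>S\<close> where \<open>norm (a - b)\<^sup>p\<close> is not yet controlled by the \<open>\<epsilon>\<close>-term, and a
  large multiple of that minimum absorbs the bounded remainder \<open>R\<close>.\<close>

lemma uniform_convexity_powr:
  fixes p \<epsilon> :: real
  assumes p: "1 < p" and e: "0 < \<epsilon>"
  shows "\<exists>C>0. \<forall>a b :: 'b::euclidean_space. norm (a - b) powr p \<le>
    \<epsilon> * (norm a powr p + norm b powr p)
    + C * ((norm a powr p + norm b powr p) / 2 - norm ((1/2) *\<^sub>R (a + b)) powr p)"
proof -
  define D where "D = (\<lambda>z::'b \<times> 'b. (norm (fst z) powr p + norm (snd z) powr p) / 2
      - norm ((1/2) *\<^sub>R (fst z + snd z)) powr p)"
  define R where "R = (\<lambda>z::'b \<times> 'b. norm (fst z - snd z) powr p - \<epsilon> * (norm (fst z) powr p + norm (snd z) powr p))"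
  define S where "S = {z::'b \<times> 'b. norm z = 1 \<and> 0 \<le> R z}"
  have D0: "0 \<le> D z" for z
    using midpoint_powr_less[OF p, of "fst z" "snd z"] by (cases "fst z = snd z") (auto simp: D_def simp flip: scaleR_2)
  have contD: "continuous_on UNIV D" "continuous_on UNIV R"
    unfolding D_def R_def using p by (auto intro!: continuous_intros continuous_on_powr')
  have "S = sphere 0 1 \<inter> (R -` {0..})" by (auto simp: S_def)
  moreover have "closed (R -` {0..})" using contD(2) by (intro closed_vimage) auto
  ultimately have compS: "compact S" by (simp add: compact_Int_closed)
  \<comment> \<open>Strict convexity of the power of the norm enters here: on \<open>S\<close> the two components differ.\<close>
  have posD: "0 < D z" if "z \<in> S" for z
  proof -
    have "fst z \<noteq> snd z"
    proof
      assume eq: "fst z = snd z"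
      have "z \<noteq> 0" using that by (auto simp: S_def)
      then have "fst z \<noteq> 0" using eq by (metis prod.collapse zero_prod_def)
      then have "0 < \<epsilon> * (norm (fst z) powr p + norm (snd z) powr p)" using eq e by simp
      then show False using that eq by (simp add: S_def R_def)
    qed
    from midpoint_powr_less[OF p this] show ?thesis by (simp add: D_def)
  qed
  have "\<exists>C>0. \<forall>z. norm z = 1 \<longrightarrow> R z \<le> C * D z"
  proof (cases "S = {}")
    case True
    have "R z \<le> 1 * D z" if "norm z = 1" for z
    proof -
      have "z \<notin> S" using True by simp
      then show ?thesis using D0[of z] that by (simp add: S_def)
    qed
    then show ?thesis by (intro exI[of _ 1]) auto
  next
    case False
    obtain z0 where z0: "z0 \<in> S" "\<And>z. z \<in> S \<Longrightarrow> D z0 \<le> D z"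
      using continuous_attains_inf[OF compS False continuous_on_subset[OF contD(1)]] by auto
    obtain z1 where z1: "z1 \<in> S" "\<And>z. z \<in> S \<Longrightarrow> R z \<le> R z1"
      using continuous_attains_sup[OF compS False continuous_on_subset[OF contD(2)]] by auto
    define C where "C = (R z1 + 1) / D z0"
    have "0 \<le> R z1" using z1 by (simp add: S_def)
    then have C: "0 < C" using posD[OF z0(1)] by (simp add: C_def)
    have "R z \<le> C * D z" if "norm z = 1" for z
    proof (cases "z \<in> S")
      case True
      have "R z \<le> C * D z0" using z1(2)[OF True] posD[OF z0(1)] by (simp add: C_def)
      also have "\<dots> \<le> C * D z" using z0(2)[OF True] C by simp
      finally show ?thesis .
    next
      case False
      then have "R z < 0" using that by (simp add: S_def)
      then show ?thesis using D0[of z] C by (smt (verit) mult_nonneg_nonneg)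
    qed
    then show ?thesis using C by blast
  qed
  then obtain C where C: "0 < C" "\<And>z. norm z = 1 \<Longrightarrow> R z \<le> C * D z" by blast
  have "R z \<le> C * D z" for z
  proof (cases "z = 0")
    case True
    then show ?thesis by (simp add: R_def D_def)
  next
    case False
    define t where "t = norm z"
    define y where "y = (1 / t) *\<^sub>R z"
    have t: "0 < t" "z = t *\<^sub>R y" "norm y = 1" using False by (auto simp: t_def y_def)
    have eqs: "fst z = t *\<^sub>R fst y" "snd z = t *\<^sub>R snd y" using t(2) by simp_all
    have eqs': "fst z - snd z = t *\<^sub>R (fst y - snd y)"
      "(1/2) *\<^sub>R (fst z + snd z) = t *\<^sub>R ((1/2) *\<^sub>R (fst y + snd y))"
      unfolding eqs by (simp_all add: scaleR_diff_right scaleR_add_right)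
    have h: "norm (fst z) = t * norm (fst y)" "norm (snd z) = t * norm (snd y)"
      "norm (fst z - snd z) = t * norm (fst y - snd y)"
      "norm ((1/2) *\<^sub>R (fst z + snd z)) = t * norm ((1/2) *\<^sub>R (fst y + snd y))"
      unfolding eqs' unfolding eqs using t(1) by (simp_all only: norm_scaleR abs_of_pos)
    have "R z = t powr p * R y" "D z = t powr p * D y"
      unfolding R_def D_def h using t(1) by (simp_all add: powr_mult algebra_simps add_divide_distrib)
    then show ?thesis using C(2)[OF t(3)] t(1) by (simp add: algebra_simps)
  qed
  then have "R (a, b) \<le> C * D (a, b)" for a b by blast
  then show ?thesis using C(1) unfolding R_def D_def fst_conv snd_conv
    by (intro exI[of _ C]) (simp only: diff_le_eq add.commute simp_thms)
qed

section \<open>Completeness and convergent convex combinations\<close>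

definition p_cauchy :: "'a measure \<Rightarrow> real \<Rightarrow> (nat \<Rightarrow> 'a \<Rightarrow> 'b::euclidean_space) \<Rightarrow> bool" where
  "p_cauchy M p g \<longleftrightarrow> (\<forall>\<epsilon>>0. \<exists>K. \<forall>k\<ge>K. \<forall>l\<ge>K. p_mass M p (\<lambda>x. g k x - g l x) < \<epsilon>)"

text \<open>A sequence that is Cauchy up to every positive error is Cauchy.  In the applications the
  approximating sequence consists of averages, of test functions, or of a single limit.\<close>

lemma p_cauchy_approx:
  assumes p: "0 \<le> p" and g: "\<And>k. pow_integrable M p (g k)"
    and approx: "\<And>\<delta>. 0 < \<delta> \<Longrightarrow> \<exists>h. (\<forall>k. pow_integrable M p (h k)) \<and> p_cauchy M p h \<and>
      (\<exists>K. \<forall>k\<ge>K. p_mass M p (\<lambda>x. g k x - h k x) < \<delta>)"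
  shows "p_cauchy M p g"
  unfolding p_cauchy_def
proof (intro allI impI)
  fix e :: real assume e: "0 < e"
  define Q :: real where "Q = 2 powr p"
  have Q: "1 \<le> Q" using p by (simp add: Q_def ge_one_powr_ge_zero)
  define \<delta> where "\<delta> = e / (4 * Q * Q)"
  have d: "0 < \<delta>" using e Q by (simp add: \<delta>_def)
  obtain h K where h: "\<And>k. pow_integrable M p (h k)" "p_cauchy M p h"
    and K: "\<And>k. K \<le> k \<Longrightarrow> p_mass M p (\<lambda>x. g k x - h k x) < \<delta>" using approx[OF d] by blast
  obtain N where N: "\<And>k l. N \<le> k \<Longrightarrow> N \<le> l \<Longrightarrow> p_mass M p (\<lambda>x. h k x - h l x) < \<delta>"
    using h(2) d unfolding p_cauchy_def by blast
  note diff = pow_integrable_diff[OF p]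
  have "p_mass M p (\<lambda>x. g k x - g l x) < e" if kl: "max K N \<le> k" "max K N \<le> l" for k l
  proof -
    have hg: "p_mass M p (\<lambda>x. h k x - g l x) \<le> Q * (2 * \<delta>)"
    proof -
      have "p_mass M p (\<lambda>x. h k x - g l x) \<le> Q * (p_mass M p (\<lambda>x. h k x - h l x) + p_mass M p (\<lambda>x. h l x - g l x))"
        unfolding Q_def by (intro p_mass_diff_triangle p diff g h)
      also have "\<dots> \<le> Q * (2 * \<delta>)"
        using N[of k l] K[of l] kl Q p_mass_minus_commute[of M p "h l"] by (intro mult_left_mono) auto
      finally show ?thesis .
    qed
    have "p_mass M p (\<lambda>x. g k x - g l x) \<le> Q * (p_mass M p (\<lambda>x. g k x - h k x) + p_mass M p (\<lambda>x. h k x - g l x))"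
      unfolding Q_def by (intro p_mass_diff_triangle p diff g h)
    also have "\<dots> \<le> Q * (Q * \<delta> + Q * (2 * \<delta>))"
    proof (intro mult_left_mono add_mono hg)
      have "\<delta> \<le> Q * \<delta>" using Q d by simp
      then show "p_mass M p (\<lambda>x. g k x - h k x) \<le> Q * \<delta>" using K[of k] kl by simp
    qed (use Q in simp)
    also have "\<dots> = 3 / 4 * e" using Q by (simp add: \<delta>_def field_simps)
    also have "\<dots> < e" using e by simp
    finally show ?thesis .
  qed
  then show "\<exists>K. \<forall>k\<ge>K. \<forall>l\<ge>K. p_mass M p (\<lambda>x. g k x - g l x) < e" by blast
qed

lemma p_cauchy_of_limit:
  assumes p: "0 \<le> p" and h: "\<And>k. pow_integrable M p (h k)" and L: "pow_integrable M p L"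
    and lim: "(\<lambda>k. p_mass M p (\<lambda>x. h k x - L x)) \<longlonglongrightarrow> 0"
  shows "p_cauchy M p h"
proof (rule p_cauchy_approx[OF p h])
  fix \<delta> :: real assume "0 < \<delta>"
  then have "\<exists>K. \<forall>k\<ge>K. p_mass M p (\<lambda>x. h k x - L x) < \<delta>"
    using order_tendstoD(2)[OF lim] unfolding eventually_sequentially by blast
  then show "\<exists>h'. (\<forall>k. pow_integrable M p (h' k)) \<and> p_cauchy M p h' \<and>
      (\<exists>K. \<forall>k\<ge>K. p_mass M p (\<lambda>x. h k x - h' k x) < \<delta>)"
    using L by (intro exI[of _ "\<lambda>k. L"]) (simp add: p_cauchy_def p_mass_def)
qed

lemma strict_mono_subseq_exists:
  assumes "\<And>n::nat. \<exists>K. \<forall>k\<ge>K. P n k"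
  obtains r :: "nat \<Rightarrow> nat" where "strict_mono r" "\<And>n k. r n \<le> k \<Longrightarrow> P n k"
proof -
  obtain K where K: "\<And>n k. K n \<le> k \<Longrightarrow> P n k" using assms by metis
  define r where "r n = n + (\<Sum>i\<le>n. K i)" for n
  have "strict_mono r" by (rule strict_monoI_Suc) (simp add: r_def)
  moreover have "K n \<le> r n" for n unfolding r_def
    by (rule trans_le_add2, rule member_le_sum) auto
  then have "\<And>n k. r n \<le> k \<Longrightarrow> P n k" using K le_trans by blast
  ultimately show ?thesis using that by blast
qed

text \<open>Completeness of \<open>L\<^sup>p\<close> on a finite measure space, together with the almost everywhere convergent
  subsequence.  Jensen's inequality turns small \<open>p\<close>-th powers into small \<open>L\<^sup>1\<close> norms, so along a
  fast subsequence the increments are summable almost everywhere; Fatou's lemma then makes the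
  pointwise limit a limit in the mean.\<close>

lemma p_cauchy_limit:
  fixes g :: "nat \<Rightarrow> 'a \<Rightarrow> 'b::euclidean_space"
  assumes M: "finite_measure M" and p: "1 < p"
    and g: "\<And>k. pow_integrable M p (g k)" and cau: "p_cauchy M p g"
  obtains r G where "strict_mono (r :: nat \<Rightarrow> nat)" "pow_integrable M p G"
    "AE x in M. (\<lambda>k. g (r k) x) \<longlonglongrightarrow> G x"
    "(\<lambda>k. p_mass M p (\<lambda>x. g k x - G x)) \<longlonglongrightarrow> 0"
proof -
  interpret finite_measure M by fact
  note [measurable] = pow_integrable_measurable[OF g]
  have gd: "pow_integrable M p (\<lambda>x. g k x - g l x)" for k l
    using g p by (intro pow_integrable_diff) auto
  \<comment> \<open>The factor by which Jensen's inequality loses, made positive; the threshold below compensates for it.\<close>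
  define c where "c = measure M (space M) powr (p - 1) + 1"
  have c: "0 < c" by (simp add: c_def add_nonneg_pos)
  obtain r where r: "strict_mono r"
    "\<And>n k. r n \<le> k \<Longrightarrow> \<forall>l\<ge>r n. p_mass M p (\<lambda>x. g k x - g l x) < ((1/2)^n) powr p / c"
  proof -
    have "\<exists>K. \<forall>k\<ge>K. \<forall>l\<ge>K. p_mass M p (\<lambda>x. g k x - g l x) < ((1/2)^n) powr p / c" for n :: nat
      using cau c unfolding p_cauchy_def by auto
    then obtain K where K: "\<And>n k l. K n \<le> k \<Longrightarrow> K n \<le> l \<Longrightarrow> p_mass M p (\<lambda>x. g k x - g l x) < ((1/2)^n) powr p / c"
      by metis
    obtain r where r: "strict_mono r" "\<And>n k. r n \<le> k \<Longrightarrow> K n \<le> k"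
      using strict_mono_subseq_exists[of "\<lambda>n k. K n \<le> k"] by auto
    show ?thesis using that[OF r(1)] K r(2) by blast
  qed
  define d where "d n x = g (r (Suc n)) x - g (r n) x" for n x
  have d_int: "integrable M (d n)" for n
    unfolding d_def by (rule norm_integral_powr_le[OF M p gd])
  have d_le: "(\<integral>x. norm (d n x) \<partial>M) \<le> (1/2)^n" for n
  proof (rule ccontr)
    assume "\<not> ?thesis"
    then have "((1/2)^n) powr p < (\<integral>x. norm (d n x) \<partial>M) powr p"
      using p by (intro powr_less_mono2) auto
    also have "\<dots> \<le> measure M (space M) powr (p - 1) * p_mass M p (d n)"
      using norm_integral_powr_le(2)[OF M p gd] by (simp add: d_def[abs_def])
    also have "\<dots> \<le> c * p_mass M p (d n)"
      by (intro mult_right_mono) (auto simp: c_def)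
    also have "p_mass M p (d n) < ((1/2)^n) powr p / c"
    proof -
      have "r n \<le> r (Suc n)" using r(1) by (simp add: strict_mono_less_eq)
      then show ?thesis using r(2)[of n "r (Suc n)"] by (auto simp: d_def[abs_def])
    qed
    finally show False using c by (simp add: field_simps)
  qed
  have "AE x in M. summable (\<lambda>n. norm (d n x))"
  proof -
    have "(\<integral>\<^sup>+x. (\<Sum>n. ennreal (norm (d n x))) \<partial>M) = (\<Sum>n. \<integral>\<^sup>+x. ennreal (norm (d n x)) \<partial>M)"
      by (intro nn_integral_suminf) (simp add: d_def)
    also have "\<dots> = (\<Sum>n. ennreal (\<integral>x. norm (d n x) \<partial>M))"
      using d_int by (intro suminf_cong nn_integral_eq_integral) auto
    also have "\<dots> \<le> (\<Sum>n. ennreal ((1/2)^n))"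
      using d_le by (intro suminf_le) (auto simp: ennreal_leI)
    also have "\<dots> = ennreal (\<Sum>n. (1/2)^n)"
      by (intro suminf_ennreal2) (auto intro!: summable_geometric)
    also have "\<dots> < \<infinity>" by simp
    finally have "AE x in M. (\<Sum>n. ennreal (norm (d n x))) \<noteq> \<infinity>"
      by (intro nn_integral_PInf_AE) (auto simp: d_def)
    then show ?thesis
      by eventually_elim (rule summable_suminf_not_top, auto)
  qed
  then have conv: "AE x in M. convergent (\<lambda>k. g (r k) x)"
  proof eventually_elim
    fix x assume "summable (\<lambda>n. norm (d n x))"
    then have "summable (\<lambda>n. d n x)" by (rule summable_norm_cancel)
    then have "convergent (\<lambda>n. \<Sum>i<n. d i x)" by (simp add: summable_iff_convergent)
    then have "convergent (\<lambda>n. g (r n) x - g (r 0) x)"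
      by (simp add: d_def sum_lessThan_telescope[of "\<lambda>n. g (r n) x"])
    then have "convergent (\<lambda>n. (g (r n) x - g (r 0) x) + g (r 0) x)"
      by (intro convergent_add convergent_const)
    then show "convergent (\<lambda>k. g (r k) x)" by simp
  qed
  define G where "G x = lim (\<lambda>k. g (r k) x)" for x
  have G_AE: "AE x in M. (\<lambda>k. g (r k) x) \<longlonglongrightarrow> G x"
    using conv by eventually_elim (simp add: G_def convergent_LIMSEQ_iff)
  have [measurable]: "G \<in> borel_measurable M"
    unfolding G_def[abs_def] by (rule borel_measurable_lim_metric) auto
  have fatou: "pow_integrable M p (\<lambda>x. g k x - G x) \<and> p_mass M p (\<lambda>x. g k x - G x) \<le> \<epsilon>"
    if e: "0 < \<epsilon>" and K: "\<And>k l. K \<le> k \<Longrightarrow> K \<le> l \<Longrightarrow> p_mass M p (\<lambda>x. g k x - g l x) < \<epsilon>" and k: "K \<le> k"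
    for k K \<epsilon>
  proof -
    have "(\<integral>\<^sup>+x. ennreal (norm (g k x - G x) powr p) \<partial>M)
       \<le> (\<integral>\<^sup>+x. liminf (\<lambda>n. ennreal (norm (g k x - g (r n) x) powr p)) \<partial>M)"
    proof (rule nn_integral_mono_AE, use G_AE in eventually_elim)
      fix x assume x: "(\<lambda>k. g (r k) x) \<longlonglongrightarrow> G x"
      have "(\<lambda>n. ennreal (norm (g k x - g (r n) x) powr p)) \<longlonglongrightarrow> ennreal (norm (g k x - G x) powr p)"
        using p by (intro tendsto_ennrealI tendsto_powr2 tendsto_norm tendsto_diff x tendsto_const) auto
      then show "ennreal (norm (g k x - G x) powr p) \<le> liminf (\<lambda>n. ennreal (norm (g k x - g (r n) x) powr p))"
        by (subst lim_imp_Liminf[of sequentially, symmetric, where f="\<lambda>n. ennreal (norm (g k x - g (r n) x) powr p)"]) auto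
    qed
    also have "\<dots> \<le> liminf (\<lambda>n. \<integral>\<^sup>+x. ennreal (norm (g k x - g (r n) x) powr p) \<partial>M)"
      by (intro nn_integral_liminf) measurable
    also have "\<dots> \<le> ennreal \<epsilon>"
    proof (rule Liminf_le)
      have "\<exists>N. \<forall>n\<ge>N. K \<le> r n"
        by (meson le_trans r(1) seq_suble)
      then have "eventually (\<lambda>n. K \<le> r n) sequentially" by (simp add: eventually_sequentially)
      then show "\<forall>\<^sub>F n in sequentially. (\<integral>\<^sup>+x. ennreal (norm (g k x - g (r n) x) powr p) \<partial>M) \<le> ennreal \<epsilon>"
      proof eventually_elim
        case (elim n)
        have "(\<integral>\<^sup>+x. ennreal (norm (g k x - g (r n) x) powr p) \<partial>M) = ennreal (p_mass M p (\<lambda>x. g k x - g (r n) x))"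
          unfolding p_mass_def using pow_integrable_integrable[OF gd] by (intro nn_integral_eq_integral) auto
        then show ?case using K[OF k elim] by (simp add: ennreal_leI)
      qed
    qed simp
    finally have le: "(\<integral>\<^sup>+x. ennreal (norm (g k x - G x) powr p) \<partial>M) \<le> ennreal \<epsilon>" .
    then have int: "integrable M (\<lambda>x. norm (g k x - G x) powr p)"
      by (intro integrableI_nonneg) (auto simp: le_less_trans[OF _ ennreal_less_top])
    moreover have "p_mass M p (\<lambda>x. g k x - G x) \<le> \<epsilon>"
      using le int e unfolding p_mass_def by (subst (asm) nn_integral_eq_integral) auto
    ultimately show ?thesis by (simp add: pow_integrable_def)
  qed
  have "(\<lambda>k. p_mass M p (\<lambda>x. g k x - G x)) \<longlonglongrightarrow> 0"
  proof (rule LIMSEQ_I)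
    fix \<epsilon> :: real assume e: "0 < \<epsilon>"
    then obtain K where K: "\<And>k l. K \<le> k \<Longrightarrow> K \<le> l \<Longrightarrow> p_mass M p (\<lambda>x. g k x - g l x) < \<epsilon>/2"
      using cau unfolding p_cauchy_def by (metis half_gt_zero)
    have "p_mass M p (\<lambda>x. g k x - G x) < \<epsilon>" if "K \<le> k" for k
      using fatou[OF _ K that] e by auto
    then show "\<exists>K. \<forall>k\<ge>K. norm (p_mass M p (\<lambda>x. g k x - G x) - 0) < \<epsilon>"
      by (intro exI[of _ K]) simp
  qed
  moreover have "pow_integrable M p G"
  proof -
    obtain K where K: "\<And>k l. K \<le> k \<Longrightarrow> K \<le> l \<Longrightarrow> p_mass M p (\<lambda>x. g k x - g l x) < 1"
      using cau unfolding p_cauchy_def by (metis zero_less_one)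
    have "0 \<le> p" "pow_integrable M p (\<lambda>x. g K x - G x)" using fatou[of 1 K K] K p by auto
    from pow_integrable_diff[OF this(1) g[of K] this(2)] show ?thesis by simp
  qed
  ultimately show ?thesis using that[OF r(1) _ G_AE] by blast
qed

text \<open>Coefficients of a convex combination of the indices \<open>j..n\<close>.  They are required to vanish
  elsewhere so that two combinations can be compared over a common larger range.\<close>

definition tail_weights :: "nat \<Rightarrow> nat \<Rightarrow> (nat \<Rightarrow> real) \<Rightarrow> bool" where
  "tail_weights j n w \<longleftrightarrow> (\<forall>k. 0 \<le> w k) \<and> (\<forall>k. k \<notin> {j..n} \<longrightarrow> w k = 0) \<and> (\<Sum>k\<in>{j..n}. w k) = 1"

lemma tail_weights_midpoint:
  assumes "tail_weights j n w" "tail_weights j n' w'"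
  shows "tail_weights j (max n n') (\<lambda>k. (w k + w' k) / 2)"
proof -
  have "(\<Sum>k\<in>{j..max n n'}. w k) = (\<Sum>k\<in>{j..n}. w k)"
    using assms(1) by (intro sum.mono_neutral_right) (auto simp: tail_weights_def)
  moreover have "(\<Sum>k\<in>{j..max n n'}. w' k) = (\<Sum>k\<in>{j..n'}. w' k)"
    using assms(2) by (intro sum.mono_neutral_right) (auto simp: tail_weights_def)
  moreover have "(w k + w' k) / 2 = 0" if "k \<notin> {j..max n n'}" for k
    using assms that by (cases "j \<le> k") (auto simp: tail_weights_def max_def split: if_splits)
  ultimately show ?thesis using assms
    by (simp add: tail_weights_def sum.distrib flip: sum_divide_distrib)
qed

lemma tail_weights_mono:
  assumes "tail_weights j n w" "i \<le> j"
  shows "tail_weights i n w"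
proof -
  have "(\<Sum>k\<in>{i..n}. w k) = (\<Sum>k\<in>{j..n}. w k)"
    using assms by (intro sum.mono_neutral_right) (auto simp: tail_weights_def)
  then show ?thesis using assms by (auto simp: tail_weights_def)
qed

definition tail_combination :: "(nat \<Rightarrow> 'a \<Rightarrow> 'b::real_vector) \<Rightarrow> nat \<Rightarrow> nat \<Rightarrow> (nat \<Rightarrow> real) \<Rightarrow> 'a \<Rightarrow> 'b" where
  "tail_combination z j n w x = (\<Sum>k\<in>{j..n}. w k *\<^sub>R z k x)"

lemma tail_combination_extend:
  assumes "tail_weights j n w" "i \<le> j" "n \<le> m"
  shows "tail_combination z i m w x = tail_combination z j n w x"
  unfolding tail_combination_def
  using assms by (intro sum.mono_neutral_right) (auto simp: tail_weights_def)

lemma tail_combination_midpoint: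
  assumes "tail_weights j n w" "tail_weights j n' w'"
  shows "tail_combination z j (max n n') (\<lambda>k. (w k + w' k) / 2) x
    = (1/2) *\<^sub>R (tail_combination z j n w x + tail_combination z j n' w' x)"
proof -
  have "tail_combination z j (max n n') (\<lambda>k. (w k + w' k) / 2) x
    = (1/2) *\<^sub>R (tail_combination z j (max n n') w x + tail_combination z j (max n n') w' x)"
    by (simp add: tail_combination_def scaleR_sum_right flip: sum.distrib)
       (auto intro!: sum.cong simp: algebra_simps add_divide_distrib)
  also have "tail_combination z j (max n n') w x = tail_combination z j n w x"
    by (rule tail_combination_extend[OF assms(1)]) auto
  also have "tail_combination z j (max n n') w' x = tail_combination z j n' w' x"
    by (rule tail_combination_extend[OF assms(2)]) auto
  finally show ?thesis .
qed

text \<open>This replaces weak compactness and Mazur's lemma.  Let \<open>m j\<close> be the infimum of \<open>p_mass\<close> over the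
  convex combinations of \<open>z j, z (j + 1), \<dots>\<close>.  It increases with \<open>j\<close> and is bounded, hence
  converges.  Almost minimal combinations with indices beyond \<open>J\<close> have mass close to the limit,
  while their midpoint is again a combination beyond \<open>J\<close> and so has mass at least \<open>m J\<close>.  The
  midpoint gap therefore tends to \<open>0\<close>, and uniform convexity makes the combinations Cauchy.\<close>

theorem bounded_tail_combinations_cauchy:
  fixes z :: "nat \<Rightarrow> 'a \<Rightarrow> 'b::euclidean_space"
  assumes p: "1 < p" and z: "\<And>k. pow_integrable M p (z k)" and B: "\<And>k. p_mass M p (z k) \<le> B"
  obtains n w where "\<And>j. tail_weights j (n j) (w j)"
    "p_cauchy M p (\<lambda>j. tail_combination z j (n j) (w j))"
proof -
  have pi: "pow_integrable M p (tail_combination z j n w)" for j n w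
    unfolding tail_combination_def[abs_def]
    using p z by (intro pow_integrable_sum pow_integrable_scaleR) auto
  define A where "A j = {p_mass M p (tail_combination z j n w) | n w. tail_weights j n w}" for j
  define m where "m j = Inf (A j)" for j
  have bdd: "bdd_below (A j)" for j by (rule bdd_belowI[of _ 0]) (auto simp: A_def)
  have single: "p_mass M p (z j) \<in> A j" for j
  proof -
    have "tail_weights j j (\<lambda>k. if k = j then 1 else 0)" by (simp add: tail_weights_def)
    moreover have "tail_combination z j j (\<lambda>k. if k = j then 1 else 0) = z j"
      by (auto simp: tail_combination_def)
    ultimately show ?thesis unfolding A_def by force
  qed
  have A_mono: "A j \<subseteq> A i" if "i \<le> j" for i j
  proof
    fix v assume "v \<in> A j"
    then obtain n w where *: "v = p_mass M p (tail_combination z j n w)" "tail_weights j n w"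
      by (auto simp: A_def)
    have "tail_combination z i n w = tail_combination z j n w"
      by (rule ext) (rule tail_combination_extend[OF *(2) that le_refl])
    then show "v \<in> A i" using * tail_weights_mono[OF *(2) that] by (force simp: A_def)
  qed
  have m_mono: "m i \<le> m j" if "i \<le> j" for i j
    unfolding m_def using single A_mono[OF that] bdd by (intro cInf_superset_mono) auto
  have m_le: "m j \<le> B" for j
    using cInf_lower[OF single bdd] B unfolding m_def by (meson order_trans)
  have "\<exists>n w. tail_weights j n w \<and> p_mass M p (tail_combination z j n w) < m j + 1 / Suc j" for j
  proof -
    have "Inf (A j) < m j + 1 / Suc j" by (simp add: m_def)
    then obtain v where "v \<in> A j" "v < m j + 1 / Suc j"
      using cInf_lessD[of "A j"] single by blast
    then show ?thesis by (auto simp: A_def)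
  qed
  then obtain n w where nw: "\<And>j. tail_weights j (n j) (w j)"
    "\<And>j. p_mass M p (tail_combination z j (n j) (w j)) < m j + 1 / Suc j" by metis
  define y where "y j = tail_combination z j (n j) (w j)" for j
  have y: "pow_integrable M p (y j)" for j unfolding y_def by (rule pi)
  have y_le: "p_mass M p (y j) \<le> B + 1" for j
    using nw(2)[of j] m_le[of j] by (simp add: y_def) (smt (verit) divide_le_eq_1 of_nat_0_le_iff)
  define L where "L = (SUP j. m j)"
  have "m \<longlonglongrightarrow> L" unfolding L_def
    using m_le m_mono by (intro LIMSEQ_incseq_SUP) (auto simp: incseq_def intro!: bdd_aboveI[of _ B])
  have m_L: "m j \<le> L" for j unfolding L_def
    using m_le by (intro cSUP_upper) (auto intro!: bdd_aboveI[of _ B])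
  have "p_cauchy M p y"
    unfolding p_cauchy_def
  proof (intro allI impI)
    fix \<epsilon> :: real assume e: "0 < \<epsilon>"
    have B1: "0 < B + 1" using order_trans[OF p_mass_nonneg B] by (simp add: add_nonneg_pos)
    \<comment> \<open>The masses of \<open>y k\<close> and \<open>y l\<close> add up to at most \<open>2 (B + 1)\<close>, so the first term costs \<open>\<epsilon> / 2\<close>.\<close>
    define \<delta> where "\<delta> = \<epsilon> / (4 * (B + 1))"
    have d: "0 < \<delta>" using e B1 by (simp add: \<delta>_def)
    obtain C where C: "0 < C" "\<And>a b :: 'b. norm (a - b) powr p \<le> \<delta> * (norm a powr p + norm b powr p)
      + C * ((norm a powr p + norm b powr p) / 2 - norm ((1/2) *\<^sub>R (a + b)) powr p)"
      using uniform_convexity_powr[OF p d] by blast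
    have "(\<lambda>j. L - m j + 1 / real (Suc j)) \<longlonglongrightarrow> L - L + 0"
      by (intro tendsto_add tendsto_diff tendsto_const \<open>m \<longlonglongrightarrow> L\<close> LIMSEQ_Suc[OF lim_const_over_n])
    then have "eventually (\<lambda>j. L - m j + 1 / real (Suc j) < \<epsilon> / (4 * C)) sequentially"
      using e C by (intro order_tendstoD) auto
    then obtain J where J: "L - m J + 1 / real (Suc J) < \<epsilon> / (4 * C)"
      by (auto simp: eventually_sequentially)
    have "p_mass M p (\<lambda>x. y k x - y l x) < \<epsilon>" if kl: "J \<le> k" "J \<le> l" for k l
    proof -
      define h where "h x = (1/2) *\<^sub>R (y k x + y l x)" for x
      have h: "pow_integrable M p h" unfolding h_def[abs_def]
        using y p by (intro pow_integrable_scaleR pow_integrable_add) auto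
      have near: "p_mass M p (y i) \<le> L + 1 / Suc J" if "J \<le> i" for i
      proof -
        have "1 / real (Suc i) \<le> 1 / real (Suc J)" using that by (simp add: field_simps)
        then show ?thesis using nw(2)[of i] m_L[of i] by (simp add: y_def)
      qed
      have inA: "p_mass M p h \<in> A J"
      proof -
        note tk = tail_weights_mono[OF nw(1)[of k] kl(1)] and tl = tail_weights_mono[OF nw(1)[of l] kl(2)]
        have "tail_combination z J (n k) (w k) = y k" "tail_combination z J (n l) (w l) = y l"
          unfolding y_def by (rule ext, rule tail_combination_extend[OF nw(1) _ le_refl], rule kl)+
        then have "h = tail_combination z J (max (n k) (n l)) (\<lambda>i. (w k i + w l i) / 2)"
          using tail_combination_midpoint[OF tk tl, of z] by (auto simp: h_def)
        then show ?thesis using tail_weights_midpoint[OF tk tl] by (force simp: A_def)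
      qed
      have hm: "m J \<le> p_mass M p h" unfolding m_def by (rule cInf_lower[OF inA bdd])
      note i = pow_integrable_integrable[OF y, of k] pow_integrable_integrable[OF y, of l] pow_integrable_integrable[OF h]
      have "p_mass M p (\<lambda>x. y k x - y l x) \<le> (\<integral>x. \<delta> * (norm (y k x) powr p + norm (y l x) powr p)
        + C * ((norm (y k x) powr p + norm (y l x) powr p) / 2 - norm (h x) powr p) \<partial>M)"
        unfolding p_mass_def
      proof (rule integral_mono)
        show "integrable M (\<lambda>x. norm (y k x - y l x) powr p)"
          using p by (intro pow_integrable_integrable pow_integrable_diff y) auto
        show "integrable M (\<lambda>x. \<delta> * (norm (y k x) powr p + norm (y l x) powr p)
          + C * ((norm (y k x) powr p + norm (y l x) powr p) / 2 - norm (h x) powr p))"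
          using i by simp
      qed (unfold h_def, rule C(2))
      also have "\<dots> = \<delta> * (p_mass M p (y k) + p_mass M p (y l))
          + C * ((p_mass M p (y k) + p_mass M p (y l)) / 2 - p_mass M p h)"
        using i by (simp add: p_mass_def)
      also have "\<dots> \<le> \<delta> * (2 * (B + 1)) + C * (L + 1 / Suc J - m J)"
      proof (intro add_mono mult_left_mono)
        show "p_mass M p (y k) + p_mass M p (y l) \<le> 2 * (B + 1)" using y_le[of k] y_le[of l] by simp
        show "(p_mass M p (y k) + p_mass M p (y l)) / 2 - p_mass M p h \<le> L + 1 / Suc J - m J"
          using near[OF kl(1)] near[OF kl(2)] hm by argo
      qed (use d C in auto)
      also have "\<dots> < \<epsilon>"
      proof -
        have "\<delta> * (2 * (B + 1)) = \<epsilon> / 2" using B1 by (simp add: \<delta>_def field_simps)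
        moreover have "C * (L + 1 / Suc J - m J) < \<epsilon> / 2"
        proof -
          have "C * (L + 1 / Suc J - m J) < C * (\<epsilon> / (4 * C))"
            using J C by (intro mult_strict_left_mono) (simp_all only: algebra_simps)
          also have "\<dots> = \<epsilon> / 4" using C by simp
          also have "\<dots> < \<epsilon> / 2" using e by simp
          finally show ?thesis .
        qed
        ultimately show ?thesis by linarith
      qed
      finally show ?thesis .
    qed
    then show "\<exists>K. \<forall>k\<ge>K. \<forall>l\<ge>K. p_mass M p (\<lambda>x. y k x - y l x) < \<epsilon>" by blast
  qed
  then show ?thesis using that nw(1) unfolding y_def by blast
qed

section \<open>Smooth functions and bump functions\<close>

text \<open>Lets the induction on the order of differentiability run with explicit derivatives instead of
  the derivative chosen by \<^const>\<open>frechet_derivative\<close>.\<close>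

lemma C_k_SucI:
  assumes "\<And>x. (\<phi> has_derivative \<phi>' x) (at x)" "\<And>b. b \<in> Basis \<Longrightarrow> C_k k (\<lambda>x. \<phi>' x b)"
  shows "C_k (Suc k) \<phi>"
proof -
  have "frechet_derivative \<phi> (at x) = \<phi>' x" for x
    using frechet_derivative_at[OF assms(1)] by simp
  then show ?thesis using assms by (auto simp: differentiable_def)
qed

lemma C_k_Suc_has_derivative:
  assumes "C_k (Suc k) \<phi>"
  shows "(\<phi> has_derivative frechet_derivative \<phi> (at x)) (at x)"
  using assms by (simp add: frechet_derivative_works[symmetric])

lemma C_k_Suc_partial:
  assumes "C_k (Suc k) \<phi>" "b \<in> Basis"
  shows "C_k k (\<lambda>x. frechet_derivative \<phi> (at x) b)"
  using assms by simp

lemma C_k_SucD: "C_k (Suc k) \<phi> \<Longrightarrow> C_k k \<phi>"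
proof (induction k arbitrary: \<phi>)
  case 0
  then have "\<And>x. isCont \<phi> x" using C_k_Suc_has_derivative[OF 0] has_derivative_continuous by blast
  then show ?case by (simp add: continuous_on_eq_continuous_at)
next
  case (Suc k)
  show ?case
    by (rule C_k_SucI[OF C_k_Suc_has_derivative[OF Suc.prems] Suc.IH[OF C_k_Suc_partial[OF Suc.prems]]])
qed

lemma C_k_continuous: "C_k k \<phi> \<Longrightarrow> continuous_on UNIV \<phi>"
proof (induction k)
  case (Suc k)
  then show ?case using C_k_SucD by blast
qed simp

lemma C_k_const: "C_k k (\<lambda>x. c)"
proof (induction k arbitrary: c)
  case (Suc k)
  show ?case by (rule C_k_SucI[where \<phi>'="\<lambda>x y. 0"]) (auto intro: Suc)
qed simp

lemma C_k_add: "C_k k \<phi> \<Longrightarrow> C_k k \<psi> \<Longrightarrow> C_k k (\<lambda>x. \<phi> x + \<psi> x)"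
proof (induction k arbitrary: \<phi> \<psi>)
  case 0
  then show ?case by (auto intro: continuous_intros)
next
  case (Suc k)
  show ?case
    by (rule C_k_SucI[OF has_derivative_add[OF Suc.prems[THEN C_k_Suc_has_derivative]]])
       (rule Suc.IH[OF Suc.prems[THEN C_k_Suc_partial]])
qed

lemma C_k_scaleR: "C_k k \<phi> \<Longrightarrow> C_k k (\<lambda>x. c *\<^sub>R \<phi> x)"
proof (induction k arbitrary: \<phi>)
  case 0
  then show ?case by (auto intro: continuous_intros)
next
  case (Suc k)
  show ?case
    by (rule C_k_SucI[OF has_derivative_scaleR_right[OF Suc.prems[THEN C_k_Suc_has_derivative]]])
       (rule Suc.IH[OF Suc.prems[THEN C_k_Suc_partial]])
qed

lemma C_k_mult:
  fixes \<phi> \<psi> :: "'a::euclidean_space \<Rightarrow> real"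
  shows "C_k k \<phi> \<Longrightarrow> C_k k \<psi> \<Longrightarrow> C_k k (\<lambda>x. \<phi> x * \<psi> x)"
proof (induction k arbitrary: \<phi> \<psi>)
  case 0
  then show ?case by (auto intro: continuous_intros)
next
  case (Suc k)
  show ?case
    by (rule C_k_SucI[OF has_derivative_mult[OF Suc.prems[THEN C_k_Suc_has_derivative]]])
       (intro C_k_add Suc.IH Suc.prems[THEN C_k_SucD] Suc.prems[THEN C_k_Suc_partial])
qed

lemma C_k_prod:
  fixes \<phi> :: "'i \<Rightarrow> 'a::euclidean_space \<Rightarrow> real"
  assumes "finite I" "\<And>i. i \<in> I \<Longrightarrow> C_k k (\<phi> i)"
  shows "C_k k (\<lambda>x. \<Prod>i\<in>I. \<phi> i x)"
  using assms by (induction I rule: finite_induct) (auto intro: C_k_const C_k_mult)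

text \<open>The functions \<open>P(1/t) exp(-1/t)\<close>, extended by \<open>0\<close> to \<open>t \<le> 0\<close>, for all polynomials \<open>P\<close>.  This class
  is closed under differentiation, so that smoothness follows by one induction over all \<open>P\<close>
  simultaneously; \<open>P = 1\<close> is the standard flat function.\<close>

definition flat_exp :: "real poly \<Rightarrow> real \<Rightarrow> real" where
  "flat_exp P t = (if 0 < t then poly P (1 / t) * exp (- 1 / t) else 0)"

lemma flat_exp_tendsto_0: "(flat_exp P \<longlongrightarrow> 0) (at 0)"
proof -
  have "((\<lambda>s. \<Sum>i\<le>degree P. coeff P i * (s ^ i / exp s)) \<longlongrightarrow> (\<Sum>i\<le>degree P. coeff P i * 0)) at_top"
    by (intro tendsto_intros tendsto_power_div_exp_0)
  then have "((\<lambda>s. poly P s * exp (- s)) \<longlongrightarrow> 0) at_top"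
    by (simp add: poly_altdef exp_minus sum_distrib_right divide_inverse mult.assoc)
  then have "((\<lambda>t. poly P (inverse t) * exp (- inverse t)) \<longlongrightarrow> 0) (at_right 0)"
    by (rule filterlim_compose[OF _ filterlim_inverse_at_top_right])
  then have "(flat_exp P \<longlongrightarrow> 0) (at_right 0)"
    by (rule Lim_transform_eventually)
       (auto simp: eventually_at_right_less flat_exp_def inverse_eq_divide intro!: eventually_mono[OF eventually_at_right_less])
  moreover have "(flat_exp P \<longlongrightarrow> 0) (at_left 0)"
    by (rule Lim_transform_eventually[OF tendsto_const])
       (auto simp: flat_exp_def eventually_at_left_field intro!: exI[of _ "-1"])
  ultimately show ?thesis by (simp add: filterlim_split_at)
qed

definition flat_exp_deriv :: "real poly \<Rightarrow> real poly" where
  "flat_exp_deriv P = monom 1 2 * (P - pderiv P)"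

text \<open>At \<open>0\<close> the difference quotient of \<^term>\<open>flat_exp P\<close> is \<^const>\<open>flat_exp\<close> of the polynomial \<open>X P\<close>,
  so it tends to \<open>0\<close> for the same reason as the function itself.\<close>

lemma flat_exp_has_real_derivative:
  "(flat_exp P has_real_derivative flat_exp (flat_exp_deriv P) t) (at t)"
proof (cases t "0 :: real" rule: linorder_cases)
  case less
  have "((\<lambda>t. 0) has_real_derivative 0) (at t)" by simp
  then have "(flat_exp P has_real_derivative 0) (at t)"
    by (rule has_field_derivative_transform_within_open[where S="{..<0}"]) (use less in \<open>auto simp: flat_exp_def\<close>)
  then show ?thesis using less by (simp add: flat_exp_def)
next
  case equal
  have "(flat_exp (monom 1 1 * P) \<longlongrightarrow> 0) (at 0)" by (rule flat_exp_tendsto_0)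
  then have "((\<lambda>h. (flat_exp P (0 + h) - flat_exp P 0) / h) \<longlongrightarrow> 0) (at 0)"
    by (rule Lim_transform_eventually)
       (auto simp: flat_exp_def poly_monom eventually_at_filter)
  then show ?thesis using equal by (simp add: DERIV_def flat_exp_def)
next
  case greater
  have "((\<lambda>t. poly P (1 / t) * exp (- 1 / t)) has_real_derivative flat_exp (flat_exp_deriv P) t) (at t)"
    using greater
    by (auto intro!: derivative_eq_intros DERIV_chain2[OF poly_DERIV]
        simp: flat_exp_def flat_exp_deriv_def poly_monom field_simps power2_eq_square)
  then show ?thesis
    by (rule has_field_derivative_transform_within_open[where S="{0<..}"])
       (use greater in \<open>auto simp: flat_exp_def\<close>)
qed

lemma C_k_flat_exp_affine:
  fixes c :: "'a::euclidean_space"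
  shows "C_k k (\<lambda>x. flat_exp P (x \<bullet> c + d))"
proof (induction k arbitrary: P)
  case 0
  have "continuous_on UNIV (flat_exp P)"
    using flat_exp_has_real_derivative by (meson DERIV_isCont continuous_at_imp_continuous_on)
  then have "continuous_on UNIV (\<lambda>x. flat_exp P (x \<bullet> c + d))"
    by (rule continuous_on_compose2) (auto intro!: continuous_intros)
  then show ?case by simp
next
  case (Suc k)
  show ?case
  proof (rule C_k_SucI)
    fix x :: 'a
    have "(flat_exp P has_derivative (*) (flat_exp (flat_exp_deriv P) (x \<bullet> c + d))) (at (x \<bullet> c + d))"
      using flat_exp_has_real_derivative by (simp add: has_field_derivative_def)
    moreover have "((\<lambda>x. x \<bullet> c + d) has_derivative (\<lambda>h. h \<bullet> c)) (at x)"
      by (auto intro!: derivative_eq_intros)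
    ultimately show "((\<lambda>x. flat_exp P (x \<bullet> c + d)) has_derivative
        (\<lambda>h. flat_exp (flat_exp_deriv P) (x \<bullet> c + d) * (h \<bullet> c))) (at x)"
      using has_derivative_compose[of "\<lambda>x. x \<bullet> c + d"] by blast
  next
    fix b :: 'a
    show "C_k k (\<lambda>x. flat_exp (flat_exp_deriv P) (x \<bullet> c + d) * (b \<bullet> c))"
      by (intro C_k_mult Suc C_k_const)
  qed
qed

text \<open>Smooth, positive exactly on the open box, and increasing to its indicator: for \<open>s > 0\<close> the value
  \<open>exp (- 1 / (m s))\<close> tends to \<open>1\<close> as \<open>m\<close> grows, while it stays \<open>0\<close> for \<open>s \<le> 0\<close>.\<close>

definition box_bump :: "'a::euclidean_space \<Rightarrow> 'a \<Rightarrow> nat \<Rightarrow> 'a \<Rightarrow> real" where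
  "box_bump a b m x = (\<Prod>i\<in>Basis. flat_exp 1 (real (Suc m) * (x \<bullet> i - a \<bullet> i))
                            * flat_exp 1 (real (Suc m) * (b \<bullet> i - x \<bullet> i)))"

lemma box_bump_C_k: "C_k k (box_bump a b m)"
proof -
  have "C_k k (\<lambda>x. flat_exp 1 (real (Suc m) * (x \<bullet> i - a \<bullet> i)))" for i
    using C_k_flat_exp_affine[of k 1 "real (Suc m) *\<^sub>R i" "- (real (Suc m) * (a \<bullet> i))"]
    by (simp only: right_diff_distrib inner_scaleR_right add_uminus_conv_diff)
  moreover have "C_k k (\<lambda>x. flat_exp 1 (real (Suc m) * (b \<bullet> i - x \<bullet> i)))" for i
    using C_k_flat_exp_affine[of k 1 "(- real (Suc m)) *\<^sub>R i" "real (Suc m) * (b \<bullet> i)"]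
    by (simp only: right_diff_distrib inner_scaleR_right) (simp add: algebra_simps)
  ultimately show ?thesis
    unfolding box_bump_def[abs_def] by (intro C_k_prod C_k_mult) auto
qed

lemma flat_exp_1_bounds: "0 \<le> flat_exp 1 t" "flat_exp 1 t \<le> 1" "flat_exp 1 t \<noteq> 0 \<longleftrightarrow> 0 < t"
  by (auto simp: flat_exp_def)

lemma box_bump_nonzero: "box_bump a b m x \<noteq> 0 \<longleftrightarrow> x \<in> box a b"
  by (auto simp: box_bump_def flat_exp_1_bounds mem_box zero_less_mult_iff)

lemma box_bump_bounds: "0 \<le> box_bump a b m x" "box_bump a b m x \<le> 1"
  unfolding box_bump_def
  by (auto intro!: prod_nonneg prod_le_1 mult_nonneg_nonneg mult_le_one flat_exp_1_bounds)

lemma flat_exp_1_scaled_tendsto: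
  assumes "0 < s"
  shows "(\<lambda>m. flat_exp 1 (real (Suc m) * s)) \<longlonglongrightarrow> 1"
proof -
  have "(\<lambda>m. exp (- ((1 / s) * inverse (real (Suc m))))) \<longlonglongrightarrow> exp (- ((1 / s) * 0))"
    by (intro tendsto_intros LIMSEQ_inverse_real_of_nat)
  moreover have "flat_exp 1 (real (Suc m) * s) = exp (- ((1 / s) * inverse (real (Suc m))))" for m
    using assms by (simp add: flat_exp_def field_simps zero_less_mult_iff del: of_nat_Suc)
  ultimately show ?thesis by simp
qed

lemma box_bump_tendsto: "(\<lambda>m. box_bump a b m x) \<longlonglongrightarrow> indicator (box a b) x"
proof (cases "x \<in> box a b")
  case True
  have "(\<lambda>m. box_bump a b m x) \<longlonglongrightarrow> (\<Prod>i\<in>(Basis::'a set). 1 * 1)"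
    unfolding box_bump_def
    by (intro tendsto_prod tendsto_mult flat_exp_1_scaled_tendsto) (use True in \<open>auto simp: mem_box\<close>)
  then show ?thesis using True by simp
next
  case False
  then have "box_bump a b m x = 0" for m using box_bump_nonzero by blast
  then show ?thesis using False by simp
qed

lemma box_bump_test_function:
  assumes "cbox a b \<subseteq> \<Omega>"
  shows "box_bump a b m \<in> test_functions \<Omega>"
proof -
  have "{x. box_bump a b m x \<noteq> 0} = box a b" using box_bump_nonzero by auto
  moreover have "closure (box a b) \<subseteq> cbox a b" by (intro closure_minimal box_subset_cbox closed_cbox)
  ultimately show ?thesis
    using assms box_bump_C_k by (auto simp: test_functions_def compact_closure bounded_box)
qed

lemma test_functions_add:
  assumes "\<phi> \<in> test_functions \<Omega>" "\<psi> \<in> test_functions \<Omega>"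
  shows "(\<lambda>x. \<phi> x + \<psi> x) \<in> test_functions \<Omega>"
proof -
  have "{x. \<phi> x + \<psi> x \<noteq> 0} \<subseteq> {x. \<phi> x \<noteq> 0} \<union> {x. \<psi> x \<noteq> 0}" by auto
  from closure_mono[OF this] have sub: "closure {x. \<phi> x + \<psi> x \<noteq> 0} \<subseteq> closure {x. \<phi> x \<noteq> 0} \<union> closure {x. \<psi> x \<noteq> 0}"
    by (simp only: closure_Un)
  moreover have "compact (closure {x. \<phi> x \<noteq> 0} \<union> closure {x. \<psi> x \<noteq> 0})"
    using assms by (auto simp: test_functions_def)
  ultimately have "compact (closure {x. \<phi> x + \<psi> x \<noteq> 0})"
    unfolding compact_eq_bounded_closed using bounded_subset by blast
  then show ?thesis using assms sub by (auto simp: test_functions_def intro: C_k_add)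
qed

lemma test_functions_scaleR:
  assumes "\<phi> \<in> test_functions \<Omega>"
  shows "(\<lambda>x. c *\<^sub>R \<phi> x) \<in> test_functions \<Omega>"
proof -
  have sub: "closure {x. c *\<^sub>R \<phi> x \<noteq> 0} \<subseteq> closure {x. \<phi> x \<noteq> 0}"
    by (intro closure_mono) auto
  then have "compact (closure {x. c *\<^sub>R \<phi> x \<noteq> 0})"
    using assms bounded_subset unfolding test_functions_def compact_eq_bounded_closed by blast
  then show ?thesis using assms sub by (auto simp: test_functions_def intro: C_k_scaleR)
qed

lemma test_functions_has_derivative:
  assumes "\<phi> \<in> test_functions \<Omega>"
  shows "(\<phi> has_derivative frechet_derivative \<phi> (at x)) (at x)"
proof -
  have "C_k (Suc 0) \<phi>" using assms unfolding test_functions_def by blast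
  then show ?thesis by (rule C_k_Suc_has_derivative)
qed

lemma test_functions_partial_continuous:
  fixes \<phi> :: "'a::euclidean_space \<Rightarrow> 'b::euclidean_space"
  assumes "\<phi> \<in> test_functions \<Omega>" 
  shows "continuous_on UNIV (\<lambda>x. frechet_derivative \<phi> (at x) h)"
proof -
  have "continuous_on UNIV (\<lambda>x. \<Sum>b\<in>Basis. (h \<bullet> b) *\<^sub>R frechet_derivative \<phi> (at x) b)"
  proof (intro continuous_intros)
    fix b :: 'a assume b: "b \<in> Basis"
    have "C_k (Suc 0) \<phi>" using assms unfolding test_functions_def by blast
    from C_k_Suc_partial[OF this b] show "continuous_on UNIV (\<lambda>x. frechet_derivative \<phi> (at x) b)" by simp
  qed
  moreover have "frechet_derivative \<phi> (at x) h = (\<Sum>b\<in>Basis. (h \<bullet> b) *\<^sub>R frechet_derivative \<phi> (at x) b)" for x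
  proof -
    have lin: "linear (frechet_derivative \<phi> (at x))"
      using test_functions_has_derivative[OF assms] has_derivative_linear by blast
    have "frechet_derivative \<phi> (at x) h = frechet_derivative \<phi> (at x) (\<Sum>b\<in>Basis. (h \<bullet> b) *\<^sub>R b)"
      by (simp add: euclidean_representation)
    then show ?thesis by (simp add: linear_sum[OF lin] linear_scale[OF lin])
  qed
  ultimately show ?thesis by simp
qed

lemma test_functions_zero_outside:
  assumes "\<phi> \<in> test_functions \<Omega>" "x \<notin> \<Omega>"
  shows "\<phi> x = 0" and "frechet_derivative \<phi> (at x) h = 0"
proof -
  let ?K = "closure {x. \<phi> x \<noteq> 0}"
  have x: "x \<notin> ?K" using assms by (auto simp: test_functions_def)
  then show "\<phi> x = 0" using closure_subset[of "{x. \<phi> x \<noteq> 0}"] by blast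
  have "((\<lambda>x. 0) has_derivative (\<lambda>h. 0)) (at x)" by simp
  then have "(\<phi> has_derivative (\<lambda>h. 0)) (at x)"
    by (rule has_derivative_transform_within_open[where s="- ?K"])
       (use x closure_subset[of "{x. \<phi> x \<noteq> 0}"] in auto)
  then have "frechet_derivative \<phi> (at x) = (\<lambda>h. 0)" using frechet_derivative_at by metis
  then show "frechet_derivative \<phi> (at x) h = 0" by simp
qed

section \<open>The fundamental lemma and integration by parts\<close>

text \<open>Open boxes are stable under intersection and generate the Borel sets, so by Dynkin's
  \<open>\<pi>\<close>-\<open>\<lambda>\<close> theorem the integral vanishes over every Borel set.  The integral over the whole space
  is what makes the property pass to complements.\<close>

lemma integrable_lborel_box_zero_imp_AE_zero:
  fixes f :: "'a::euclidean_space \<Rightarrow> real"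
  assumes f: "integrable lborel f" and tot: "(\<integral>x. f x \<partial>lborel) = 0"
    and box: "\<And>u v. (LINT x:box u v|lborel. f x) = 0"
  shows "AE x in lborel. f x = 0"
proof -
  have si: "set_integrable lborel A f" if "A \<in> sets borel" for A
    unfolding set_integrable_def using f that by (intro integrable_mult_indicator) auto
  have "(LINT x:A|lborel. f x) = 0" if A: "A \<in> sets borel" for A
  proof -
    have gen: "A \<in> sigma_sets UNIV (range (\<lambda>(a, b). box a b :: 'a set))"
      using A by (subst (asm) borel_eq_box) simp
    have stable: "Int_stable (range (\<lambda>(a, b). box a b :: 'a set))"
      by (auto simp: Int_stable_def box_Int_box)
    have in_borel: "B \<in> sets borel" if "B \<in> sigma_sets UNIV (range (\<lambda>(a, b). box a b :: 'a set))" for B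
      using that by (subst borel_eq_box) simp
    have pow: "range (\<lambda>(a, b). box a b :: 'a set) \<subseteq> Pow UNIV" by simp
    from stable pow gen show ?thesis
    proof (induction A rule: sigma_sets_induct_disjoint)
      case (basic A)
      then show ?case using box by auto
    next
      case empty
      then show ?case by (simp add: set_lebesgue_integral_def)
    next
      case (compl A)
      have "(LINT x:UNIV - A|lborel. f x) = (\<integral>x. f x - indicator A x *\<^sub>R f x \<partial>lborel)"
        unfolding set_lebesgue_integral_def
        by (intro Bochner_Integration.integral_cong) (auto simp: indicator_def)
      also have "\<dots> = 0"
        using compl(2) tot f si[OF in_borel[OF compl(1)]]
        by (simp add: set_lebesgue_integral_def set_integrable_def)
      finally show ?case .
    next
      case (union A)
      then have "range A \<subseteq> sets borel" using in_borel by blast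
      then have "(LINT x:(\<Union>i. A i)|lborel. f x) = (\<Sum>i. (LINT x:(A i)|lborel. f x))"
        using union by (intro lebesgue_integral_countable_add si sets.countable_UN)
           (auto simp: disjoint_family_on_def)
      then show ?case using union by simp
    qed
  qed
  then show ?thesis
    by (intro density_unique_real[OF f]) (auto simp: set_lebesgue_integral_def)
qed

lemma integrable_box_zero_imp_AE_zero:
  fixes f :: "'a::euclidean_space \<Rightarrow> real"
  assumes f: "integrable lebesgue f" and tot: "(\<integral>x. f x \<partial>lebesgue) = 0"
    and box: "\<And>u v. (LINT x:box u v|lebesgue. f x) = 0"
  shows "AE x in lebesgue. f x = 0"
proof -
  obtain f' where f': "f' \<in> borel_measurable lborel" "AE x in lborel. f x = f' x"
    using completion_ex_borel_measurable_real[OF borel_measurable_integrable[OF f]] by auto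
  have mf: "f \<in> borel_measurable lebesgue" and mf': "f' \<in> borel_measurable lebesgue"
    using f f'(1) by (auto intro: measurable_completion)
  have ae: "AE x in lebesgue. f x = f' x" using f'(2) by (rule AE_completion)
  have "integrable lebesgue f' \<longleftrightarrow> integrable lebesgue f"
    using ae by (intro integrable_cong_AE) (auto intro: mf mf')
  then have "integrable lborel f'" using f f'(1) integrable_completion by blast
  moreover have "(\<integral>x. f' x \<partial>lborel) = 0"
  proof -
    have "(\<integral>x. f' x \<partial>lborel) = (\<integral>x. f' x \<partial>lebesgue)" using f'(1) by (simp add: integral_completion)
    also have "\<dots> = (\<integral>x. f x \<partial>lebesgue)"
      using ae by (intro integral_cong_AE) (auto intro: mf mf')
    finally show ?thesis using tot by simp
  qed
  moreover have "(LINT x:box u v|lborel. f' x) = 0" for u v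
  proof -
    have "(LINT x:box u v|lborel. f' x) = (LINT x:box u v|lebesgue. f' x)"
      using f'(1) unfolding set_lebesgue_integral_def by (subst integral_completion) auto
    also have "\<dots> = (LINT x:box u v|lebesgue. f x)"
      unfolding set_lebesgue_integral_def using ae
      by (intro integral_cong_AE borel_measurable_scaleR borel_measurable_indicator mf mf') auto
    finally show ?thesis using box by simp
  qed
  ultimately have "AE x in lborel. f' x = 0" by (rule integrable_lborel_box_zero_imp_AE_zero)
  then have "AE x in lebesgue. f' x = 0" by (rule AE_completion)
  with ae show ?thesis by eventually_elim simp
qed

lemma integrable_lebesgue_on_iff:
  fixes f :: "'a::euclidean_space \<Rightarrow> 'b::euclidean_space"
  assumes "S \<in> sets lebesgue"
  shows "integrable (lebesgue_on S) f \<longleftrightarrow> integrable lebesgue (\<lambda>x. indicator S x *\<^sub>R f x)"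
  using assms by (intro integrable_restrict_space) auto

lemma integral_lebesgue_on_eq:
  fixes f :: "'a::euclidean_space \<Rightarrow> 'b::euclidean_space"
  assumes "S \<in> sets lebesgue"
  shows "(LINT x|lebesgue_on S. f x) = (LINT x|lebesgue. indicator S x *\<^sub>R f x)"
  using assms by (intro integral_restrict_space) auto

text \<open>Testing with \<^const>\<open>box_bump\<close> and passing to the limit shows that \<open>g\<close> has integral \<open>0\<close> over every
  open box whose closure lies in \<open>\<Omega>\<close>, hence vanishes almost everywhere on such a box.  Countably
  many closed boxes cover \<open>\<Omega>\<close>, and their boundaries are negligible.\<close>

theorem fundamental_lemma_calculus_of_variations:
  fixes g :: "'a::euclidean_space \<Rightarrow> real"
  assumes \<Omega>: "open \<Omega>" and g: "locally_integrable \<Omega> g"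
    and zero: "\<And>\<phi>. \<phi> \<in> test_functions \<Omega> \<Longrightarrow> (LINT x|lebesgue_on \<Omega>. g x * \<phi> x) = 0"
  shows "AE x in lebesgue_on \<Omega>. g x = 0"
proof -
  have int_box: "integrable lebesgue (\<lambda>x. indicator (cbox a b) x * g x)" if "cbox a b \<subseteq> \<Omega>" for a b
    using g that integrable_lebesgue_on_iff[of "cbox a b" g] by (simp add: locally_integrable_def)
  have box0: "(\<integral>x. indicator (box a b) x * g x \<partial>lebesgue) = 0" if ab: "cbox a b \<subseteq> \<Omega>" for a b
  proof -
    have "(\<lambda>m. \<integral>x. (indicator (cbox a b) x * g x) * box_bump a b m x \<partial>lebesgue)
       \<longlonglongrightarrow> (\<integral>x. (indicator (cbox a b) x * g x) * indicator (box a b) x \<partial>lebesgue)"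
    proof (rule integral_dominated_convergence[where w="\<lambda>x. norm (indicator (cbox a b) x * g x)"])
      show "(\<lambda>x. (indicator (cbox a b) x * g x) * box_bump a b m x) \<in> borel_measurable lebesgue" for m
      proof (rule borel_measurable_times)
        show "(\<lambda>x. indicator (cbox a b) x * g x) \<in> borel_measurable lebesgue"
          using int_box[OF ab] by auto
        have "box_bump a b m \<in> borel_measurable borel"
          using C_k_continuous[OF box_bump_C_k] by (rule borel_measurable_continuous_onI)
        then show "box_bump a b m \<in> borel_measurable lebesgue" by (simp add: measurable_completion)
      qed
      show "(\<lambda>x. (indicator (cbox a b) x * g x) * indicator (box a b) x) \<in> borel_measurable lebesgue"
        using borel_measurable_integrable[OF int_box[OF ab]] by (rule borel_measurable_times)
           (rule borel_measurable_indicator, simp)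
      show "integrable lebesgue (\<lambda>x. norm (indicator (cbox a b) x * g x))"
        using int_box[OF ab] by (rule integrable_norm)
      show "AE x in lebesgue. (\<lambda>m. (indicator (cbox a b) x * g x) * box_bump a b m x)
          \<longlonglongrightarrow> (indicator (cbox a b) x * g x) * indicator (box a b) x"
        by (intro AE_I2 tendsto_mult tendsto_const box_bump_tendsto)
      show "AE x in lebesgue. norm ((indicator (cbox a b) x * g x) * box_bump a b m x)
          \<le> norm (indicator (cbox a b) x * g x)" for m
        by (intro AE_I2) (auto simp: abs_mult abs_of_nonneg[OF box_bump_bounds(1)] box_bump_bounds intro!: mult_left_le)
    qed
    moreover have "(\<integral>x. (indicator (cbox a b) x * g x) * box_bump a b m x \<partial>lebesgue) = 0" for m
    proof -
      have "(\<integral>x. (indicator (cbox a b) x * g x) * box_bump a b m x \<partial>lebesgue)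
         = (\<integral>x. indicator \<Omega> x *\<^sub>R (g x * box_bump a b m x) \<partial>lebesgue)"
        using ab box_bump_nonzero[of a b m] box_subset_cbox[of a b]
        by (intro Bochner_Integration.integral_cong refl) (auto simp: indicator_def)
      also have "\<dots> = (LINT x|lebesgue_on \<Omega>. g x * box_bump a b m x)"
        using \<Omega> by (subst integral_lebesgue_on_eq) auto
      also have "\<dots> = 0" by (rule zero[OF box_bump_test_function[OF ab]])
      finally show ?thesis .
    qed
    ultimately have "(\<integral>x. (indicator (cbox a b) x * g x) * indicator (box a b) x \<partial>lebesgue) = 0"
      by (simp add: LIMSEQ_const_iff)
    moreover have "(indicator (cbox a b) x * g x) * indicator (box a b) x = indicator (box a b) x * g x" for x
      using box_subset_cbox[of a b] by (auto simp: indicator_def)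
    ultimately show ?thesis by simp
  qed
  have ae_cbox: "AE x in lebesgue. x \<in> cbox a b \<longrightarrow> g x = 0" if ab: "cbox a b \<subseteq> \<Omega>" for a b
  proof -
    have int: "integrable lebesgue (\<lambda>x. indicator (box a b) x * g x)"
    proof -
      have "integrable lebesgue (\<lambda>x. indicator (box a b) x *\<^sub>R (indicator (cbox a b) x * g x))"
        using int_box[OF ab] by (intro integrable_mult_indicator) auto
      moreover have "indicator (box a b) x *\<^sub>R (indicator (cbox a b) x * g x) = indicator (box a b) x * g x" for x
        using box_subset_cbox[of a b] by (auto simp: indicator_def)
      ultimately show ?thesis by (simp only:)
    qed
    have "AE x in lebesgue. indicator (box a b) x * g x = 0"
    proof (rule integrable_box_zero_imp_AE_zero[OF int box0[OF ab]])
      fix u v :: 'a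
      obtain c d where cd: "box u v \<inter> box a b = box c d" by (rule that[OF box_Int_box])
      have "(LINT x:box u v|lebesgue. indicator (box a b) x * g x) = (\<integral>x. indicator (box c d) x * g x \<partial>lebesgue)"
        unfolding set_lebesgue_integral_def cd[symmetric]
        by (intro Bochner_Integration.integral_cong refl) (auto simp: indicator_def)
      also have "\<dots> = 0"
      proof (cases "box c d = {}")
        case False
        have "box c d \<subseteq> box a b" using cd by blast
        then have "closure (box c d) \<subseteq> cbox a b"
          using box_subset_cbox[of a b] by (intro closure_minimal closed_cbox) blast
        then have "cbox c d \<subseteq> cbox a b" by (simp only: closure_box[OF False])
        then show ?thesis using box0 ab by blast
      qed simp
      finally show "(LINT x:box u v|lebesgue. indicator (box a b) x * g x) = 0" .
    qed
    moreover have "AE x in lebesgue. x \<notin> cbox a b - box a b"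
      using negligible_frontier_interval[of a b] by (intro AE_not_in) (simp add: negligible_iff_null_sets)
    ultimately show ?thesis by eventually_elim (auto simp: indicator_def)
  qed
  obtain D where D: "countable D" "\<And>X. X \<in> D \<Longrightarrow> X \<subseteq> \<Omega> \<and> (\<exists>a b. X = cbox a b)" "\<Union>D = \<Omega>"
    using open_countable_Union_open_cbox[OF \<Omega>] by (metis Pow_iff subsetD)
  have "AE x in lebesgue. \<forall>X\<in>D. x \<in> X \<longrightarrow> g x = 0"
    using D(2) ae_cbox by (subst AE_ball_countable[OF D(1)]) blast
  then have "AE x in lebesgue. x \<in> \<Omega> \<longrightarrow> g x = 0"
    by eventually_elim (use D(3) in blast)
  then show ?thesis using \<Omega> by (subst AE_restrict_space_iff) auto
qed

lemma C_k_inner_const: "C_k k \<phi> \<Longrightarrow> C_k k (\<lambda>x. \<phi> x \<bullet> c)"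
proof (induction k arbitrary: \<phi>)
  case 0
  then show ?case by (auto intro!: continuous_intros)
next
  case (Suc k)
  show ?case
    by (rule C_k_SucI[OF has_derivative_inner_left[OF Suc.prems[THEN C_k_Suc_has_derivative]]])
       (rule Suc.IH[OF Suc.prems[THEN C_k_Suc_partial]])
qed

lemma test_functions_restrict_support:
  assumes "\<phi> \<in> test_functions \<Omega>" "\<And>k. C_k k \<psi>" "\<And>x. \<phi> x = 0 \<Longrightarrow> \<psi> x = 0"
  shows "\<psi> \<in> test_functions \<Omega>"
proof -
  have sub: "closure {x. \<psi> x \<noteq> 0} \<subseteq> closure {x. \<phi> x \<noteq> 0}"
    using assms(3) by (intro closure_mono) auto
  then have "compact (closure {x. \<psi> x \<noteq> 0})"
    using assms(1) bounded_subset unfolding test_functions_def compact_eq_bounded_closed by blast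
  then show ?thesis using assms sub by (auto simp: test_functions_def)
qed

lemma compact_support_integrable:
  fixes g :: "'a::euclidean_space \<Rightarrow> 'b::euclidean_space"
  assumes "continuous_on UNIV g" "compact K" "\<And>x. x \<notin> K \<Longrightarrow> g x = 0"
  shows "integrable lborel g"
proof -
  have "integrable lborel (\<lambda>x. indicator K x *\<^sub>R g x)"
    using assms by (intro borel_integrable_compact) (auto intro: continuous_on_subset)
  moreover have "indicator K x *\<^sub>R g x = g x" for x using assms(3) by (auto simp: indicator_def)
  ultimately show ?thesis by simp
qed

lemma test_functions_support:
  fixes \<phi> :: "'a::euclidean_space \<Rightarrow> 'b::euclidean_space"
  assumes "\<phi> \<in> test_functions \<Omega>"
  obtains K where "compact K" "K \<subseteq> \<Omega>" "\<And>x. x \<notin> K \<Longrightarrow> \<phi> x = 0"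
    "\<And>x h. x \<notin> K \<Longrightarrow> frechet_derivative \<phi> (at x) h = 0"
proof
  let ?K = "closure {x. \<phi> x \<noteq> 0}"
  show "compact ?K" "?K \<subseteq> \<Omega>" using assms by (auto simp: test_functions_def)
  have "\<phi> \<in> test_functions ?K" using assms by (auto simp: test_functions_def)
  then show "x \<notin> ?K \<Longrightarrow> \<phi> x = 0" "x \<notin> ?K \<Longrightarrow> frechet_derivative \<phi> (at x) h = 0" for x h
    using test_functions_zero_outside by blast+
qed

lemma test_functions_continuous: "\<phi> \<in> test_functions \<Omega> \<Longrightarrow> continuous_on UNIV \<phi>"
  using C_k_continuous by (auto simp: test_functions_def)

lemma test_function_integrable:
  assumes "\<phi> \<in> test_functions \<Omega>"
  shows "integrable lborel \<phi>" "integrable lborel (\<lambda>x. frechet_derivative \<phi> (at x) h)"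
proof -
  obtain K where K: "compact K" "K \<subseteq> \<Omega>" "\<And>x. x \<notin> K \<Longrightarrow> \<phi> x = 0"
    "\<And>x h. x \<notin> K \<Longrightarrow> frechet_derivative \<phi> (at x) h = 0" by (rule test_functions_support[OF assms]) blast
  show "integrable lborel \<phi>"
    by (rule compact_support_integrable[OF test_functions_continuous[OF assms] K(1,3)])
  show "integrable lborel (\<lambda>x. frechet_derivative \<phi> (at x) h)"
    by (rule compact_support_integrable[OF test_functions_partial_continuous[OF assms] K(1,4)])
qed

lemma test_function_line_derivative:
  assumes "\<phi> \<in> test_functions \<Omega>"
  shows "((\<lambda>t. \<phi> (x + t *\<^sub>R h)) has_vector_derivative frechet_derivative \<phi> (at (x + t *\<^sub>R h)) h) (at t within S)"
proof -
  have "((\<lambda>t. x + t *\<^sub>R h) has_vector_derivative h) (at t within S)"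
    by (auto intro!: derivative_eq_intros simp: has_vector_derivative_def)
  from vector_derivative_diff_chain_within[OF this, of \<phi>]
  show ?thesis using has_derivative_at_withinI[OF test_functions_has_derivative[OF assms]]
    by (auto simp: o_def)
qed

lemma lborel_integral_translate:
  fixes g :: "'a::euclidean_space \<Rightarrow> 'b::{banach, second_countable_topology}"
  assumes "g \<in> borel_measurable borel"
  shows "(\<integral>x. g (x + h) \<partial>lborel) = (\<integral>x. g x \<partial>lborel)"
proof -
  have "(\<integral>x. g x \<partial>lborel) = (\<integral>x. g x \<partial>distr lborel borel ((+) h))" by (simp add: lborel_distr_plus)
  also have "\<dots> = (\<integral>x. g (h + x) \<partial>lborel)" using assms by (intro integral_distr) auto
  finally show ?thesis by (simp add: add.commute)
qed

text \<open>Translation invariance gives every difference quotient integral \<open>0\<close>.  The quotients are bounded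
  by the maximum of the derivative and live in one fixed ball, so dominated convergence carries
  this to the derivative.\<close>

lemma test_function_partial_integral_zero:
  fixes \<phi> :: "'a::euclidean_space \<Rightarrow> real"
  assumes phi: "\<phi> \<in> test_functions \<Omega>"
  shows "(\<integral>x. frechet_derivative \<phi> (at x) h \<partial>lborel) = 0"
proof -
  obtain K where K: "compact K" "K \<subseteq> \<Omega>" "\<And>x. x \<notin> K \<Longrightarrow> \<phi> x = 0"
    "\<And>x h. x \<notin> K \<Longrightarrow> frechet_derivative \<phi> (at x) h = 0" by (rule test_functions_support[OF phi]) blast
  define D where "D x = frechet_derivative \<phi> (at x) h" for x
  note cont = test_functions_continuous[OF phi]
  have contD: "continuous_on UNIV D" unfolding D_def[abs_def] by (rule test_functions_partial_continuous[OF phi])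
  have "bounded (D ` K)"
    using contD K(1) by (intro compact_imp_bounded compact_continuous_image) (auto intro: continuous_on_subset)
  then obtain B where B: "0 < B" "\<And>x. x \<in> K \<Longrightarrow> norm (D x) \<le> B"
    by (metis bounded_pos imageI)
  have DB: "norm (D x) \<le> B" for x using B K(4)[of x] by (cases "x \<in> K") (auto simp: D_def)
  obtain R where R: "\<And>x. x \<in> K \<Longrightarrow> norm x \<le> R" using compact_imp_bounded[OF K(1)] by (auto simp: bounded_iff)
  define s where "s n = 1 / real (Suc n)" for n
  have s: "0 < s n" "s n \<le> 1" for n by (auto simp: s_def)
  define q where "q n x = (\<phi> (x + s n *\<^sub>R h) - \<phi> x) / s n" for n x
  have q_bound: "norm (q n x) \<le> B * indicator (cball 0 (R + norm h)) x" for n x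
  proof -
    have "\<exists>t. 0 < t \<and> t < s n \<and> \<phi> (x + s n *\<^sub>R h) - \<phi> (x + 0 *\<^sub>R h) = (s n - 0) * D (x + t *\<^sub>R h)"
      unfolding D_def
      using test_function_line_derivative[OF phi, of x h] s[of n]
      by (intro MVT2) (auto simp: has_real_derivative_iff_has_vector_derivative)
    then obtain t where t: "0 < t" "t < s n" "q n x = D (x + t *\<^sub>R h)"
      using s[of n] by (auto simp: q_def)
    have "D (x + t *\<^sub>R h) = 0" if "x \<notin> cball 0 (R + norm h)"
    proof -
      have "R + norm h < norm x" using that by simp
      also have "norm x \<le> norm (x + t *\<^sub>R h) + norm (t *\<^sub>R h)" by (metis add_diff_cancel_right' norm_triangle_ineq4)
      also have "norm (t *\<^sub>R h) \<le> norm h" using t s[of n] by (simp add: mult_left_le_one_le)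
      finally have "x + t *\<^sub>R h \<notin> K" using R by force
      then show ?thesis using K(4) by (simp add: D_def)
    qed
    then show ?thesis using t DB[of "x + t *\<^sub>R h"] by (auto simp: indicator_def)
  qed
  have q_meas: "q n \<in> borel_measurable borel" for n
    unfolding q_def[abs_def] using s[of n]
    by (intro borel_measurable_continuous_onI continuous_intros continuous_on_compose2[OF cont]) auto
  have "(\<lambda>n. \<integral>x. q n x \<partial>lborel) \<longlonglongrightarrow> (\<integral>x. D x \<partial>lborel)"
  proof (rule integral_dominated_convergence[where w="\<lambda>x. B * indicator (cball 0 (R + norm h)) x"])
    show "integrable lborel (\<lambda>x. B * indicator (cball 0 (R + norm h)) x :: real)"
      by (intro integrable_mult_right integrable_real_indicator) (auto intro!: emeasure_compact_finite[unfolded infinity_ennreal_def])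
    show "AE x in lborel. (\<lambda>n. q n x) \<longlonglongrightarrow> D x"
    proof (intro AE_I2)
      fix x
      have "((\<lambda>t. \<phi> (x + t *\<^sub>R h)) has_real_derivative D x) (at 0)"
        using test_function_line_derivative[OF phi, of x h 0 UNIV]
        by (simp add: has_real_derivative_iff_has_vector_derivative D_def)
      then have "((\<lambda>t. (\<phi> (x + t *\<^sub>R h) - \<phi> x) / t) \<longlongrightarrow> D x) (at 0)"
        by (simp add: DERIV_def)
      moreover have "filterlim s (at 0) sequentially"
        unfolding filterlim_at s_def using LIMSEQ_Suc[OF lim_const_over_n[of "1::real"]] by simp
      ultimately show "(\<lambda>n. q n x) \<longlonglongrightarrow> D x"
        unfolding q_def by (rule filterlim_compose)
    qed
  qed (use q_bound q_meas contD in \<open>auto intro: borel_measurable_continuous_onI\<close>)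
  moreover have "(\<integral>x. q n x \<partial>lborel) = 0" for n
  proof -
    have i: "integrable lborel \<phi>" by (rule test_function_integrable[OF phi])
    have "integrable lborel (\<lambda>x. \<phi> (x + s n *\<^sub>R h))"
    proof (rule compact_support_integrable)
      show "continuous_on UNIV (\<lambda>x. \<phi> (x + s n *\<^sub>R h))"
        by (intro continuous_on_compose2[OF cont] continuous_intros) auto
      show "compact ((\<lambda>x. x - s n *\<^sub>R h) ` K)"
        by (intro compact_continuous_image continuous_intros K)
      show "\<phi> (x + s n *\<^sub>R h) = 0" if "x \<notin> (\<lambda>x. x - s n *\<^sub>R h) ` K" for x
      proof (rule K(3))
        show "x + s n *\<^sub>R h \<notin> K" using that by (metis add_diff_cancel_right' imageI)
      qed
    qed
    then show ?thesis using i lborel_integral_translate[OF borel_measurable_continuous_onI[OF cont], of "s n *\<^sub>R h"]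
      by (simp add: q_def)
  qed
  ultimately show ?thesis by (simp add: LIMSEQ_const_iff D_def)
qed

lemma test_function_integration_by_parts:
  fixes \<phi> \<psi> :: "'a::euclidean_space \<Rightarrow> real"
  assumes phi: "\<phi> \<in> test_functions \<Omega>" and psi: "\<psi> \<in> test_functions \<Omega>"
  shows "(\<integral>x. \<phi> x * frechet_derivative \<psi> (at x) h \<partial>lborel)
    = - (\<integral>x. frechet_derivative \<phi> (at x) h * \<psi> x \<partial>lborel)"
proof -
  have prod: "(\<lambda>x. \<phi> x * \<psi> x) \<in> test_functions \<Omega>"
    using phi psi by (intro test_functions_restrict_support[OF phi] C_k_mult) (auto simp: test_functions_def)
  have "frechet_derivative (\<lambda>x. \<phi> x * \<psi> x) (at x)
      = (\<lambda>h. \<phi> x * frechet_derivative \<psi> (at x) h + frechet_derivative \<phi> (at x) h * \<psi> x)" for x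
    by (rule frechet_derivative_at[OF has_derivative_mult[OF test_functions_has_derivative[OF phi]
        test_functions_has_derivative[OF psi]], symmetric])
  note fd = fun_cong[OF this]
  obtain K where K: "compact K" "K \<subseteq> \<Omega>" "\<And>x. x \<notin> K \<Longrightarrow> \<phi> x = 0"
    "\<And>x h. x \<notin> K \<Longrightarrow> frechet_derivative \<phi> (at x) h = 0" by (rule test_functions_support[OF phi]) blast
  have "integrable lborel (\<lambda>x. \<phi> x * frechet_derivative \<psi> (at x) h)"
    using K by (intro compact_support_integrable[OF _ K(1)] continuous_intros test_functions_continuous[OF phi]
        test_functions_partial_continuous[OF psi]) auto
  moreover have "integrable lborel (\<lambda>x. frechet_derivative \<phi> (at x) h * \<psi> x)"
    using K by (intro compact_support_integrable[OF _ K(1)] continuous_intros test_functions_continuous[OF psi]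
        test_functions_partial_continuous[OF phi]) auto
  ultimately show ?thesis
    using test_function_partial_integral_zero[OF prod, of h] by (simp add: fd)
qed

section \<open>Translations and the Poincare inequality\<close>

lemma nn_integral_p_mass:
  assumes "pow_integrable M p f"
  shows "(\<integral>\<^sup>+x. ennreal (norm (f x) powr p) \<partial>M) = ennreal (p_mass M p f)"
  unfolding p_mass_def using pow_integrable_integrable[OF assms]
  by (intro nn_integral_eq_integral) auto

lemma p_mass_leI:
  assumes "f \<in> borel_measurable M" "(\<integral>\<^sup>+x. ennreal (norm (f x) powr p) \<partial>M) \<le> ennreal C" "0 \<le> C"
  shows "pow_integrable M p f" "p_mass M p f \<le> C"
proof -
  show *: "pow_integrable M p f"
    unfolding pow_integrable_def using assms
    by (auto intro!: integrableI_nonneg le_less_trans[OF assms(2)])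
  show "p_mass M p f \<le> C"
    using assms(2,3) nn_integral_p_mass[OF *] by simp
qed

lemma nn_integral_lborel_translate:
  fixes F :: "'a::euclidean_space \<Rightarrow> ennreal"
  assumes "F \<in> borel_measurable borel"
  shows "(\<integral>\<^sup>+x. F (x + h) \<partial>lborel) = (\<integral>\<^sup>+x. F x \<partial>lborel)"
proof -
  have "(\<integral>\<^sup>+x. F x \<partial>lborel) = (\<integral>\<^sup>+x. F x \<partial>distr lborel borel ((+) h))" by (simp add: lborel_distr_plus)
  also have "\<dots> = (\<integral>\<^sup>+x. F (h + x) \<partial>lborel)" using assms by (intro nn_integral_distr) auto
  finally show ?thesis by (simp add: add.commute)
qed

definition gradient :: "(real^'n \<Rightarrow> real^'d) \<Rightarrow> real^'n \<Rightarrow> real^'n^'d" where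
  "gradient \<phi> x = (\<chi> j i. frechet_derivative \<phi> (at x) (axis i 1) $ j)"

lemma norm_matrix_vector_mult_le:
  fixes A :: "real^'n^'d"
  shows "norm (A *v h) \<le> norm A * norm h"
proof -
  have "norm (A *v h) = L2_set (\<lambda>j. norm (A $ j \<bullet> h)) UNIV"
    by (simp add: norm_vec_def matrix_vector_mul_component)
  also have "\<dots> \<le> L2_set (\<lambda>j. norm (A $ j) * norm h) UNIV"
    by (intro L2_set_mono) (auto simp: Cauchy_Schwarz_ineq2)
  also have "\<dots> = norm A * norm h"
    by (simp add: norm_vec_def L2_set_left_distrib)
  finally show ?thesis .
qed

lemma norm_frechet_derivative_le_gradient:
  fixes \<phi> :: "real^'n \<Rightarrow> real^'d"
  assumes "\<phi> \<in> test_functions \<Omega>"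
  shows "norm (frechet_derivative \<phi> (at x) h) \<le> norm (gradient \<phi> x) * norm h"
proof -
  have "linear (frechet_derivative \<phi> (at x))"
    using test_functions_has_derivative[OF assms] has_derivative_linear by blast
  then have "frechet_derivative \<phi> (at x) h = gradient \<phi> x *v h"
    using matrix_works[of "frechet_derivative \<phi> (at x)" h]
    by (simp add: gradient_def matrix_def linear_matrix_vector_mul_eq)
  then show ?thesis using norm_matrix_vector_mult_le[of "gradient \<phi> x" h] by simp
qed

lemma gradient_continuous:
  assumes "\<phi> \<in> test_functions \<Omega>"
  shows "continuous_on UNIV (gradient \<phi>)"
  unfolding gradient_def[abs_def]
  by (intro continuous_on_vec_lambda continuous_on_component test_functions_partial_continuous[OF assms])

lemma gradient_zero_outside:
  assumes "\<phi> \<in> test_functions \<Omega>" "x \<notin> \<Omega>"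
  shows "gradient \<phi> x = 0"
  using test_functions_zero_outside(2)[OF assms] by (simp add: gradient_def vec_eq_iff)

lemma continuous_compact_support_pow_integrable:
  fixes g :: "'a::euclidean_space \<Rightarrow> 'b::euclidean_space"
  assumes "0 < p" "continuous_on UNIV g" "compact K" "\<And>x. x \<notin> K \<Longrightarrow> g x = 0"
  shows "pow_integrable lborel p g"
  unfolding pow_integrable_def
proof
  show "g \<in> borel_measurable lborel" using borel_measurable_continuous_onI[OF assms(2)] by simp
  show "integrable lborel (\<lambda>x. norm (g x) powr p)"
    using assms by (intro compact_support_integrable[OF _ assms(3)] continuous_on_powr' continuous_intros) auto
qed

lemma test_function_pow_integrable:
  assumes "0 < p" "\<phi> \<in> test_functions \<Omega>"
  shows "pow_integrable lborel p \<phi>"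
proof -
  obtain K where "compact K" "K \<subseteq> \<Omega>" "\<And>x. x \<notin> K \<Longrightarrow> \<phi> x = 0"
    "\<And>x h. x \<notin> K \<Longrightarrow> frechet_derivative \<phi> (at x) h = 0" by (rule test_functions_support[OF assms(2)]) blast
  then show ?thesis
    using assms test_functions_continuous by (intro continuous_compact_support_pow_integrable) auto
qed

lemma gradient_pow_integrable:
  assumes "0 < p" "\<phi> \<in> test_functions \<Omega>"
  shows "pow_integrable lborel p (gradient \<phi>)"
proof -
  obtain K where "compact K" "K \<subseteq> \<Omega>" "\<And>x. x \<notin> K \<Longrightarrow> \<phi> x = 0"
    "\<And>x h. x \<notin> K \<Longrightarrow> frechet_derivative \<phi> (at x) h = 0" by (rule test_functions_support[OF assms(2)]) blast
  then show ?thesis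
    using assms gradient_continuous
    by (intro continuous_compact_support_pow_integrable) (auto simp: gradient_def vec_eq_iff)
qed

text \<open>The increment is the integral of the derivative along the segment from \<open>x\<close> to \<open>x + h\<close>; Jensen's
  inequality on the unit interval moves the power inside.\<close>

lemma test_function_increment_powr_le:
  fixes \<phi> :: "real^'n \<Rightarrow> real^'d"
  assumes p: "1 < p" and phi: "\<phi> \<in> test_functions \<Omega>"
  shows "ennreal (norm (\<phi> (x + h) - \<phi> x) powr p)
    \<le> (\<integral>\<^sup>+t. indicator {0..1} t * ennreal (norm h powr p * norm (gradient \<phi> (x + t *\<^sub>R h)) powr p) \<partial>lborel)"
proof -
  define M where "M = restrict_space lborel {0..1::real}"
  define D where "D t = frechet_derivative \<phi> (at (x + t *\<^sub>R h)) h" for t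
  have contD: "continuous_on UNIV D" unfolding D_def[abs_def]
    by (intro continuous_on_compose2[OF test_functions_partial_continuous[OF phi]] continuous_intros) auto
  have measM: "measure M (space M) = 1"
    by (simp add: M_def measure_restrict_space space_restrict_space)
  have finM: "finite_measure M"
    by (rule finite_measureI) (simp add: M_def emeasure_restrict_space space_restrict_space)
  have "integrable lborel (\<lambda>t. indicator {0..1} t *\<^sub>R (norm (D t) powr p))"
    using p by (intro borel_integrable_compact continuous_on_powr' continuous_intros)
       (auto intro: continuous_on_subset[OF contD])
  then have int: "integrable M (\<lambda>t. norm (D t) powr p)"
    by (simp add: M_def integrable_restrict_space)
  have meas: "D \<in> borel_measurable M"
    unfolding M_def using borel_measurable_continuous_onI[OF contD] by (intro measurable_restrict_space1) simp
  have "(\<integral>t. D t \<partial>M) = (\<integral>t. indicator {0..1} t *\<^sub>R D t \<partial>lborel)"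
    unfolding M_def by (intro integral_restrict_space) auto
  also have "\<dots> = \<phi> (x + 1 *\<^sub>R h) - \<phi> (x + 0 *\<^sub>R h)"
    unfolding D_def using continuous_on_subset[OF contD]
    by (intro integral_FTC_Icc test_function_line_derivative[OF phi]) (auto simp: D_def[abs_def])
  finally have FTC: "(\<integral>t. D t \<partial>M) = \<phi> (x + h) - \<phi> x" by simp
  have "norm (\<phi> (x + h) - \<phi> x) powr p \<le> p_mass M p D"
    using norm_integral_powr_le(3)[OF finM p, of D] int meas unfolding FTC measM pow_integrable_def by simp
  then have "ennreal (norm (\<phi> (x + h) - \<phi> x) powr p) \<le> (\<integral>\<^sup>+t. ennreal (norm (D t) powr p) \<partial>M)"
    using nn_integral_p_mass[of M p D] int meas by (simp add: pow_integrable_def ennreal_leI)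
  also have "\<dots> = (\<integral>\<^sup>+t. ennreal (norm (D t) powr p) * indicator {0..1} t \<partial>lborel)"
    unfolding M_def by (intro nn_integral_restrict_space) auto
  also have "\<dots> \<le> (\<integral>\<^sup>+t. indicator {0..1} t * ennreal (norm h powr p * norm (gradient \<phi> (x + t *\<^sub>R h)) powr p) \<partial>lborel)"
  proof (rule nn_integral_mono)
    fix t
    have "norm (D t) powr p \<le> (norm (gradient \<phi> (x + t *\<^sub>R h)) * norm h) powr p"
      using p norm_frechet_derivative_le_gradient[OF phi] by (intro powr_mono2) (auto simp: D_def)
    also have "\<dots> = norm h powr p * norm (gradient \<phi> (x + t *\<^sub>R h)) powr p"
      by (simp add: powr_mult mult.commute)
    finally show "ennreal (norm (D t) powr p) * indicator {0..1} t
      \<le> indicator {0..1} t * ennreal (norm h powr p * norm (gradient \<phi> (x + t *\<^sub>R h)) powr p)"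
      by (auto simp: indicator_def ennreal_leI)
  qed
  finally show ?thesis .
qed

text \<open>The one inequality behind all estimates in \<open>W\<^sub>0\<^sup>1\<^sup>,\<^sup>p\<close>.  After integrating the bound for a single
  increment over \<open>x\<close>, Tonelli's theorem and translation invariance remove the dependence on the
  position along the segment.\<close>

theorem translation_estimate:
  fixes \<phi> :: "real^'n \<Rightarrow> real^'d"
  assumes p: "1 < p" and phi: "\<phi> \<in> test_functions \<Omega>"
  shows "pow_integrable lborel p (\<lambda>x. \<phi> (x + h) - \<phi> x)"
    and "p_mass lborel p (\<lambda>x. \<phi> (x + h) - \<phi> x) \<le> norm h powr p * p_mass lborel p (gradient \<phi>)"
proof -
  have gm [measurable]: "gradient \<phi> \<in> borel_measurable borel"
    by (rule borel_measurable_continuous_onI[OF gradient_continuous[OF phi]])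
  have pm [measurable]: "\<phi> \<in> borel_measurable borel"
    by (rule borel_measurable_continuous_onI[OF test_functions_continuous[OF phi]])
  let ?C = "norm h powr p * p_mass lborel p (gradient \<phi>)"
  have gi: "pow_integrable lborel p (gradient \<phi>)" using p phi by (intro gradient_pow_integrable) auto
  have "(\<integral>\<^sup>+x. ennreal (norm (\<phi> (x + h) - \<phi> x) powr p) \<partial>lborel)
    \<le> (\<integral>\<^sup>+x. \<integral>\<^sup>+t. indicator {0..1} t * ennreal (norm h powr p * norm (gradient \<phi> (x + t *\<^sub>R h)) powr p) \<partial>lborel \<partial>lborel)"
    by (intro nn_integral_mono test_function_increment_powr_le[OF p phi])
  also have "\<dots> = (\<integral>\<^sup>+t. \<integral>\<^sup>+x. indicator {0..1::real} t * ennreal (norm h powr p * norm (gradient \<phi> (x + t *\<^sub>R h)) powr p) \<partial>lborel \<partial>lborel)"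
    by (intro lborel_pair.Fubini'[symmetric]) measurable
  also have "\<dots> = (\<integral>\<^sup>+t. indicator {0..1::real} t * ennreal ?C \<partial>lborel)"
  proof (rule nn_integral_cong)
    fix t :: real
    have "(\<integral>\<^sup>+x. indicator {0..1::real} t * ennreal (norm h powr p * norm (gradient \<phi> (x + t *\<^sub>R h)) powr p) \<partial>lborel)
      = indicator {0..1} t * (ennreal (norm h powr p) * (\<integral>\<^sup>+x. ennreal (norm (gradient \<phi> (x + t *\<^sub>R h)) powr p) \<partial>lborel))"
      by (simp add: nn_integral_cmult ennreal_mult)
    also have "(\<integral>\<^sup>+x. ennreal (norm (gradient \<phi> (x + t *\<^sub>R h)) powr p) \<partial>lborel)
      = (\<integral>\<^sup>+x. ennreal (norm (gradient \<phi> x) powr p) \<partial>lborel)"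
      by (rule nn_integral_lborel_translate) measurable
    also have "\<dots> = ennreal (p_mass lborel p (gradient \<phi>))" by (rule nn_integral_p_mass[OF gi])
    finally show "(\<integral>\<^sup>+x. indicator {0..1::real} t * ennreal (norm h powr p * norm (gradient \<phi> (x + t *\<^sub>R h)) powr p) \<partial>lborel)
      = indicator {0..1} t * ennreal ?C" by (simp add: ennreal_mult)
  qed
  also have "\<dots> = ennreal ?C" by (simp add: nn_integral_multc)
  finally have *: "(\<integral>\<^sup>+x. ennreal (norm (\<phi> (x + h) - \<phi> x) powr p) \<partial>lborel) \<le> ennreal ?C" .
  have m: "(\<lambda>x. \<phi> (x + h) - \<phi> x) \<in> borel_measurable lborel" by simp
  show "pow_integrable lborel p (\<lambda>x. \<phi> (x + h) - \<phi> x)" "p_mass lborel p (\<lambda>x. \<phi> (x + h) - \<phi> x) \<le> ?C"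
    using p_mass_leI[OF m *] by auto
qed

text \<open>A shift by more than the diameter moves the support of \<open>\<phi>\<close> off itself.  Then \<open>\<phi> (x + h) = 0\<close>
  wherever \<open>\<phi> x \<noteq> 0\<close>, and the translation estimate is already a bound for \<open>\<phi>\<close>.\<close>

theorem poincare_inequality:
  fixes \<Omega> :: "(real^'n) set"
  assumes p: "1 < p" and \<Omega>: "bounded \<Omega>"
  obtains P where "0 < P"
    "\<And>\<phi> :: real^'n \<Rightarrow> real^'d. \<phi> \<in> test_functions \<Omega> \<Longrightarrow> p_mass lborel p \<phi> \<le> P * p_mass lborel p (gradient \<phi>)"
proof -
  obtain R where R: "0 < R" "\<And>x. x \<in> \<Omega> \<Longrightarrow> norm x \<le> R" using \<Omega> by (auto simp: bounded_pos)
  \<comment> \<open>Any vector longer than the diameter \<open>2 R\<close> will do.\<close>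
  define h :: "real^'n" where "h = (3 * R) *\<^sub>R axis undefined 1"
  have h: "norm h = 3 * R" using R by (simp add: h_def)
  have "p_mass lborel p \<phi> \<le> (3 * R) powr p * p_mass lborel p (gradient \<phi>)"
    if phi: "\<phi> \<in> test_functions \<Omega>" for \<phi> :: "real^'n \<Rightarrow> real^'d"
  proof -
    have "p_mass lborel p \<phi> \<le> p_mass lborel p (\<lambda>x. \<phi> (x + h) - \<phi> x)"
      unfolding p_mass_def
    proof (rule integral_mono)
      show "integrable lborel (\<lambda>x. norm (\<phi> x) powr p)"
        using test_function_pow_integrable[OF _ phi, of p] p by (auto simp: pow_integrable_def)
      show "integrable lborel (\<lambda>x. norm (\<phi> (x + h) - \<phi> x) powr p)"
        using translation_estimate(1)[OF p phi] by (auto simp: pow_integrable_def)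
      fix x
      show "norm (\<phi> x) powr p \<le> norm (\<phi> (x + h) - \<phi> x) powr p"
      proof (cases "x \<in> \<Omega>")
        case True
        have "norm h \<le> norm (x + h) + norm x" using norm_triangle_ineq4[of "x + h" x] by simp
        then have "x + h \<notin> \<Omega>" using R(2)[OF True] R(2)[of "x + h"] R(1) h by force
        then show ?thesis using test_functions_zero_outside(1)[OF phi] by simp
      qed (use test_functions_zero_outside(1)[OF phi] in simp)
    qed
    also have "\<dots> \<le> (3 * R) powr p * p_mass lborel p (gradient \<phi>)"
      using translation_estimate(2)[OF p phi, of h] h by simp
    finally show ?thesis .
  qed
  then show ?thesis using that[of "(3 * R) powr p"] R by simp
qed

section \<open>Compactness in the mean\<close>

text \<open>Probability measures on the ball of radius \<open>\<epsilon>\<close> that have a density bounded by \<open>c\<close>.  Uniform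
  measures on balls are of this kind, and averaging with respect to such a measure plays the part
  of a mollifier.\<close>

definition averaging_measure :: "real \<Rightarrow> real \<Rightarrow> 'a::euclidean_space measure \<Rightarrow> bool" where
  "averaging_measure \<epsilon> c U \<longleftrightarrow> finite_measure U \<and> measure U (space U) = 1 \<and> sets U = sets borel \<and>
     (AE y in U. norm y \<le> \<epsilon>) \<and> 0 \<le> c \<and>
     (\<forall>F\<in>borel_measurable borel. (\<integral>\<^sup>+y. F y \<partial>U) \<le> ennreal c * (\<integral>\<^sup>+y. F y \<partial>lborel))"

lemma averaging_measure_exists:
  assumes "0 < \<epsilon>"
  obtains c and U :: "'a::euclidean_space measure" where "averaging_measure \<epsilon> c U"
proof -
  define S where "S = cball (0::'a) \<epsilon>"
  define c where "c = 1 / measure lborel S"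
  define U where "U = uniform_measure lborel S"
  have pos: "0 < measure lborel S" unfolding S_def using assms by (rule content_cball_pos)
  have fin: "emeasure lborel S \<noteq> \<infinity>" unfolding S_def using emeasure_lborel_cball_finite[of 0 \<epsilon>] by (simp add: less_top)
  have em: "emeasure lborel S = ennreal (measure lborel S)"
    using fin by (intro emeasure_eq_ennreal_measure) auto
  have nz: "emeasure lborel S \<noteq> 0" using pos em by simp
  have sp: "emeasure U (space U) = 1"
  proof -
    have "emeasure U (space U) = emeasure lborel S / emeasure lborel S"
      unfolding U_def by (subst emeasure_uniform_measure) (auto simp: S_def)
    then show ?thesis using pos by (simp add: em divide_ennreal)
  qed
  have "averaging_measure \<epsilon> c U"
    unfolding averaging_measure_def
  proof (intro conjI ballI)
    show "finite_measure U" by (rule finite_measureI) (simp add: sp)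
    show "measure U (space U) = 1" using sp by (simp add: measure_def)
    show "sets U = sets borel" by (simp add: U_def)
    show "AE y in U. norm y \<le> \<epsilon>"
      unfolding U_def by (rule AE_uniform_measureI) (auto simp: S_def)
    show "0 \<le> c" by (simp add: c_def)
    fix F :: "'a \<Rightarrow> ennreal" assume F: "F \<in> borel_measurable borel"
    have "(\<integral>\<^sup>+y. F y \<partial>U) = (\<integral>\<^sup>+y. F y * indicator S y \<partial>lborel) / emeasure lborel S"
      unfolding U_def using F by (intro nn_integral_uniform_measure) (auto simp: S_def)
    also have "\<dots> = ennreal c * (\<integral>\<^sup>+y. F y * indicator S y \<partial>lborel)"
      using pos by (simp add: em c_def divide_ennreal_def inverse_ennreal inverse_eq_divide mult.commute)
    also have "\<dots> \<le> ennreal c * (\<integral>\<^sup>+y. F y \<partial>lborel)"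
      by (intro mult_left_mono nn_integral_mono) (auto simp: indicator_def)
    finally show "(\<integral>\<^sup>+y. F y \<partial>U) \<le> ennreal c * (\<integral>\<^sup>+y. F y \<partial>lborel)" .
  qed
  then show ?thesis using that by blast
qed

text \<open>The hypotheses of the Riesz--Kolmogorov criterion, with the linear modulus of continuity that
  bounded gradients provide, for functions that are moreover continuous and bounded.\<close>

definition translation_bounded :: "real \<Rightarrow> real \<Rightarrow> ('a::euclidean_space \<Rightarrow> 'b::euclidean_space) \<Rightarrow> bool" where
  "translation_bounded p B g \<longleftrightarrow> continuous_on UNIV g \<and> bounded (range g) \<and>
     pow_integrable lborel p g \<and> p_mass lborel p g \<le> B \<and>
     (\<forall>h. pow_integrable lborel p (\<lambda>x. g (x + h) - g x) \<and>
          p_mass lborel p (\<lambda>x. g (x + h) - g x) \<le> B * norm h powr p)"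

lemma translation_bounded_nonneg: "translation_bounded p B g \<Longrightarrow> 0 \<le> B"
  unfolding translation_bounded_def by (meson order_trans p_mass_nonneg)

text \<open>Jensen's inequality for the probability measure \<open>U\<close> reduces everything to integrals of \<open>p\<close>-th
  powers.  For the pointwise bounds the density bound \<open>c\<close> then replaces \<open>U\<close> by Lebesgue measure; for
  the distance between \<open>g\<close> and its averages Tonelli's theorem leaves translates by vectors of norm
  at most \<open>\<epsilon>\<close>.\<close>

lemma averages_estimates:
  fixes g :: "'a::euclidean_space \<Rightarrow> 'b::euclidean_space"
  assumes p: "1 < p" and U: "averaging_measure \<epsilon> c U" and g: "translation_bounded p B g"
  shows "(\<lambda>x. \<integral>y. g (x + y) \<partial>U) \<in> borel_measurable borel"
    and "norm (\<integral>y. g (x + y) \<partial>U) powr p \<le> c * B"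
    and "norm ((\<integral>y. g (x + y) \<partial>U) - (\<integral>y. g (x' + y) \<partial>U)) powr p \<le> c * (B * norm (x - x') powr p)"
    and "pow_integrable lborel p (\<lambda>x. (\<integral>y. g (x + y) \<partial>U) - g x)"
    and "p_mass lborel p (\<lambda>x. (\<integral>y. g (x + y) \<partial>U) - g x) \<le> B * \<epsilon> powr p"
proof -
  interpret finite_measure U using U by (simp add: averaging_measure_def)
  have U1: "measure U (space U) = 1" and setsU [measurable_cong]: "sets U = sets borel"
    and Ue: "AE y in U. norm y \<le> \<epsilon>" and c0: "0 \<le> c"
    and Uc: "\<And>F. F \<in> borel_measurable borel \<Longrightarrow> (\<integral>\<^sup>+y. F y \<partial>U) \<le> ennreal c * (\<integral>\<^sup>+y. F y \<partial>lborel)"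
    using U by (auto simp: averaging_measure_def)
  have gm [measurable]: "g \<in> borel_measurable borel"
    using g by (auto simp: translation_bounded_def intro: borel_measurable_continuous_onI)
  obtain b where b: "\<And>x. norm (g x) \<le> b"
    using g unfolding translation_bounded_def bounded_iff by blast
  have B: "0 \<le> B" using g translation_bounded_nonneg by blast
  have intU: "integrable U (\<lambda>y. g (x + y))" for x
    by (rule integrable_const_bound[where B=b]) (use b in auto)
  have pU: "pow_integrable U p h" if "h \<in> borel_measurable borel" "\<And>y. norm (h y) \<le> d" for h :: "'a \<Rightarrow> 'b" and d
    unfolding pow_integrable_def
  proof
    show hm: "h \<in> borel_measurable U" using that(1) by measurable
    show "integrable U (\<lambda>y. norm (h y) powr p)"
    proof (rule integrable_const_bound[where B="d powr p"])
      show "AE y in U. norm (norm (h y) powr p) \<le> d powr p"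
        using that(2) p by (intro AE_I2) (auto intro!: powr_mono2)
    qed (use hm in measurable)
  qed
  have jensen: "ennreal (norm (\<integral>y. h y \<partial>U) powr p) \<le> (\<integral>\<^sup>+y. ennreal (norm (h y) powr p) \<partial>U)"
    if "h \<in> borel_measurable borel" "\<And>y. norm (h y) \<le> d" for h :: "'a \<Rightarrow> 'b" and d
    using norm_integral_powr_le(3)[OF finite_measure_axioms p pU[OF that]] nn_integral_p_mass[OF pU[OF that]] U1
    by (simp add: ennreal_leI)
  show meas: "(\<lambda>x. \<integral>y. g (x + y) \<partial>U) \<in> borel_measurable borel"
    by (rule borel_measurable_lebesgue_integral) measurable
  show "norm (\<integral>y. g (x + y) \<partial>U) powr p \<le> c * B"
  proof -
    have "ennreal (norm (\<integral>y. g (x + y) \<partial>U) powr p) \<le> (\<integral>\<^sup>+y. ennreal (norm (g (x + y)) powr p) \<partial>U)"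
      by (rule jensen[where d=b]) (use b in auto)
    also have "\<dots> \<le> ennreal c * (\<integral>\<^sup>+y. ennreal (norm (g (x + y)) powr p) \<partial>lborel)"
      by (rule Uc) measurable
    also have "(\<integral>\<^sup>+y. ennreal (norm (g (x + y)) powr p) \<partial>lborel) = (\<integral>\<^sup>+y. ennreal (norm (g y) powr p) \<partial>lborel)"
      using nn_integral_lborel_translate[of "\<lambda>y. ennreal (norm (g y) powr p)" x] by (simp add: add.commute)
    also have "\<dots> = ennreal (p_mass lborel p g)"
      using g by (intro nn_integral_p_mass) (simp add: translation_bounded_def)
    also have "ennreal c * \<dots> \<le> ennreal (c * B)"
      using g c0 by (auto simp: translation_bounded_def ennreal_mult'[symmetric] intro!: ennreal_leI mult_left_mono)
    finally show ?thesis using c0 B by simp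
  qed
  show "norm ((\<integral>y. g (x + y) \<partial>U) - (\<integral>y. g (x' + y) \<partial>U)) powr p \<le> c * (B * norm (x - x') powr p)"
  proof -
    let ?h = "\<lambda>y. g (x + y) - g (x' + y)"
    let ?k = "\<lambda>y. g (y + (x - x')) - g y"
    have "(\<integral>y. g (x + y) \<partial>U) - (\<integral>y. g (x' + y) \<partial>U) = (\<integral>y. ?h y \<partial>U)"
      using intU by simp
    moreover have "norm (?h y) \<le> 2 * b" for y
      using norm_triangle_ineq4[of "g (x + y)" "g (x' + y)"] b[of "x + y"] b[of "x' + y"] by linarith
    moreover have "?h \<in> borel_measurable borel" by measurable
    ultimately have "ennreal (norm ((\<integral>y. g (x + y) \<partial>U) - (\<integral>y. g (x' + y) \<partial>U)) powr p) \<le> (\<integral>\<^sup>+y. ennreal (norm (?h y) powr p) \<partial>U)"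
      using jensen[of ?h "2 * b"] by (simp only:)
    also have "\<dots> \<le> ennreal c * (\<integral>\<^sup>+y. ennreal (norm (?h y) powr p) \<partial>lborel)"
      by (rule Uc) measurable
    also have "(\<integral>\<^sup>+y. ennreal (norm (?h y) powr p) \<partial>lborel) = (\<integral>\<^sup>+y. ennreal (norm (?k y) powr p) \<partial>lborel)"
      using nn_integral_lborel_translate[of "\<lambda>y. ennreal (norm (?k y) powr p)" x'] by (simp add: add_ac)
    also have "\<dots> = ennreal (p_mass lborel p ?k)"
      using g by (intro nn_integral_p_mass) (simp add: translation_bounded_def)
    also have "ennreal c * \<dots> \<le> ennreal (c * (B * norm (x - x') powr p))"
      using g c0 by (auto simp: translation_bounded_def ennreal_mult'[symmetric] intro!: ennreal_leI mult_left_mono)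
    finally show ?thesis using c0 B by simp
  qed
  have "(\<integral>\<^sup>+x. ennreal (norm ((\<integral>y. g (x + y) \<partial>U) - g x) powr p) \<partial>lborel)
    \<le> (\<integral>\<^sup>+x. \<integral>\<^sup>+y. ennreal (norm (g (x + y) - g x) powr p) \<partial>U \<partial>lborel)"
  proof (rule nn_integral_mono)
    fix x
    let ?h = "\<lambda>y. g (x + y) - g x"
    have "(\<integral>y. g (x + y) \<partial>U) - g x = (\<integral>y. ?h y \<partial>U)"
      using intU U1 by simp
    moreover have "norm (?h y) \<le> 2 * b" for y
      using norm_triangle_ineq4[of "g (x + y)" "g x"] b[of "x + y"] b[of x] by linarith
    ultimately show "ennreal (norm ((\<integral>y. g (x + y) \<partial>U) - g x) powr p) \<le> (\<integral>\<^sup>+y. ennreal (norm (?h y) powr p) \<partial>U)"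
      using jensen[of ?h "2 * b"] by simp
  qed
  also have "\<dots> = (\<integral>\<^sup>+y. \<integral>\<^sup>+x. ennreal (norm (g (x + y) - g x) powr p) \<partial>lborel \<partial>U)"
  proof -
    interpret pair_sigma_finite lborel U ..
    show ?thesis by (rule Fubini'[symmetric]) measurable
  qed
  also have "\<dots> \<le> (\<integral>\<^sup>+y. ennreal (B * \<epsilon> powr p) \<partial>U)"
  proof (rule nn_integral_mono_AE, use Ue in eventually_elim)
    fix y :: 'a assume y: "norm y \<le> \<epsilon>"
    have "(\<integral>\<^sup>+x. ennreal (norm (g (x + y) - g x) powr p) \<partial>lborel) = ennreal (p_mass lborel p (\<lambda>x. g (x + y) - g x))"
      using g by (intro nn_integral_p_mass) (simp add: translation_bounded_def)
    also have "\<dots> \<le> ennreal (B * norm y powr p)"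
      using g by (intro ennreal_leI) (simp add: translation_bounded_def)
    also have "\<dots> \<le> ennreal (B * \<epsilon> powr p)"
      using B y p by (intro ennreal_leI mult_left_mono powr_mono2) auto
    finally show "(\<integral>\<^sup>+x. ennreal (norm (g (x + y) - g x) powr p) \<partial>lborel) \<le> ennreal (B * \<epsilon> powr p)" .
  qed
  also have "\<dots> = ennreal (B * \<epsilon> powr p)" using U1 by (simp add: emeasure_eq_measure)
  finally have *: "(\<integral>\<^sup>+x. ennreal (norm ((\<integral>y. g (x + y) \<partial>U) - g x) powr p) \<partial>lborel) \<le> ennreal (B * \<epsilon> powr p)" .
  have m: "(\<lambda>x. (\<integral>y. g (x + y) \<partial>U) - g x) \<in> borel_measurable lborel" using meas by simp
  show "pow_integrable lborel p (\<lambda>x. (\<integral>y. g (x + y) \<partial>U) - g x)"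
    "p_mass lborel p (\<lambda>x. (\<integral>y. g (x + y) \<partial>U) - g x) \<le> B * \<epsilon> powr p"
    using p_mass_leI[OF m *] B by auto
qed

lemma borel_measurable_lebesgue_on:
  assumes "f \<in> borel_measurable borel"
  shows "f \<in> borel_measurable (lebesgue_on S)"
  using assms by (intro measurable_restrict_space1 measurable_completion) simp

lemma p_mass_lebesgue_on_le:
  fixes f :: "'a::euclidean_space \<Rightarrow> 'b::euclidean_space"
  assumes S: "S \<in> sets lebesgue" and f: "pow_integrable lborel p f"
  shows "pow_integrable (lebesgue_on S) p f" "p_mass (lebesgue_on S) p f \<le> p_mass lborel p f"
proof -
  have fm: "f \<in> borel_measurable borel" using pow_integrable_measurable[OF f] by simp
  have "(\<integral>\<^sup>+x. ennreal (norm (f x) powr p) \<partial>lebesgue_on S)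
    = (\<integral>\<^sup>+x. ennreal (norm (f x) powr p) * indicator S x \<partial>lebesgue)"
    using S by (intro nn_integral_restrict_space) auto
  also have "\<dots> \<le> (\<integral>\<^sup>+x. ennreal (norm (f x) powr p) \<partial>lebesgue)"
    by (intro nn_integral_mono) (auto simp: indicator_def)
  also have "\<dots> = ennreal (p_mass lborel p f)"
    using nn_integral_p_mass[OF f] by (simp add: nn_integral_completion)
  finally show "pow_integrable (lebesgue_on S) p f" "p_mass (lebesgue_on S) p f \<le> p_mass lborel p f"
    using p_mass_leI[OF borel_measurable_lebesgue_on[OF fm]] by auto
qed

text \<open>For fixed \<open>m\<close> the averages of \<open>g k\<close> on the scale \<open>1 / (m + 1)\<close> are bounded and Lipschitz uniformly
  in \<open>k\<close>.  A diagonal sequence therefore makes them converge at every point, first on a countable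
  dense set and then everywhere, and by dominated convergence in the mean on \<open>S\<close>.  The averages
  differ from \<open>g k\<close> by a quantity that tends to \<open>0\<close> with the scale, uniformly in \<open>k\<close>.\<close>

theorem riesz_kolmogorov:
  fixes g :: "nat \<Rightarrow> 'a::euclidean_space \<Rightarrow> 'b::euclidean_space"
  assumes p: "1 < p" and g: "\<And>k. translation_bounded p B (g k)" and S: "S \<in> lmeasurable"
  obtains r where "strict_mono (r :: nat \<Rightarrow> nat)" "p_cauchy (lebesgue_on S) p (\<lambda>k. g (r k))"
proof -
  have B: "0 \<le> B" using g[of 0] translation_bounded_nonneg by blast
  have SL: "S \<in> sets lebesgue" using S by (rule fmeasurableD)
  interpret SM: finite_measure "lebesgue_on S" using S by (rule finite_measure_lebesgue_on)
  have ex: "\<exists>z :: real \<times> 'a measure. averaging_measure (1 / real (Suc m)) (fst z) (snd z)" for m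
  proof -
    obtain c and U :: "'a measure" where "averaging_measure (1 / real (Suc m)) c U"
      by (rule averaging_measure_exists[of "1 / real (Suc m)"]) auto
    then show ?thesis by (intro exI[of _ "(c, U)"]) simp
  qed
  define z where "z m = (SOME z :: real \<times> 'a measure. averaging_measure (1 / real (Suc m)) (fst z) (snd z))" for m
  define c U where "c m = fst (z m)" and "U m = snd (z m)" for m
  have U: "averaging_measure (1 / real (Suc m)) (c m) (U m)" for m
    unfolding c_def U_def z_def by (rule someI_ex[OF ex])
  have c0: "0 \<le> c m" for m using U[of m] by (simp add: averaging_measure_def)
  define A where "A m k x = (\<integral>y. g k (x + y) \<partial>U m)" for m k x
  note A_est = averages_estimates[OF p U g, folded A_def]
  \<comment> \<open>A uniform bound for the averages on scale \<open>m\<close>; dividing by it gives the diagonal argument one bound for all scales.\<close>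
  define b where "b m = (c m * B) powr (1 / p) + 1" for m
  have b: "0 < b m" for m by (simp add: b_def add_nonneg_pos)
  have A_b: "norm (A m k x) \<le> b m" for m k x
  proof -
    have "norm (A m k x) = (norm (A m k x) powr p) powr (1 / p)" using p by (simp add: powr_powr)
    also have "\<dots> \<le> (c m * B) powr (1 / p)" using A_est(2) p by (intro powr_mono2) auto
    finally show ?thesis by (simp add: b_def)
  qed
  obtain D :: "'a set" where D: "countable D" "\<And>X. open X \<Longrightarrow> X \<noteq> {} \<Longrightarrow> \<exists>d\<in>D. d \<in> X"
    by (rule countable_dense_setE) blast
  obtain r where r: "strict_mono (r :: nat \<Rightarrow> nat)"
    "\<And>z. z \<in> (UNIV :: nat set) \<times> D \<Longrightarrow> \<exists>l. (\<lambda>k. (1 / b (fst z)) *\<^sub>R A (fst z) (r k) (snd z)) \<longlonglongrightarrow> l"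
  proof (rule function_convergent_subsequence[of "(UNIV :: nat set) \<times> D" "\<lambda>k z. (1 / b (fst z)) *\<^sub>R A (fst z) k (snd z)" 1])
    show "countable ((UNIV :: nat set) \<times> D)" using D(1) by simp
    show "norm ((1 / b (fst z)) *\<^sub>R A (fst z) k (snd z)) \<le> 1" for k z
      using A_b[of "fst z" k "snd z"] b[of "fst z"] by simp
  qed blast
  have conv_D: "Cauchy (\<lambda>k. A m (r k) d)" if dD: "d \<in> D" for m d
  proof -
    obtain l where "(\<lambda>k. (1 / b m) *\<^sub>R A m (r k) d) \<longlonglongrightarrow> l" using r(2)[of "(m, d)"] dD unfolding fst_conv snd_conv by blast
    then have "(\<lambda>k. b m *\<^sub>R ((1 / b m) *\<^sub>R A m (r k) d)) \<longlonglongrightarrow> b m *\<^sub>R l" by (intro tendsto_scaleR tendsto_const)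
    then show ?thesis using b[of m] by (auto intro: LIMSEQ_imp_Cauchy)
  qed
  have conv: "convergent (\<lambda>k. A m (r k) x)" for m x
  proof (rule Cauchy_convergent, rule metric_CauchyI)
    fix e :: real assume e: "0 < e"
    define K where "K = (c m * B) powr (1 / p) + 1"
    have K: "0 < K" by (simp add: K_def add_nonneg_pos)
    have "0 < e / (3 * K)" using e K by simp
    then have "ball x (e / (3 * K)) \<noteq> {}" by (simp only: ball_eq_empty not_le)
    then have "\<exists>d\<in>D. d \<in> ball x (e / (3 * K))" using D(2) by blast
    then obtain d where d: "d \<in> D" "norm (x - d) < e / (3 * K)" by (auto simp: dist_norm)
    have lip: "norm (A m k x - A m k d) < e / 3" for k
    proof -
      have "norm (A m k x - A m k d) = (norm (A m k x - A m k d) powr p) powr (1 / p)"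
        using p by (simp add: powr_powr)
      also have "\<dots> \<le> (c m * (B * norm (x - d) powr p)) powr (1 / p)"
        using A_est(3) p by (intro powr_mono2) auto
      also have "\<dots> = (c m * B) powr (1 / p) * norm (x - d)"
        using p B c0 by (simp add: mult.assoc[symmetric] powr_mult powr_powr)
      also have "\<dots> \<le> K * norm (x - d)" by (intro mult_right_mono) (auto simp: K_def)
      also have "\<dots> < K * (e / (3 * K))" using d K by (intro mult_strict_left_mono) auto
      also have "\<dots> = e / 3" using K by simp
      finally show ?thesis .
    qed
    obtain N where N: "\<And>k l. N \<le> k \<Longrightarrow> N \<le> l \<Longrightarrow> dist (A m (r k) d) (A m (r l) d) < e / 3"
      using metric_CauchyD[OF conv_D[OF d(1)], of "e / 3" m] e by auto
    have "dist (A m (r k) x) (A m (r l) x) < e" if "N \<le> k" "N \<le> l" for k l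
    proof -
      have "dist (A m (r k) x) (A m (r l) x) \<le> dist (A m (r k) x) (A m (r k) d)
          + dist (A m (r k) d) (A m (r l) d) + dist (A m (r l) d) (A m (r l) x)"
        using dist_triangle[of "A m (r k) x" "A m (r l) x" "A m (r k) d"]
          dist_triangle[of "A m (r k) d" "A m (r l) x" "A m (r l) d"] by linarith
      moreover have "dist (A m (r k) x) (A m (r k) d) < e / 3" "dist (A m (r l) d) (A m (r l) x) < e / 3"
        using lip[of "r k"] lip[of "r l"] by (auto simp: dist_norm norm_minus_commute)
      ultimately show ?thesis using N[OF that] by argo
    qed
    then show "\<exists>M. \<forall>k\<ge>M. \<forall>l\<ge>M. dist (A m (r k) x) (A m (r l) x) < e" by blast
  qed
  define L where "L m x = lim (\<lambda>k. A m (r k) x)" for m x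
  have L: "(\<lambda>k. A m (r k) x) \<longlonglongrightarrow> L m x" for m x
    using conv by (simp add: L_def convergent_LIMSEQ_iff)
  have Am: "A m k \<in> borel_measurable (lebesgue_on S)" for m k
    using A_est(1) by (rule borel_measurable_lebesgue_on)
  have Lm: "L m \<in> borel_measurable (lebesgue_on S)" for m
    by (rule borel_measurable_LIMSEQ_metric[OF Am[of m] L])
  have Lb: "norm (L m x) \<le> b m" for m x
    by (rule LIMSEQ_le_const2[OF tendsto_norm[OF L[of m x]]]) (use A_b in blast)
  have pS: "pow_integrable (lebesgue_on S) p h" if "h \<in> borel_measurable (lebesgue_on S)" "\<And>x. norm (h x) \<le> d"
    for h :: "'a \<Rightarrow> 'b" and d
    unfolding pow_integrable_def
  proof
    show hm: "h \<in> borel_measurable (lebesgue_on S)" by fact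
    show "integrable (lebesgue_on S) (\<lambda>y. norm (h y) powr p)"
    proof (rule SM.integrable_const_bound[where B="d powr p"])
      show "AE y in lebesgue_on S. norm (norm (h y) powr p) \<le> d powr p"
        using that(2) p by (intro AE_I2) (auto intro!: powr_mono2)
    qed (use hm in measurable)
  qed
  have A_L: "(\<lambda>k. p_mass (lebesgue_on S) p (\<lambda>x. A m (r k) x - L m x)) \<longlonglongrightarrow> 0" for m
  proof -
    have "(\<lambda>k. \<integral>x. norm (A m (r k) x - L m x) powr p \<partial>lebesgue_on S) \<longlonglongrightarrow> (\<integral>x. 0 \<partial>lebesgue_on S)"
    proof (rule integral_dominated_convergence[where w="\<lambda>x. (2 * b m) powr p"])
      show "(\<lambda>x. norm (A m (r k) x - L m x) powr p) \<in> borel_measurable (lebesgue_on S)" for k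
        using Am Lm by measurable
      show "AE x in lebesgue_on S. (\<lambda>k. norm (A m (r k) x - L m x) powr p) \<longlonglongrightarrow> 0"
      proof (intro AE_I2)
        fix x
        have "(\<lambda>k. norm (A m (r k) x - L m x) powr p) \<longlonglongrightarrow> norm (L m x - L m x) powr p"
          using p by (intro tendsto_powr2 tendsto_norm tendsto_diff L tendsto_const) auto
        then show "(\<lambda>k. norm (A m (r k) x - L m x) powr p) \<longlonglongrightarrow> 0" by simp
      qed
      show "AE x in lebesgue_on S. norm (norm (A m (r k) x - L m x) powr p) \<le> (2 * b m) powr p" for k
      proof (intro AE_I2)
        fix x
        have "norm (A m (r k) x - L m x) \<le> 2 * b m"
          using norm_triangle_ineq4[of "A m (r k) x" "L m x"] A_b[of m "r k" x] Lb[of m x] by linarith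
        then show "norm (norm (A m (r k) x - L m x) powr p) \<le> (2 * b m) powr p"
          using p by (auto intro!: powr_mono2)
      qed
    qed auto
    then show ?thesis by (simp add: p_mass_def)
  qed
  have p0: "0 \<le> p" using p by simp
  have "p_cauchy (lebesgue_on S) p (\<lambda>k. g (r k))"
  proof (rule p_cauchy_approx[OF p0])
    show "pow_integrable (lebesgue_on S) p (g (r k))" for k
      using g[of "r k"] p_mass_lebesgue_on_le(1)[OF SL] unfolding translation_bounded_def by blast
    fix \<delta> :: real assume d: "0 < \<delta>"
    have "(\<lambda>m. B * (1 / real (Suc m)) powr p) \<longlonglongrightarrow> B * 0 powr p"
      using p by (intro tendsto_mult tendsto_powr2 tendsto_const LIMSEQ_Suc[OF lim_const_over_n]) auto
    then have "eventually (\<lambda>m. B * (1 / real (Suc m)) powr p < \<delta>) sequentially"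
      using d by (intro order_tendstoD) auto
    then obtain m where m: "B * (1 / real (Suc m)) powr p < \<delta>" by (auto simp: eventually_sequentially)
    have i: "pow_integrable (lebesgue_on S) p (A m k)" "pow_integrable (lebesgue_on S) p (L m)" for k
      using pS[OF Am A_b] pS[OF Lm Lb] by blast+
    have "p_mass (lebesgue_on S) p (\<lambda>x. g (r k) x - A m (r k) x) < \<delta>" for k
      using p_mass_lebesgue_on_le(2)[OF SL A_est(4)[of m "r k"]] A_est(5)[of m "r k"] m
      by (simp add: p_mass_minus_commute[of _ _ "g (r k)"])
    then show "\<exists>h. (\<forall>k. pow_integrable (lebesgue_on S) p (h k)) \<and> p_cauchy (lebesgue_on S) p h \<and>
        (\<exists>K. \<forall>k\<ge>K. p_mass (lebesgue_on S) p (\<lambda>x. g (r k) x - h k x) < \<delta>)"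
      using p_cauchy_of_limit[OF p0 i(1) i(2) A_L] i(1) by (intro exI[of _ "\<lambda>k. A m (r k)"]) blast
  qed
  then show ?thesis using that r(1) by blast
qed

text \<open>Rellich's theorem for test functions: the Poincare inequality and the translation estimate turn a
  bound for the gradients into the hypotheses of the compactness criterion.\<close>

theorem test_functions_compactness:
  fixes \<phi> :: "nat \<Rightarrow> real^'n \<Rightarrow> real^'d"
  assumes p: "1 < p" and \<Omega>: "bounded \<Omega>" "\<Omega> \<in> lmeasurable"
    and phi: "\<And>k. \<phi> k \<in> test_functions \<Omega>"
    and B: "\<And>k. p_mass lborel p (gradient (\<phi> k)) \<le> B"
  obtains r where "strict_mono (r :: nat \<Rightarrow> nat)" "p_cauchy (lebesgue_on \<Omega>) p (\<lambda>k. \<phi> (r k))"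
proof -
  obtain P where P: "0 < P"
    "\<And>\<phi> :: real^'n \<Rightarrow> real^'d. \<phi> \<in> test_functions \<Omega> \<Longrightarrow> p_mass lborel p \<phi> \<le> P * p_mass lborel p (gradient \<phi>)"
    by (rule poincare_inequality[OF p \<Omega>(1)]) blast
  have "translation_bounded p (max (P * B) B) (\<phi> k)" for k
    unfolding translation_bounded_def
  proof (intro conjI allI)
    show cont: "continuous_on UNIV (\<phi> k)" by (rule test_functions_continuous[OF phi])
    obtain K where K: "compact K" "K \<subseteq> \<Omega>" "\<And>x. x \<notin> K \<Longrightarrow> \<phi> k x = 0"
      "\<And>x h. x \<notin> K \<Longrightarrow> frechet_derivative (\<phi> k) (at x) h = 0" by (rule test_functions_support[OF phi]) blast
    have "bounded (\<phi> k ` K)"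
      using K(1) cont by (intro compact_imp_bounded compact_continuous_image) (auto intro: continuous_on_subset)
    moreover have "range (\<phi> k) \<subseteq> insert 0 (\<phi> k ` K)" using K(3) by auto
    ultimately show "bounded (range (\<phi> k))" using bounded_subset[of "insert 0 (\<phi> k ` K)"] by simp
    show "pow_integrable lborel p (\<phi> k)" using p by (intro test_function_pow_integrable[OF _ phi]) auto
    have "p_mass lborel p (\<phi> k) \<le> P * p_mass lborel p (gradient (\<phi> k))" by (rule P(2)[OF phi])
    also have "\<dots> \<le> P * B" using P(1) B by (intro mult_left_mono) auto
    finally show "p_mass lborel p (\<phi> k) \<le> max (P * B) B" by simp
    fix h
    show "pow_integrable lborel p (\<lambda>x. \<phi> k (x + h) - \<phi> k x)" by (rule translation_estimate(1)[OF p phi])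
    have "p_mass lborel p (\<lambda>x. \<phi> k (x + h) - \<phi> k x) \<le> norm h powr p * p_mass lborel p (gradient (\<phi> k))"
      by (rule translation_estimate(2)[OF p phi])
    also have "\<dots> \<le> norm h powr p * max (P * B) B" using B[of k] by (intro mult_left_mono) auto
    finally show "p_mass lborel p (\<lambda>x. \<phi> k (x + h) - \<phi> k x) \<le> max (P * B) B * norm h powr p"
      by (simp add: mult.commute)
  qed
  then show ?thesis using riesz_kolmogorov[OF p _ \<Omega>(2)] that by blast
qed

section \<open>Sobolev functions as pairs of a function and its gradient\<close>

lemma Lp_space_iff: "v \<in> Lp_space p \<Omega> \<longleftrightarrow> pow_integrable (lebesgue_on \<Omega>) p v"
  by (simp add: Lp_space_def pow_integrable_def)

lemma integral_lebesgue_on_eq_lborel: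
  fixes f :: "'a::euclidean_space \<Rightarrow> 'b::euclidean_space"
  assumes "S \<in> sets lebesgue" "f \<in> borel_measurable borel" "\<And>x. x \<notin> S \<Longrightarrow> f x = 0"
  shows "(LINT x|lebesgue_on S. f x) = (\<integral>x. f x \<partial>lborel)"
proof -
  have "(LINT x|lebesgue_on S. f x) = (LINT x|lebesgue. indicator S x *\<^sub>R f x)"
    by (rule integral_lebesgue_on_eq[OF assms(1)])
  also have "\<dots> = (LINT x|lebesgue. f x)"
    using assms(3) by (intro Bochner_Integration.integral_cong) (auto simp: indicator_def)
  finally show ?thesis using assms(2) by (simp add: integral_completion)
qed

lemma p_mass_lebesgue_on_eq_lborel:
  fixes f :: "'a::euclidean_space \<Rightarrow> 'b::euclidean_space"
  assumes "S \<in> sets lebesgue" "f \<in> borel_measurable borel" "\<And>x. x \<notin> S \<Longrightarrow> f x = 0"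
  shows "p_mass (lebesgue_on S) p f = p_mass lborel p f"
  unfolding p_mass_def using assms by (intro integral_lebesgue_on_eq_lborel) auto

lemma integrable_lebesgue_on_locally_integrable:
  fixes v :: "'a::euclidean_space \<Rightarrow> 'b::euclidean_space"
  assumes \<Omega>: "\<Omega> \<in> sets lebesgue" and v: "integrable (lebesgue_on \<Omega>) v"
  shows "locally_integrable \<Omega> v"
  unfolding locally_integrable_def
proof (intro allI impI)
  fix K assume K: "compact K \<and> K \<subseteq> \<Omega>"
  then have KL: "K \<in> sets lebesgue" by (simp add: borel_compact)
  have "integrable lebesgue (\<lambda>x. indicator \<Omega> x *\<^sub>R v x)"
    using v by (simp only: integrable_lebesgue_on_iff[OF \<Omega>])
  then have "integrable lebesgue (\<lambda>x. indicator K x *\<^sub>R (indicator \<Omega> x *\<^sub>R v x))"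
    by (rule integrable_mult_indicator[OF KL])
  moreover have "indicator K x *\<^sub>R (indicator \<Omega> x *\<^sub>R v x) = indicator K x *\<^sub>R v x" for x
    using K by (auto simp: indicator_def)
  ultimately show "integrable (lebesgue_on K) v" by (simp only: integrable_lebesgue_on_iff[OF KL])
qed

lemma locally_integrable_bounded_linear:
  assumes "bounded_linear T" "locally_integrable \<Omega> v"
  shows "locally_integrable \<Omega> (\<lambda>x. T (v x))"
  using assms(2) unfolding locally_integrable_def
  by (auto intro: integrable_bounded_linear[OF assms(1)])

lemma locally_integrable_add:
  assumes "locally_integrable \<Omega> v" "locally_integrable \<Omega> w"
  shows "locally_integrable \<Omega> (\<lambda>x. v x + w x)"
  using assms unfolding locally_integrable_def by auto

lemma locally_integrable_diff:
  assumes "locally_integrable \<Omega> v" "locally_integrable \<Omega> w"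
  shows "locally_integrable \<Omega> (\<lambda>x. v x - w x)"
  using assms unfolding locally_integrable_def by auto

lemma locally_integrable_times_compact_support:
  fixes g \<psi> :: "'a::euclidean_space \<Rightarrow> real"
  assumes \<Omega>: "\<Omega> \<in> sets lebesgue" and g: "locally_integrable \<Omega> g"
    and K: "compact K" "K \<subseteq> \<Omega>" and psi: "continuous_on UNIV \<psi>" "\<And>x. x \<notin> K \<Longrightarrow> \<psi> x = 0"
  shows "integrable (lebesgue_on \<Omega>) (\<lambda>x. g x * \<psi> x)"
proof -
  have KL: "K \<in> sets lebesgue" using K by (simp add: borel_compact)
  have gK: "integrable lebesgue (\<lambda>x. indicator K x *\<^sub>R g x)"
    using g K by (simp only: locally_integrable_def integrable_lebesgue_on_iff[OF KL, symmetric])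
  have "bounded (\<psi> ` K)"
    using psi(1) K(1) by (intro compact_imp_bounded compact_continuous_image) (auto intro: continuous_on_subset)
  then obtain B where B: "\<And>x. x \<in> K \<Longrightarrow> norm (\<psi> x) \<le> B" unfolding bounded_iff by blast
  have psim: "\<psi> \<in> borel_measurable lebesgue"
    using borel_measurable_continuous_onI[OF psi(1)] by (intro measurable_completion) simp
  have "integrable lebesgue (\<lambda>x. (indicator K x *\<^sub>R g x) * \<psi> x)"
  proof (rule Bochner_Integration.integrable_bound)
    show "integrable lebesgue (\<lambda>x. B * norm (indicator K x *\<^sub>R g x))"
      by (intro integrable_mult_right integrable_norm gK)
    show "(\<lambda>x. (indicator K x *\<^sub>R g x) * \<psi> x) \<in> borel_measurable lebesgue"
      by (rule borel_measurable_times[OF borel_measurable_integrable[OF gK] psim])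
    show "AE x in lebesgue. norm ((indicator K x *\<^sub>R g x) * \<psi> x) \<le> norm (B * norm (indicator K x *\<^sub>R g x))"
    proof (intro AE_I2)
      fix x
      show "norm ((indicator K x *\<^sub>R g x) * \<psi> x) \<le> norm (B * norm (indicator K x *\<^sub>R g x))"
      proof (cases "x \<in> K")
        case True
        have "\<bar>g x\<bar> * \<bar>\<psi> x\<bar> \<le> \<bar>g x\<bar> * \<bar>B\<bar>" using B[OF True] by (intro mult_left_mono) auto
        then show ?thesis using True by (simp add: abs_mult mult.commute)
      qed simp
    qed
  qed
  moreover have "(indicator K x *\<^sub>R g x) * \<psi> x = indicator \<Omega> x *\<^sub>R (g x * \<psi> x)" for x
    using K(2) psi(2)[of x] by (auto simp: indicator_def)
  ultimately show ?thesis by (simp only: integrable_lebesgue_on_iff[OF \<Omega>])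
qed

lemma test_function_products_integrable:
  fixes g \<psi> :: "'a::euclidean_space \<Rightarrow> real"
  assumes \<Omega>: "\<Omega> \<in> sets lebesgue" and g: "locally_integrable \<Omega> g" and psi: "\<psi> \<in> test_functions \<Omega>"
  shows "integrable (lebesgue_on \<Omega>) (\<lambda>x. g x * \<psi> x)"
    and "integrable (lebesgue_on \<Omega>) (\<lambda>x. g x * frechet_derivative \<psi> (at x) h)"
proof -
  obtain K where K: "compact K" "K \<subseteq> \<Omega>" "\<And>x. x \<notin> K \<Longrightarrow> \<psi> x = 0"
    "\<And>x h. x \<notin> K \<Longrightarrow> frechet_derivative \<psi> (at x) h = 0" by (rule test_functions_support[OF psi]) blast
  show "integrable (lebesgue_on \<Omega>) (\<lambda>x. g x * \<psi> x)"
    by (rule locally_integrable_times_compact_support[OF \<Omega> g K(1,2) test_functions_continuous[OF psi] K(3)])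
  show "integrable (lebesgue_on \<Omega>) (\<lambda>x. g x * frechet_derivative \<psi> (at x) h)"
    by (rule locally_integrable_times_compact_support[OF \<Omega> g K(1,2) test_functions_partial_continuous[OF psi] K(4)])
qed

lemma locally_integrable_entry:
  fixes G :: "real^'n \<Rightarrow> real^'m^'d"
  assumes "locally_integrable \<Omega> G"
  shows "locally_integrable \<Omega> (\<lambda>x. G x $ j $ i)"
  using locally_integrable_bounded_linear[OF bounded_linear_vec_nth
      locally_integrable_bounded_linear[OF bounded_linear_vec_nth assms]] .

lemma has_weak_gradient_add:
  fixes \<Omega> :: "(real^'n) set" and v w :: "real^'n \<Rightarrow> real^'d"
  assumes \<Omega>: "\<Omega> \<in> sets lebesgue" and v: "has_weak_gradient \<Omega> v G" and w: "has_weak_gradient \<Omega> w H"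
  shows "has_weak_gradient \<Omega> (\<lambda>x. v x + w x) (\<lambda>x. G x + H x)"
  unfolding has_weak_gradient_def
proof (intro conjI ballI allI)
  have L: "locally_integrable \<Omega> v" "locally_integrable \<Omega> w" "locally_integrable \<Omega> G" "locally_integrable \<Omega> H"
    using v w by (auto simp: has_weak_gradient_def)
  show "locally_integrable \<Omega> (\<lambda>x. v x + w x)" "locally_integrable \<Omega> (\<lambda>x. G x + H x)"
    using L by (auto intro: locally_integrable_add)
  fix \<psi> :: "real^'n \<Rightarrow> real" and i j assume psi: "\<psi> \<in> test_functions \<Omega>"
  note cL = L(1,2)[THEN locally_integrable_bounded_linear[OF bounded_linear_vec_nth, of _ _ j]]
    L(3,4)[THEN locally_integrable_entry, of j i]
  have "(LINT x|lebesgue_on \<Omega>. v x $ j * frechet_derivative \<psi> (at x) (axis i 1)) = - (LINT x|lebesgue_on \<Omega>. (G x $ j $ i) * \<psi> x)"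
    "(LINT x|lebesgue_on \<Omega>. w x $ j * frechet_derivative \<psi> (at x) (axis i 1)) = - (LINT x|lebesgue_on \<Omega>. (H x $ j $ i) * \<psi> x)"
    using v w psi by (auto simp: has_weak_gradient_def)
  then show "(LINT x|lebesgue_on \<Omega>. (v x + w x) $ j * frechet_derivative \<psi> (at x) (axis i 1))
     = - (LINT x|lebesgue_on \<Omega>. ((G x + H x) $ j $ i) * \<psi> x)"
    using test_function_products_integrable[OF \<Omega> _ psi] cL by (simp add: distrib_right)
qed

lemma has_weak_gradient_scaleR:
  assumes "has_weak_gradient \<Omega> v G"
  shows "has_weak_gradient \<Omega> (\<lambda>x. c *\<^sub>R v x) (\<lambda>x. c *\<^sub>R G x)"
  using assms unfolding has_weak_gradient_def
  by (auto intro: locally_integrable_bounded_linear[OF bounded_linear_scaleR_right] simp: mult.assoc)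

lemma has_weak_gradient_diff:
  assumes \<Omega>: "\<Omega> \<in> sets lebesgue" and v: "has_weak_gradient \<Omega> v G" and w: "has_weak_gradient \<Omega> w H"
  shows "has_weak_gradient \<Omega> (\<lambda>x. v x - w x) (\<lambda>x. G x - H x)"
  using has_weak_gradient_add[OF \<Omega> v has_weak_gradient_scaleR[OF w, of "-1"]] by simp

theorem has_weak_gradient_unique:
  fixes \<Omega> :: "(real^'n) set" and v :: "real^'n \<Rightarrow> real^'d"
  assumes \<Omega>: "open \<Omega>" and v: "has_weak_gradient \<Omega> v G" and w: "has_weak_gradient \<Omega> v H"
  shows "AE x in lebesgue_on \<Omega>. G x = H x"
proof -
  have \<Omega>L: "\<Omega> \<in> sets lebesgue" using \<Omega> by simp
  have L: "locally_integrable \<Omega> G" "locally_integrable \<Omega> H" using v w by (auto simp: has_weak_gradient_def)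
  have "AE x in lebesgue_on \<Omega>. G x $ j $ i - H x $ j $ i = 0" for i j
  proof (rule fundamental_lemma_calculus_of_variations[OF \<Omega>])
    show "locally_integrable \<Omega> (\<lambda>x. G x $ j $ i - H x $ j $ i)"
      by (intro locally_integrable_diff locally_integrable_entry L)
    fix \<psi> :: "real^'n \<Rightarrow> real" assume psi: "\<psi> \<in> test_functions \<Omega>"
    have "- (LINT x|lebesgue_on \<Omega>. (G x $ j $ i) * \<psi> x) = (LINT x|lebesgue_on \<Omega>. v x $ j * frechet_derivative \<psi> (at x) (axis i 1))"
      "- (LINT x|lebesgue_on \<Omega>. (H x $ j $ i) * \<psi> x) = (LINT x|lebesgue_on \<Omega>. v x $ j * frechet_derivative \<psi> (at x) (axis i 1))"
      using v w psi by (simp_all add: has_weak_gradient_def)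
    then have "(LINT x|lebesgue_on \<Omega>. (G x $ j $ i) * \<psi> x) = (LINT x|lebesgue_on \<Omega>. (H x $ j $ i) * \<psi> x)"
      by linarith
    then show "(LINT x|lebesgue_on \<Omega>. (G x $ j $ i - H x $ j $ i) * \<psi> x) = 0"
      using test_function_products_integrable(1)[OF \<Omega>L locally_integrable_entry[OF L(1)] psi]
        test_function_products_integrable(1)[OF \<Omega>L locally_integrable_entry[OF L(2)] psi]
      by (simp add: left_diff_distrib)
  qed
  then have "AE x in lebesgue_on \<Omega>. \<forall>j\<in>UNIV. \<forall>i\<in>UNIV. G x $ j $ i - H x $ j $ i = 0"
    by (intro AE_finite_allI) auto
  then show ?thesis by eventually_elim (simp add: vec_eq_iff)
qed

lemma test_function_component:
  fixes \<phi> :: "real^'n \<Rightarrow> real^'d"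
  assumes "\<phi> \<in> test_functions \<Omega>"
  shows "(\<lambda>x. \<phi> x $ j) \<in> test_functions \<Omega>"
    and "frechet_derivative (\<lambda>x. \<phi> x $ j) (at x) (axis i 1) = gradient \<phi> x $ j $ i"
proof -
  have "(\<lambda>x. \<phi> x \<bullet> axis j 1) \<in> test_functions \<Omega>"
    using assms by (intro test_functions_restrict_support[OF assms] C_k_inner_const) (auto simp: test_functions_def)
  then show "(\<lambda>x. \<phi> x $ j) \<in> test_functions \<Omega>" by (simp add: inner_axis)
  have "((\<lambda>x. \<phi> x $ j) has_derivative (\<lambda>h. frechet_derivative \<phi> (at x) h $ j)) (at x)"
    by (rule bounded_linear.has_derivative[OF bounded_linear_vec_nth test_functions_has_derivative[OF assms]])
  from fun_cong[OF frechet_derivative_at[OF this], of "axis i 1"]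
  show "frechet_derivative (\<lambda>x. \<phi> x $ j) (at x) (axis i 1) = gradient \<phi> x $ j $ i"
    by (simp add: gradient_def)
qed

lemma test_function_has_weak_gradient:
  fixes \<phi> :: "real^'n \<Rightarrow> real^'d"
  assumes \<Omega>: "\<Omega> \<in> sets lebesgue" and phi: "\<phi> \<in> test_functions \<Omega>"
  shows "has_weak_gradient \<Omega> \<phi> (gradient \<phi>)"
  unfolding has_weak_gradient_def
proof (intro conjI ballI allI)
  have loc: "locally_integrable \<Omega> v" if "continuous_on UNIV v" for v :: "real^'n \<Rightarrow> 'b::euclidean_space"
    unfolding locally_integrable_def
  proof (intro allI impI)
    fix K assume K: "compact K \<and> K \<subseteq> \<Omega>"
    then have KL: "K \<in> sets lebesgue" by (simp add: borel_compact)
    have int: "integrable lborel (\<lambda>x. indicator K x *\<^sub>R v x)"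
      using K that by (intro borel_integrable_compact) (auto intro: continuous_on_subset)
    then have "integrable lebesgue (\<lambda>x. indicator K x *\<^sub>R v x)"
      using integrable_completion[OF borel_measurable_integrable[OF int]] by blast
    then show "integrable (lebesgue_on K) v" by (simp only: integrable_lebesgue_on_iff[OF KL])
  qed
  show "locally_integrable \<Omega> \<phi>" by (rule loc[OF test_functions_continuous[OF phi]])
  show "locally_integrable \<Omega> (gradient \<phi>)" by (rule loc[OF gradient_continuous[OF phi]])
  fix \<psi> :: "real^'n \<Rightarrow> real" and i j assume psi: "\<psi> \<in> test_functions \<Omega>"
  note pc = test_function_component[OF phi, of j]
  have "(LINT x|lebesgue_on \<Omega>. \<phi> x $ j * frechet_derivative \<psi> (at x) (axis i 1))
      = (\<integral>x. \<phi> x $ j * frechet_derivative \<psi> (at x) (axis i 1) \<partial>lborel)"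
    using test_functions_zero_outside(1)[OF phi]
    by (intro integral_lebesgue_on_eq_lborel[OF \<Omega>] borel_measurable_continuous_onI continuous_intros
        test_functions_continuous[OF phi] test_functions_partial_continuous[OF psi]) auto
  also have "\<dots> = - (\<integral>x. frechet_derivative (\<lambda>x. \<phi> x $ j) (at x) (axis i 1) * \<psi> x \<partial>lborel)"
    by (rule test_function_integration_by_parts[OF pc(1) psi])
  also have "(\<integral>x. frechet_derivative (\<lambda>x. \<phi> x $ j) (at x) (axis i 1) * \<psi> x \<partial>lborel)
      = (\<integral>x. gradient \<phi> x $ j $ i * \<psi> x \<partial>lborel)" by (simp add: pc(2))
  also have "\<dots> = (LINT x|lebesgue_on \<Omega>. gradient \<phi> x $ j $ i * \<psi> x)"
    using test_functions_zero_outside(1)[OF psi]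
    by (intro integral_lebesgue_on_eq_lborel[OF \<Omega>, symmetric] borel_measurable_continuous_onI continuous_intros
        gradient_continuous[OF phi] test_functions_continuous[OF psi]) auto
  finally show "(LINT x|lebesgue_on \<Omega>. \<phi> x $ j * frechet_derivative \<psi> (at x) (axis i 1))
     = - (LINT x|lebesgue_on \<Omega>. (gradient \<phi> x $ j $ i) * \<psi> x)" .
qed

text \<open>Completeness of Lebesgue measure.  It makes the arbitrary representative chosen by
  \<^const>\<open>weak_gradient\<close> measurable as soon as one weak gradient is.\<close>

lemma borel_measurable_lebesgue_on_AE:
  fixes f g :: "'a::euclidean_space \<Rightarrow> 'b::euclidean_space"
  assumes S: "S \<in> sets lebesgue" and f: "f \<in> borel_measurable (lebesgue_on S)"
    and ae: "AE x in lebesgue_on S. f x = g x"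
  shows "g \<in> borel_measurable (lebesgue_on S)"
proof -
  have "(\<lambda>x. indicator S x *\<^sub>R f x) \<in> borel_measurable lebesgue"
    using f S by (subst (asm) borel_measurable_restrict_space_iff) auto
  moreover have "AE x in lebesgue. indicator S x *\<^sub>R f x = indicator S x *\<^sub>R g x"
    using ae S by (subst (asm) AE_restrict_space_iff) (auto elim!: eventually_mono simp: indicator_def)
  ultimately have "(\<lambda>x. indicator S x *\<^sub>R g x) \<in> borel_measurable lebesgue"
    by (rule borel_measurable_AE)
  then show ?thesis using S by (subst borel_measurable_restrict_space_iff) auto
qed

lemma pow_integrable_AE_cong:
  fixes f g :: "'a::euclidean_space \<Rightarrow> 'b::euclidean_space"
  assumes S: "S \<in> sets lebesgue" and f: "pow_integrable (lebesgue_on S) p f"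
    and ae: "AE x in lebesgue_on S. f x = g x"
  shows "pow_integrable (lebesgue_on S) p g" and "p_mass (lebesgue_on S) p g = p_mass (lebesgue_on S) p f"
proof -
  have fm: "f \<in> borel_measurable (lebesgue_on S)" by (rule pow_integrable_measurable[OF f])
  have gm: "g \<in> borel_measurable (lebesgue_on S)" by (rule borel_measurable_lebesgue_on_AE[OF S fm ae])
  have ae': "AE x in lebesgue_on S. norm (f x) powr p = norm (g x) powr p" using ae by eventually_elim simp
  have "integrable (lebesgue_on S) (\<lambda>x. norm (g x) powr p)"
    using pow_integrable_integrable[OF f] ae' fm gm
    by (subst integrable_cong_AE[where g="\<lambda>x. norm (f x) powr p"]) (auto elim: eventually_mono)
  then show "pow_integrable (lebesgue_on S) p g" using gm by (simp add: pow_integrable_def)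
  show "p_mass (lebesgue_on S) p g = p_mass (lebesgue_on S) p f"
    unfolding p_mass_def using ae' fm gm by (intro integral_cong_AE) (auto elim: eventually_mono)
qed

lemma weak_gradient_eq_AE:
  assumes "open \<Omega>" "has_weak_gradient \<Omega> v G"
  shows "AE x in lebesgue_on \<Omega>. G x = weak_gradient \<Omega> v x"
proof -
  have "has_weak_gradient \<Omega> v (weak_gradient \<Omega> v)"
    unfolding weak_gradient_def by (rule someI[of "has_weak_gradient \<Omega> v", OF assms(2)])
  then show ?thesis by (rule has_weak_gradient_unique[OF assms])
qed

lemma sobolev_weak_gradient:
  assumes \<Omega>: "open \<Omega>" and v: "v \<in> sobolev p \<Omega>"
  shows "has_weak_gradient \<Omega> v (weak_gradient \<Omega> v)"
    and "pow_integrable (lebesgue_on \<Omega>) p (weak_gradient \<Omega> v)"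
    and "pow_integrable (lebesgue_on \<Omega>) p v"
proof -
  obtain G where G: "pow_integrable (lebesgue_on \<Omega>) p G" "has_weak_gradient \<Omega> v G"
    using v by (auto simp: sobolev_def Lp_space_iff)
  show "has_weak_gradient \<Omega> v (weak_gradient \<Omega> v)"
    unfolding weak_gradient_def by (rule someI[of "has_weak_gradient \<Omega> v", OF G(2)])
  show "pow_integrable (lebesgue_on \<Omega>) p (weak_gradient \<Omega> v)"
    using \<Omega> by (intro pow_integrable_AE_cong(1)[OF _ G(1) weak_gradient_eq_AE[OF \<Omega> G(2)]]) simp
  show "pow_integrable (lebesgue_on \<Omega>) p v" using v by (simp add: sobolev_def Lp_space_iff)
qed

text \<open>\<open>W\<^sub>0\<^sup>1\<^sup>,\<^sup>p\<close> as the closure, in a single \<open>L\<^sup>p\<close> space, of the graph of the gradient on test functions.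
  A member carries a function and its gradient together, so that convex combinations and limits
  act on both at once, and closedness under limits in the mean is immediate.\<close>

definition sobolev0_pairs ::
    "real \<Rightarrow> (real^'n) set \<Rightarrow> (real^'n \<Rightarrow> (real^'d) \<times> (real^'n^'d)) set" where
  "sobolev0_pairs p \<Omega> = {z. pow_integrable (lebesgue_on \<Omega>) p z \<and>
     (\<forall>\<eta>>0. \<exists>\<phi>\<in>test_functions \<Omega>. p_mass (lebesgue_on \<Omega>) p (\<lambda>x. z x - (\<phi> x, gradient \<phi> x)) < \<eta>)}"

lemma pow_integrable_fst_snd:
  fixes z :: "'a \<Rightarrow> 'b::euclidean_space \<times> 'c::euclidean_space"
  assumes p: "0 \<le> p" and z: "pow_integrable M p z"
  shows "pow_integrable M p (\<lambda>x. fst (z x))" "pow_integrable M p (\<lambda>x. snd (z x))"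
    and "p_mass M p (\<lambda>x. fst (z x)) \<le> p_mass M p z" "p_mass M p (\<lambda>x. snd (z x)) \<le> p_mass M p z"
proof -
  have m: "(\<lambda>x. fst (z x)) \<in> borel_measurable M" "(\<lambda>x. snd (z x)) \<in> borel_measurable M"
    by (intro measurable_compose[OF pow_integrable_measurable[OF z]] borel_measurable_continuous_onI continuous_intros)+
  have le: "norm (fst (z x)) powr p \<le> norm (z x) powr p" "norm (snd (z x)) powr p \<le> norm (z x) powr p" for x
    using p norm_fst_le[of "fst (z x)" "snd (z x)"] norm_snd_le[of "snd (z x)" "fst (z x)"] by (auto intro!: powr_mono2)
  show 1: "pow_integrable M p (\<lambda>x. fst (z x))"
    using le by (intro pow_integrable_bound[OF z m(1), where C=1]) auto
  show 2: "pow_integrable M p (\<lambda>x. snd (z x))"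
    using le by (intro pow_integrable_bound[OF z m(2), where C=1]) auto
  show "p_mass M p (\<lambda>x. fst (z x)) \<le> p_mass M p z" "p_mass M p (\<lambda>x. snd (z x)) \<le> p_mass M p z"
    unfolding p_mass_def using le 1 2 z by (auto intro!: integral_mono simp: pow_integrable_def)
qed

lemma pow_integrable_Pair:
  fixes v :: "'a \<Rightarrow> 'b::euclidean_space" and w :: "'a \<Rightarrow> 'c::euclidean_space"
  assumes p: "0 \<le> p" and v: "pow_integrable M p v" and w: "pow_integrable M p w"
  shows "pow_integrable M p (\<lambda>x. (v x, w x))"
    and "p_mass M p (\<lambda>x. (v x, w x)) \<le> 2 powr p * (p_mass M p v + p_mass M p w)"
proof -
  have 1: "pow_integrable M p (\<lambda>x. (v x, 0 :: 'c))"
    using pow_integrable_measurable[OF v] by (intro pow_integrable_bound[OF v, where C=1]) auto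
  have 2: "pow_integrable M p (\<lambda>x. (0 :: 'b, w x))"
    using pow_integrable_measurable[OF w] by (intro pow_integrable_bound[OF w, where C=1]) auto
  show "pow_integrable M p (\<lambda>x. (v x, w x))" using pow_integrable_add[OF p 1 2] by simp
  show "p_mass M p (\<lambda>x. (v x, w x)) \<le> 2 powr p * (p_mass M p v + p_mass M p w)"
    using p_mass_add_le[OF p 1 2] by (simp add: p_mass_def)
qed

context
  fixes p :: real and \<Omega> :: "(real^'n) set"
  assumes p: "1 < p" and \<Omega>: "open \<Omega>" "bounded \<Omega>"
begin

lemma domain_measurable: "\<Omega> \<in> sets lebesgue" "\<Omega> \<in> lmeasurable" "finite_measure (lebesgue_on \<Omega>)"
proof -
  show "\<Omega> \<in> lmeasurable" using \<Omega> by (intro lmeasurable_open)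
  then show "\<Omega> \<in> sets lebesgue" "finite_measure (lebesgue_on \<Omega>)"
    using finite_measure_lebesgue_on fmeasurableD by blast+
qed

lemma test_function_pair_pow_integrable:
  fixes \<phi> :: "real^'n \<Rightarrow> real^'d"
  assumes "\<phi> \<in> test_functions \<Omega>"
  shows "pow_integrable (lebesgue_on \<Omega>) p \<phi>" "pow_integrable (lebesgue_on \<Omega>) p (gradient \<phi>)"
    "pow_integrable (lebesgue_on \<Omega>) p (\<lambda>x. (\<phi> x, gradient \<phi> x))"
    "p_mass (lebesgue_on \<Omega>) p \<phi> = p_mass lborel p \<phi>"
    "p_mass (lebesgue_on \<Omega>) p (gradient \<phi>) = p_mass lborel p (gradient \<phi>)"
proof -
  show 1: "pow_integrable (lebesgue_on \<Omega>) p \<phi>" "pow_integrable (lebesgue_on \<Omega>) p (gradient \<phi>)"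
    using p by (intro p_mass_lebesgue_on_le domain_measurable test_function_pow_integrable[OF _ assms]
        gradient_pow_integrable[OF _ assms]; simp)+
  show "pow_integrable (lebesgue_on \<Omega>) p (\<lambda>x. (\<phi> x, gradient \<phi> x))"
    using p by (intro pow_integrable_Pair 1) simp
  show "p_mass (lebesgue_on \<Omega>) p \<phi> = p_mass lborel p \<phi>"
    using test_functions_zero_outside(1)[OF assms]
    by (intro p_mass_lebesgue_on_eq_lborel domain_measurable borel_measurable_continuous_onI test_functions_continuous[OF assms])
  show "p_mass (lebesgue_on \<Omega>) p (gradient \<phi>) = p_mass lborel p (gradient \<phi>)"
    using gradient_zero_outside[OF assms]
    by (intro p_mass_lebesgue_on_eq_lborel domain_measurable borel_measurable_continuous_onI gradient_continuous[OF assms])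
qed

lemma pow_integrable_locally_integrable:
  "pow_integrable (lebesgue_on \<Omega>) p v \<Longrightarrow> locally_integrable \<Omega> v"
  using norm_integral_powr_le(1)[OF domain_measurable(3) p] integrable_lebesgue_on_locally_integrable[OF domain_measurable(1)]
  by blast

text \<open>Fix a test function \<open>\<psi>\<close> and indices.  The functional \<open>T\<close> is the defect in the defining identity of
  a weak gradient.  It is linear, continuous in the mean, and vanishes on the graph of the gradient
  by integration by parts; hence it vanishes on the closure.\<close>

lemma sobolev0_pairs_has_weak_gradient:
  fixes z :: "real^'n \<Rightarrow> (real^'d) \<times> (real^'n^'d)"
  assumes z: "z \<in> sobolev0_pairs p \<Omega>"
  shows "has_weak_gradient \<Omega> (\<lambda>x. fst (z x)) (\<lambda>x. snd (z x))"
  unfolding has_weak_gradient_def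
proof (intro conjI ballI allI)
  let ?M = "lebesgue_on \<Omega>"
  interpret finite_measure ?M by (rule domain_measurable)
  have p0: "0 \<le> p" using p by simp
  have zi: "pow_integrable ?M p z" using z by (simp add: sobolev0_pairs_def)
  show "locally_integrable \<Omega> (\<lambda>x. fst (z x))" "locally_integrable \<Omega> (\<lambda>x. snd (z x))"
    by (intro pow_integrable_locally_integrable pow_integrable_fst_snd[OF p0 zi])+
  fix \<psi> :: "real^'n \<Rightarrow> real" and i j assume psi: "\<psi> \<in> test_functions \<Omega>"
  define T where "T w = (LINT x|?M. fst (w x) $ j * frechet_derivative \<psi> (at x) (axis i 1))
      + (LINT x|?M. snd (w x) $ j $ i * \<psi> x)" for w :: "real^'n \<Rightarrow> (real^'d) \<times> (real^'n^'d)"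
  have T_int: "integrable ?M (\<lambda>x. fst (w x) $ j * frechet_derivative \<psi> (at x) (axis i 1))"
    "integrable ?M (\<lambda>x. snd (w x) $ j $ i * \<psi> x)" if "pow_integrable ?M p w" for w :: "real^'n \<Rightarrow> (real^'d) \<times> (real^'n^'d)"
  proof -
    note l = pow_integrable_fst_snd(1,2)[OF p0 that, THEN pow_integrable_locally_integrable]
    show "integrable ?M (\<lambda>x. fst (w x) $ j * frechet_derivative \<psi> (at x) (axis i 1))"
      using locally_integrable_bounded_linear[OF bounded_linear_vec_nth l(1)]
      by (rule test_function_products_integrable(2)[OF domain_measurable(1) _ psi])
    show "integrable ?M (\<lambda>x. snd (w x) $ j $ i * \<psi> x)"
      using locally_integrable_entry[OF l(2)]
      by (rule test_function_products_integrable(1)[OF domain_measurable(1) _ psi])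
  qed
  obtain K where K: "compact K" "K \<subseteq> \<Omega>" "\<And>x. x \<notin> K \<Longrightarrow> \<psi> x = 0"
    "\<And>x h. x \<notin> K \<Longrightarrow> frechet_derivative \<psi> (at x) h = 0" by (rule test_functions_support[OF psi]) blast
  have "bounded ((\<lambda>x. (\<psi> x, frechet_derivative \<psi> (at x) (axis i 1))) ` K)"
    using K(1) by (intro compact_imp_bounded compact_continuous_image continuous_on_Pair
        continuous_on_subset[OF test_functions_continuous[OF psi]]
        continuous_on_subset[OF test_functions_partial_continuous[OF psi]]) auto
  then obtain b where b: "0 < b" "\<And>x. x \<in> K \<Longrightarrow> norm (\<psi> x, frechet_derivative \<psi> (at x) (axis i 1)) \<le> b"
    unfolding bounded_pos by blast
  have b1: "\<bar>\<psi> x\<bar> \<le> b" for x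
    using b(1) b(2)[of x] K(3)[of x] norm_fst_le[of "\<psi> x" "frechet_derivative \<psi> (at x) (axis i 1)"]
    by (cases "x \<in> K") auto
  have b2: "\<bar>frechet_derivative \<psi> (at x) (axis i 1)\<bar> \<le> b" for x
    using b(1) b(2)[of x] K(4)[of x] norm_snd_le[of "frechet_derivative \<psi> (at x) (axis i 1)" "\<psi> x"]
    by (cases "x \<in> K") auto
  have T_le: "\<bar>T w\<bar> \<le> (2 * b) * (\<integral>x. norm (w x) \<partial>?M)" if w: "pow_integrable ?M p w"
    for w :: "real^'n \<Rightarrow> (real^'d) \<times> (real^'n^'d)"
  proof -
    have wi: "integrable ?M w" by (rule norm_integral_powr_le(1)[OF domain_measurable(3) p w])
    have "T w = (LINT x|?M. fst (w x) $ j * frechet_derivative \<psi> (at x) (axis i 1) + snd (w x) $ j $ i * \<psi> x)"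
      unfolding T_def using T_int[OF w] by simp
    also have "\<bar>\<dots>\<bar> \<le> (LINT x|?M. \<bar>fst (w x) $ j * frechet_derivative \<psi> (at x) (axis i 1) + snd (w x) $ j $ i * \<psi> x\<bar>)"
      by (rule integral_abs_bound)
    also have "\<dots> \<le> (LINT x|?M. (2 * b) * norm (w x))"
    proof (rule integral_mono)
      show "integrable ?M (\<lambda>x. \<bar>fst (w x) $ j * frechet_derivative \<psi> (at x) (axis i 1) + snd (w x) $ j $ i * \<psi> x\<bar>)"
        using T_int[OF w] by (intro integrable_abs Bochner_Integration.integrable_add)
      show "integrable ?M (\<lambda>x. (2 * b) * norm (w x))" using wi by (intro integrable_mult_right integrable_norm)
      fix x
      have "\<bar>fst (w x) $ j\<bar> \<le> norm (w x)"
        using component_le_norm_cart[of "fst (w x)" j] norm_fst_le[of "fst (w x)" "snd (w x)"] by simp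
      then have "\<bar>fst (w x) $ j * frechet_derivative \<psi> (at x) (axis i 1)\<bar> \<le> norm (w x) * b"
        unfolding abs_mult using b2 by (intro mult_mono) auto
      moreover have "\<bar>snd (w x) $ j $ i\<bar> \<le> norm (w x)"
        using component_le_norm_cart[of "snd (w x) $ j" i] Finite_Cartesian_Product.norm_nth_le[of "snd (w x)" j]
          norm_snd_le[of "snd (w x)" "fst (w x)"] by simp
      then have "\<bar>snd (w x) $ j $ i * \<psi> x\<bar> \<le> norm (w x) * b"
        unfolding abs_mult using b1 by (intro mult_mono) auto
      ultimately show "\<bar>fst (w x) $ j * frechet_derivative \<psi> (at x) (axis i 1) + snd (w x) $ j $ i * \<psi> x\<bar> \<le> (2 * b) * norm (w x)"
        using abs_triangle_ineq[of "fst (w x) $ j * frechet_derivative \<psi> (at x) (axis i 1)" "snd (w x) $ j $ i * \<psi> x"]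
        by (simp only: mult_2 distrib_right) (simp add: mult.commute)
    qed
    finally show ?thesis by simp
  qed
  define C where "C = (2 * b) powr p * measure ?M (space ?M) powr (p - 1)"
  have T_powr: "\<bar>T w\<bar> powr p \<le> C * p_mass ?M p w" if w: "pow_integrable ?M p w"
    for w :: "real^'n \<Rightarrow> (real^'d) \<times> (real^'n^'d)"
  proof -
    have "\<bar>T w\<bar> powr p \<le> ((2 * b) * (\<integral>x. norm (w x) \<partial>?M)) powr p"
      using T_le[OF w] p by (intro powr_mono2) auto
    also have "\<dots> = (2 * b) powr p * (\<integral>x. norm (w x) \<partial>?M) powr p"
      using b(1) by (simp add: powr_mult)
    also have "\<dots> \<le> (2 * b) powr p * (measure ?M (space ?M) powr (p - 1) * p_mass ?M p w)"
      by (intro mult_left_mono norm_integral_powr_le(2)[OF domain_measurable(3) p w]) auto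
    finally show ?thesis by (simp add: C_def mult.assoc)
  qed
  have C0: "0 \<le> C" by (simp add: C_def)
  have "\<bar>T z\<bar> powr p \<le> 0 + e" if e: "0 < e" for e
  proof -
    have "0 < e / (C + 1)" using e C0 by simp
    then obtain \<phi> where phi: "\<phi> \<in> test_functions \<Omega>"
      "p_mass ?M p (\<lambda>x. z x - (\<phi> x, gradient \<phi> x)) < e / (C + 1)"
      using z by (auto simp: sobolev0_pairs_def)
    note phi_i = test_function_pair_pow_integrable(3)[OF phi(1)]
    have "T (\<lambda>x. (\<phi> x, gradient \<phi> x)) = 0"
      using test_function_has_weak_gradient[OF domain_measurable(1) phi(1)] psi
      by (simp add: T_def has_weak_gradient_def)
    moreover have "T (\<lambda>x. z x - (\<phi> x, gradient \<phi> x)) = T z - T (\<lambda>x. (\<phi> x, gradient \<phi> x))"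
      using T_int[OF zi] T_int[OF phi_i] by (simp add: T_def left_diff_distrib)
    ultimately have "\<bar>T z\<bar> powr p \<le> C * p_mass ?M p (\<lambda>x. z x - (\<phi> x, gradient \<phi> x))"
      using T_powr[OF pow_integrable_diff[OF p0 zi phi_i]] by simp
    also have "\<dots> \<le> C * (e / (C + 1))" using phi(2) C0 by (intro mult_left_mono) auto
    also have "\<dots> \<le> e" using C0 e by (simp add: field_simps)
    finally show ?thesis by simp
  qed
  then have "\<bar>T z\<bar> powr p \<le> 0" by (rule field_le_epsilon)
  then have "T z = 0" by simp
  then show "(LINT x|?M. fst (z x) $ j * frechet_derivative \<psi> (at x) (axis i 1))
     = - (LINT x|?M. (snd (z x) $ j $ i) * \<psi> x)"
    by (simp add: T_def eq_neg_iff_add_eq_0)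
qed

text \<open>Since weak gradients are unique, the gradient chosen for \<open>h - \<phi>\<close> agrees almost everywhere with the
  difference of the gradients.  Hence \<^const>\<open>sobolev_norm\<close> of \<open>h - \<phi>\<close> and \<^const>\<open>p_mass\<close> of the
  difference of pairs control each other, here and in the converse inclusion.\<close>

lemma sobolev0_pairs_imp_sobolev0:
  fixes z :: "real^'n \<Rightarrow> (real^'d) \<times> (real^'n^'d)"
  assumes z: "z \<in> sobolev0_pairs p \<Omega>"
  shows "(\<lambda>x. fst (z x)) \<in> sobolev0 p \<Omega>"
proof -
  let ?M = "lebesgue_on \<Omega>" and ?h = "\<lambda>x. fst (z x)" and ?H = "\<lambda>x. snd (z x)"
  have p0: "0 \<le> p" using p by simp
  have zi: "pow_integrable ?M p z" using z by (simp add: sobolev0_pairs_def)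
  note wg = sobolev0_pairs_has_weak_gradient[OF z]
  have sob: "?h \<in> sobolev p \<Omega>"
    using pow_integrable_fst_snd(1,2)[OF p0 zi] wg by (auto simp: sobolev_def Lp_space_iff)
  have "\<exists>\<phi>\<in>test_functions \<Omega>. p_mass ?M p (\<lambda>x. z x - (\<phi> x, gradient \<phi> x)) < 1 / real (Suc k)" for k
    using z by (auto simp: sobolev0_pairs_def)
  then have ex: "\<exists>\<phi>. \<phi> \<in> test_functions \<Omega> \<and> p_mass ?M p (\<lambda>x. z x - (\<phi> x, gradient \<phi> x)) < 1 / real (Suc k)" for k
    by blast
  define \<phi> where "\<phi> k = (SOME \<phi>. \<phi> \<in> test_functions \<Omega> \<and>
      p_mass ?M p (\<lambda>x. z x - (\<phi> x, gradient \<phi> x)) < 1 / real (Suc k))" for k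
  have phi: "\<phi> k \<in> test_functions \<Omega>"
    "p_mass ?M p (\<lambda>x. z x - (\<phi> k x, gradient (\<phi> k) x)) < 1 / real (Suc k)" for k
    using someI_ex[OF ex[of k]] by (auto simp: \<phi>_def)
  have le: "sobolev_norm p \<Omega> (\<lambda>x. ?h x - \<phi> k x) \<le> (2 * (1 / real (Suc k))) powr (1 / p)" for k
  proof -
    let ?w = "\<lambda>x. z x - (\<phi> k x, gradient (\<phi> k) x)"
    have wi: "pow_integrable ?M p ?w"
      by (rule pow_integrable_diff[OF p0 zi test_function_pair_pow_integrable(3)[OF phi(1)]])
    have hwg: "has_weak_gradient \<Omega> (\<lambda>x. ?h x - \<phi> k x) (\<lambda>x. ?H x - gradient (\<phi> k) x)"
      by (rule has_weak_gradient_diff[OF domain_measurable(1) wg test_function_has_weak_gradient[OF domain_measurable(1) phi(1)]])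
    have snd_w: "pow_integrable ?M p (\<lambda>x. ?H x - gradient (\<phi> k) x)"
      using pow_integrable_fst_snd(2)[OF p0 wi] by simp
    have "p_mass ?M p (weak_gradient \<Omega> (\<lambda>x. ?h x - \<phi> k x)) = p_mass ?M p (\<lambda>x. ?H x - gradient (\<phi> k) x)"
      by (rule pow_integrable_AE_cong(2)[OF domain_measurable(1) snd_w weak_gradient_eq_AE[OF \<Omega>(1) hwg]])
    moreover have "p_mass ?M p (\<lambda>x. ?H x - gradient (\<phi> k) x) \<le> p_mass ?M p ?w"
      using pow_integrable_fst_snd(4)[OF p0 wi] by simp
    moreover have "p_mass ?M p (\<lambda>x. ?h x - \<phi> k x) \<le> p_mass ?M p ?w"
      using pow_integrable_fst_snd(3)[OF p0 wi] by simp
    ultimately have "p_mass ?M p (\<lambda>x. ?h x - \<phi> k x) + p_mass ?M p (weak_gradient \<Omega> (\<lambda>x. ?h x - \<phi> k x))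
        \<le> 2 * (1 / real (Suc k))"
      using phi(2)[of k] by linarith
    then show ?thesis
      unfolding sobolev_norm_def p_mass_def[symmetric] using p by (intro powr_mono2) auto
  qed
  have "(\<lambda>k. (2 * (1 / real (Suc k))) powr (1 / p)) \<longlonglongrightarrow> (2 * 0) powr (1 / p)"
    using p by (intro tendsto_powr2 tendsto_mult tendsto_const LIMSEQ_Suc[OF lim_const_over_n]) auto
  then have lim: "(\<lambda>k. (2 * (1 / real (Suc k))) powr (1 / p)) \<longlonglongrightarrow> 0" by simp
  have "(\<lambda>k. sobolev_norm p \<Omega> (\<lambda>x. ?h x - \<phi> k x)) \<longlonglongrightarrow> 0"
    by (rule tendsto_sandwich[OF _ _ tendsto_const lim]) (use le in \<open>auto simp: sobolev_norm_def\<close>)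
  then show ?thesis using sob phi(1) by (auto simp: sobolev0_def)
qed

lemma sobolev0_imp_sobolev0_pairs:
  fixes h :: "real^'n \<Rightarrow> real^'d"
  assumes h: "h \<in> sobolev0 p \<Omega>"
  shows "(\<lambda>x. (h x, weak_gradient \<Omega> h x)) \<in> sobolev0_pairs p \<Omega>"
proof -
  let ?M = "lebesgue_on \<Omega>"
  have p0: "0 \<le> p" using p by simp
  have hs: "h \<in> sobolev p \<Omega>" using h by (simp add: sobolev0_def)
  note hw = sobolev_weak_gradient[OF \<Omega>(1) hs]
  obtain \<phi> where phi: "\<And>k. \<phi> k \<in> test_functions \<Omega>"
    "(\<lambda>k. sobolev_norm p \<Omega> (\<lambda>x. h x - \<phi> k x)) \<longlonglongrightarrow> 0"
    using h by (auto simp: sobolev0_def)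
  have key: "p_mass ?M p (\<lambda>x. (h x, weak_gradient \<Omega> h x) - (\<phi> k x, gradient (\<phi> k) x))
      \<le> 2 powr p * sobolev_norm p \<Omega> (\<lambda>x. h x - \<phi> k x) powr p" for k
  proof -
    have hwg: "has_weak_gradient \<Omega> (\<lambda>x. h x - \<phi> k x) (\<lambda>x. weak_gradient \<Omega> h x - gradient (\<phi> k) x)"
      by (rule has_weak_gradient_diff[OF domain_measurable(1) hw(1) test_function_has_weak_gradient[OF domain_measurable(1) phi(1)]])
    have i: "pow_integrable ?M p (\<lambda>x. h x - \<phi> k x)" "pow_integrable ?M p (\<lambda>x. weak_gradient \<Omega> h x - gradient (\<phi> k) x)"
      by (intro pow_integrable_diff p0 hw test_function_pair_pow_integrable phi)+
    have "sobolev_norm p \<Omega> (\<lambda>x. h x - \<phi> k x) powr p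
      = p_mass ?M p (\<lambda>x. h x - \<phi> k x) + p_mass ?M p (weak_gradient \<Omega> (\<lambda>x. h x - \<phi> k x))"
      unfolding sobolev_norm_def p_mass_def[symmetric] using p by (simp add: powr_powr)
    also have "p_mass ?M p (weak_gradient \<Omega> (\<lambda>x. h x - \<phi> k x)) = p_mass ?M p (\<lambda>x. weak_gradient \<Omega> h x - gradient (\<phi> k) x)"
      by (rule pow_integrable_AE_cong(2)[OF domain_measurable(1) i(2) weak_gradient_eq_AE[OF \<Omega>(1) hwg]])
    finally show ?thesis using pow_integrable_Pair(2)[OF p0 i] by simp
  qed
  have "(\<lambda>k. 2 powr p * sobolev_norm p \<Omega> (\<lambda>x. h x - \<phi> k x) powr p) \<longlonglongrightarrow> 2 powr p * 0 powr p"
    using p by (intro tendsto_mult tendsto_const tendsto_powr2 phi) (auto simp: sobolev_norm_def)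
  then have lim: "(\<lambda>k. 2 powr p * sobolev_norm p \<Omega> (\<lambda>x. h x - \<phi> k x) powr p) \<longlonglongrightarrow> 0" by simp
  have "\<exists>\<phi>\<in>test_functions \<Omega>. p_mass ?M p (\<lambda>x. (h x, weak_gradient \<Omega> h x) - (\<phi> x, gradient \<phi> x)) < \<eta>" if eta: "0 < \<eta>" for \<eta>
  proof -
    obtain k where "2 powr p * sobolev_norm p \<Omega> (\<lambda>x. h x - \<phi> k x) powr p < \<eta>"
      using order_tendstoD(2)[OF lim eta] by (auto simp: eventually_sequentially)
    then show ?thesis using key[of k] phi(1)[of k] by (intro bexI[of _ "\<phi> k"]) auto
  qed
  then show ?thesis
    using pow_integrable_Pair(1)[OF p0 hw(3,2)] by (simp add: sobolev0_pairs_def)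
qed

lemma sobolev0_pairs_closed:
  fixes z :: "real^'n \<Rightarrow> (real^'d) \<times> (real^'n^'d)"
  assumes z: "pow_integrable (lebesgue_on \<Omega>) p z"
    and lim: "\<And>\<eta>. 0 < \<eta> \<Longrightarrow> \<exists>y\<in>sobolev0_pairs p \<Omega>. p_mass (lebesgue_on \<Omega>) p (\<lambda>x. z x - y x) < \<eta>"
  shows "z \<in> sobolev0_pairs p \<Omega>"
  unfolding sobolev0_pairs_def
proof (safe intro!: z)
  let ?M = "lebesgue_on \<Omega>"
  have p0: "0 \<le> p" using p by simp
  fix \<eta> :: real assume "0 < \<eta>"
  define \<delta> where "\<delta> = \<eta> / (2 powr p * 2)"
  have d: "0 < \<delta>" using \<open>0 < \<eta>\<close> by (simp add: \<delta>_def)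
  obtain y where y: "y \<in> sobolev0_pairs p \<Omega>" "p_mass ?M p (\<lambda>x. z x - y x) < \<delta>" using lim[OF d] by blast
  then obtain \<phi> where phi: "\<phi> \<in> test_functions \<Omega>" "p_mass ?M p (\<lambda>x. y x - (\<phi> x, gradient \<phi> x)) < \<delta>"
    using d by (auto simp: sobolev0_pairs_def)
  have yi: "pow_integrable ?M p y" using y(1) by (simp add: sobolev0_pairs_def)
  have "p_mass ?M p (\<lambda>x. z x - (\<phi> x, gradient \<phi> x))
    \<le> 2 powr p * (p_mass ?M p (\<lambda>x. z x - y x) + p_mass ?M p (\<lambda>x. y x - (\<phi> x, gradient \<phi> x)))"
    by (intro p_mass_diff_triangle p0 pow_integrable_diff z yi test_function_pair_pow_integrable phi)
  also have "\<dots> < 2 powr p * (2 * \<delta>)" using y(2) phi(2) by (intro mult_strict_left_mono) auto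
  also have "\<dots> = \<eta>" by (simp add: \<delta>_def)
  finally show "\<exists>\<phi>\<in>test_functions \<Omega>. p_mass ?M p (\<lambda>x. z x - (\<phi> x, gradient \<phi> x)) < \<eta>" using phi(1) by blast
qed

lemma gradient_add:
  fixes \<phi> \<psi> :: "real^'n \<Rightarrow> real^'d"
  assumes "\<phi> \<in> test_functions \<Omega>" "\<psi> \<in> test_functions \<Omega>"
  shows "gradient (\<lambda>x. \<phi> x + \<psi> x) x = gradient \<phi> x + gradient \<psi> x"
  unfolding gradient_def
  using frechet_derivative_at[OF has_derivative_add[OF test_functions_has_derivative[OF assms(1)]
      test_functions_has_derivative[OF assms(2)]], of x, symmetric]
  by (simp add: vec_eq_iff)

lemma gradient_scaleR:
  fixes \<phi> :: "real^'n \<Rightarrow> real^'d"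
  assumes "\<phi> \<in> test_functions \<Omega>"
  shows "gradient (\<lambda>x. c *\<^sub>R \<phi> x) x = c *\<^sub>R gradient \<phi> x"
  unfolding gradient_def
  using frechet_derivative_at[OF has_derivative_scaleR_right[OF test_functions_has_derivative[OF assms]], of c x, symmetric]
  by (simp add: vec_eq_iff)

lemma sobolev0_pairs_add:
  fixes y z :: "real^'n \<Rightarrow> (real^'d) \<times> (real^'n^'d)"
  assumes y: "y \<in> sobolev0_pairs p \<Omega>" and z: "z \<in> sobolev0_pairs p \<Omega>"
  shows "(\<lambda>x. y x + z x) \<in> sobolev0_pairs p \<Omega>"
  unfolding sobolev0_pairs_def
proof (intro CollectI conjI allI impI)
  let ?M = "lebesgue_on \<Omega>"
  have p0: "0 \<le> p" using p by simp
  have i: "pow_integrable ?M p y" "pow_integrable ?M p z" using y z by (auto simp: sobolev0_pairs_def)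
  show "pow_integrable ?M p (\<lambda>x. y x + z x)" by (rule pow_integrable_add[OF p0 i])
  fix \<eta> :: real assume "0 < \<eta>"
  define \<delta> where "\<delta> = \<eta> / (2 powr p * 2)"
  have d: "0 < \<delta>" using \<open>0 < \<eta>\<close> by (simp add: \<delta>_def)
  obtain \<phi> where phi: "\<phi> \<in> test_functions \<Omega>" "p_mass ?M p (\<lambda>x. y x - (\<phi> x, gradient \<phi> x)) < \<delta>"
    using y d by (auto simp: sobolev0_pairs_def)
  obtain \<psi> where psi: "\<psi> \<in> test_functions \<Omega>" "p_mass ?M p (\<lambda>x. z x - (\<psi> x, gradient \<psi> x)) < \<delta>"
    using z d by (auto simp: sobolev0_pairs_def)
  have eq: "y x + z x - (\<phi> x + \<psi> x, gradient (\<lambda>x. \<phi> x + \<psi> x) x)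
      = (y x - (\<phi> x, gradient \<phi> x)) + (z x - (\<psi> x, gradient \<psi> x))" for x
    by (simp add: gradient_add[OF phi(1) psi(1)] prod_eq_iff)
  have "p_mass ?M p (\<lambda>x. y x + z x - (\<phi> x + \<psi> x, gradient (\<lambda>x. \<phi> x + \<psi> x) x))
    \<le> 2 powr p * (p_mass ?M p (\<lambda>x. y x - (\<phi> x, gradient \<phi> x)) + p_mass ?M p (\<lambda>x. z x - (\<psi> x, gradient \<psi> x)))"
    unfolding eq by (intro p_mass_add_le p0 pow_integrable_diff i test_function_pair_pow_integrable phi psi)
  also have "\<dots> < 2 powr p * (2 * \<delta>)" using phi(2) psi(2) by (intro mult_strict_left_mono) auto
  also have "\<dots> = \<eta>" by (simp add: \<delta>_def)
  finally show "\<exists>\<phi>\<in>test_functions \<Omega>. p_mass ?M p (\<lambda>x. y x + z x - (\<phi> x, gradient \<phi> x)) < \<eta>"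
    by (intro bexI[of _ "\<lambda>x. \<phi> x + \<psi> x"] test_functions_add phi psi)
qed

lemma sobolev0_pairs_scaleR:
  fixes z :: "real^'n \<Rightarrow> (real^'d) \<times> (real^'n^'d)"
  assumes z: "z \<in> sobolev0_pairs p \<Omega>"
  shows "(\<lambda>x. c *\<^sub>R z x) \<in> sobolev0_pairs p \<Omega>"
  unfolding sobolev0_pairs_def
proof (intro CollectI conjI allI impI)
  let ?M = "lebesgue_on \<Omega>"
  have i: "pow_integrable ?M p z" using z by (auto simp: sobolev0_pairs_def)
  show "pow_integrable ?M p (\<lambda>x. c *\<^sub>R z x)" by (rule pow_integrable_scaleR[OF i])
  fix \<eta> :: real assume "0 < \<eta>"
  define \<delta> where "\<delta> = \<eta> / (\<bar>c\<bar> powr p + 1)"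
  have c1: "0 < \<bar>c\<bar> powr p + 1" by (simp add: add_nonneg_pos)
  have d: "0 < \<delta>" using \<open>0 < \<eta>\<close> c1 by (simp add: \<delta>_def)
  obtain \<phi> where phi: "\<phi> \<in> test_functions \<Omega>" "p_mass ?M p (\<lambda>x. z x - (\<phi> x, gradient \<phi> x)) < \<delta>"
    using z d by (auto simp: sobolev0_pairs_def)
  have eq: "c *\<^sub>R z x - (c *\<^sub>R \<phi> x, gradient (\<lambda>x. c *\<^sub>R \<phi> x) x) = c *\<^sub>R (z x - (\<phi> x, gradient \<phi> x))" for x
    by (simp add: gradient_scaleR[OF phi(1)] prod_eq_iff scaleR_diff_right)
  have "p_mass ?M p (\<lambda>x. c *\<^sub>R z x - (c *\<^sub>R \<phi> x, gradient (\<lambda>x. c *\<^sub>R \<phi> x) x))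
    = \<bar>c\<bar> powr p * p_mass ?M p (\<lambda>x. z x - (\<phi> x, gradient \<phi> x))"
    unfolding eq by (rule p_mass_scaleR)
  also have "\<dots> \<le> \<bar>c\<bar> powr p * \<delta>" using phi(2) by (intro mult_left_mono) auto
  also have "\<dots> < (\<bar>c\<bar> powr p + 1) * \<delta>" using d by (simp add: distrib_right)
  also have "\<dots> = \<eta>" using c1 by (simp add: \<delta>_def)
  finally show "\<exists>\<phi>\<in>test_functions \<Omega>. p_mass ?M p (\<lambda>x. c *\<^sub>R z x - (\<phi> x, gradient \<phi> x)) < \<eta>"
    by (intro bexI[of _ "\<lambda>x. c *\<^sub>R \<phi> x"] test_functions_scaleR phi)
qed

lemma sobolev0_pairs_sum:
  fixes z :: "'i \<Rightarrow> real^'n \<Rightarrow> (real^'d) \<times> (real^'n^'d)"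
  assumes "finite I" "I \<noteq> {}" "\<And>i. i \<in> I \<Longrightarrow> z i \<in> sobolev0_pairs p \<Omega>"
  shows "(\<lambda>x. \<Sum>i\<in>I. z i x) \<in> sobolev0_pairs p \<Omega>"
  using assms
proof (induction I rule: finite_ne_induct)
  case (singleton i)
  then show ?case by simp
next
  case (insert i I)
  have "(\<lambda>x. z i x + (\<Sum>i\<in>I. z i x)) \<in> sobolev0_pairs p \<Omega>"
    using insert by (intro sobolev0_pairs_add) auto
  then show ?case using insert by simp
qed

text \<open>Approximate \<open>z\<close> by a test function to within \<open>\<eta>\<close>, use the inequality there, and let \<open>\<eta>\<close> tend to
  \<open>0\<close>; the two approximations cost a factor \<open>2\<^sup>p\<close> each.\<close>

lemma sobolev0_pairs_poincare:
  obtains P where "0 < P"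
    "\<And>z :: real^'n \<Rightarrow> (real^'d) \<times> (real^'n^'d). z \<in> sobolev0_pairs p \<Omega> \<Longrightarrow>
      p_mass (lebesgue_on \<Omega>) p (\<lambda>x. fst (z x)) \<le> P * p_mass (lebesgue_on \<Omega>) p (\<lambda>x. snd (z x))"
proof -
  let ?M = "lebesgue_on \<Omega>"
  have p0: "0 \<le> p" using p by simp
  obtain P where P: "0 < P"
    "\<And>\<phi> :: real^'n \<Rightarrow> real^'d. \<phi> \<in> test_functions \<Omega> \<Longrightarrow> p_mass lborel p \<phi> \<le> P * p_mass lborel p (gradient \<phi>)"
    by (rule poincare_inequality[OF p \<Omega>(2)]) blast
  define Q :: real where "Q = 2 powr p"
  have Q: "0 < Q" by (simp add: Q_def)
  have "p_mass ?M p (\<lambda>x. fst (z x)) \<le> Q * P * Q * p_mass ?M p (\<lambda>x. snd (z x))"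
    if z: "z \<in> sobolev0_pairs p \<Omega>" for z :: "real^'n \<Rightarrow> (real^'d) \<times> (real^'n^'d)"
  proof (rule field_le_epsilon)
    fix e :: real assume e: "0 < e"
    define \<eta> where "\<eta> = e / (Q + Q * P * Q)"
    have QP: "0 < Q + Q * P * Q" using P Q by (intro add_pos_pos mult_pos_pos)
    have eta: "0 < \<eta>" using e QP by (simp add: \<eta>_def)
    have zi: "pow_integrable ?M p z" using z by (simp add: sobolev0_pairs_def)
    obtain \<phi> where phi: "\<phi> \<in> test_functions \<Omega>" "p_mass ?M p (\<lambda>x. z x - (\<phi> x, gradient \<phi> x)) < \<eta>"
      using z eta by (auto simp: sobolev0_pairs_def)
    note ti = test_function_pair_pow_integrable[OF phi(1)]
    have wi: "pow_integrable ?M p (\<lambda>x. z x - (\<phi> x, gradient \<phi> x))" by (rule pow_integrable_diff[OF p0 zi ti(3)])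
    have w1: "pow_integrable ?M p (\<lambda>x. fst (z x) - \<phi> x)" "p_mass ?M p (\<lambda>x. fst (z x) - \<phi> x) < \<eta>"
      using pow_integrable_fst_snd(1,3)[OF p0 wi] phi(2) by auto
    have w2: "pow_integrable ?M p (\<lambda>x. gradient \<phi> x - snd (z x))" "p_mass ?M p (\<lambda>x. gradient \<phi> x - snd (z x)) < \<eta>"
      using pow_integrable_scaleR[OF pow_integrable_fst_snd(2)[OF p0 wi], of "-1"] pow_integrable_fst_snd(4)[OF p0 wi] phi(2)
        p_mass_minus_commute[of ?M p "gradient \<phi>"] by auto
    have g: "p_mass ?M p (gradient \<phi>) \<le> Q * (\<eta> + p_mass ?M p (\<lambda>x. snd (z x)))"
    proof -
      have "p_mass ?M p (gradient \<phi>) \<le> Q * (p_mass ?M p (\<lambda>x. gradient \<phi> x - snd (z x)) + p_mass ?M p (\<lambda>x. snd (z x)))"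
        using p_mass_add_le[OF p0 w2(1) pow_integrable_fst_snd(2)[OF p0 zi]] by (simp add: Q_def)
      also have "\<dots> \<le> Q * (\<eta> + p_mass ?M p (\<lambda>x. snd (z x)))" using w2(2) Q by (intro mult_left_mono) auto
      finally show ?thesis .
    qed
    have "p_mass ?M p (\<lambda>x. fst (z x)) \<le> Q * (p_mass ?M p (\<lambda>x. fst (z x) - \<phi> x) + p_mass ?M p \<phi>)"
      using p_mass_add_le[OF p0 w1(1) ti(1)] by (simp add: Q_def)
    also have "\<dots> \<le> Q * (\<eta> + P * (Q * (\<eta> + p_mass ?M p (\<lambda>x. snd (z x)))))"
    proof (intro mult_left_mono add_mono)
      have "p_mass ?M p \<phi> \<le> P * p_mass ?M p (gradient \<phi>)" using P(2)[OF phi(1)] ti(4,5) by simp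
      also have "\<dots> \<le> P * (Q * (\<eta> + p_mass ?M p (\<lambda>x. snd (z x))))" using g P(1) by (intro mult_left_mono) auto
      finally show "p_mass ?M p \<phi> \<le> P * (Q * (\<eta> + p_mass ?M p (\<lambda>x. snd (z x))))" .
    qed (use w1(2) Q in auto)
    also have "\<dots> = Q * P * Q * p_mass ?M p (\<lambda>x. snd (z x)) + (Q + Q * P * Q) * \<eta>"
      by (simp add: algebra_simps)
    also have "(Q + Q * P * Q) * \<eta> = e" using QP by (simp add: \<eta>_def)
    finally show "p_mass ?M p (\<lambda>x. fst (z x)) \<le> Q * P * Q * p_mass ?M p (\<lambda>x. snd (z x)) + e" .
  qed
  then show ?thesis using that[of "Q * P * Q"] P Q by simp
qed

text \<open>Test functions approximating \<open>z k\<close> to within \<open>1 / (k + 1)\<close> have bounded gradients, and a Cauchy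
  subsequence of them is inherited by the functions themselves.\<close>

theorem sobolev0_pairs_compact:
  fixes z :: "nat \<Rightarrow> real^'n \<Rightarrow> (real^'d) \<times> (real^'n^'d)"
  assumes z: "\<And>k. z k \<in> sobolev0_pairs p \<Omega>" and B: "\<And>k. p_mass (lebesgue_on \<Omega>) p (\<lambda>x. snd (z k x)) \<le> B"
  obtains r where "strict_mono (r :: nat \<Rightarrow> nat)" "p_cauchy (lebesgue_on \<Omega>) p (\<lambda>k x. fst (z (r k) x))"
proof -
  let ?M = "lebesgue_on \<Omega>"
  have p0: "0 \<le> p" using p by simp
  define Q :: real where "Q = 2 powr p"
  have Q: "0 < Q" by (simp add: Q_def)
  have zi: "pow_integrable ?M p (z k)" for k using z by (simp add: sobolev0_pairs_def)
  have "\<exists>\<phi>\<in>test_functions \<Omega>. p_mass ?M p (\<lambda>x. z k x - (\<phi> x, gradient \<phi> x)) < 1 / real (Suc k)" for k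
    using z[of k] by (auto simp: sobolev0_pairs_def)
  then have ex: "\<exists>\<phi>. \<phi> \<in> test_functions \<Omega> \<and> p_mass ?M p (\<lambda>x. z k x - (\<phi> x, gradient \<phi> x)) < 1 / real (Suc k)" for k
    by blast
  define \<phi> where "\<phi> k = (SOME \<phi>. \<phi> \<in> test_functions \<Omega> \<and>
      p_mass ?M p (\<lambda>x. z k x - (\<phi> x, gradient \<phi> x)) < 1 / real (Suc k))" for k
  have phi: "\<phi> k \<in> test_functions \<Omega>"
    "p_mass ?M p (\<lambda>x. z k x - (\<phi> k x, gradient (\<phi> k) x)) < 1 / real (Suc k)" for k
    using someI_ex[OF ex[of k]] by (auto simp: \<phi>_def)
  note ti = test_function_pair_pow_integrable[OF phi(1)]
  have wi: "pow_integrable ?M p (\<lambda>x. z k x - (\<phi> k x, gradient (\<phi> k) x))" for k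
    by (rule pow_integrable_diff[OF p0 zi ti(3)])
  have w1: "p_mass ?M p (\<lambda>x. fst (z k x) - \<phi> k x) < 1 / real (Suc k)" for k
    using pow_integrable_fst_snd(3)[OF p0 wi[of k]] phi(2)[of k] by auto
  have w2: "pow_integrable ?M p (\<lambda>x. gradient (\<phi> k) x - snd (z k x))" "p_mass ?M p (\<lambda>x. gradient (\<phi> k) x - snd (z k x)) < 1 / real (Suc k)" for k
    using pow_integrable_scaleR[OF pow_integrable_fst_snd(2)[OF p0 wi[of k]], of "-1"] pow_integrable_fst_snd(4)[OF p0 wi[of k]] phi(2)[of k]
      p_mass_minus_commute[of ?M p "gradient (\<phi> k)"] by auto
  have grad_le: "p_mass lborel p (gradient (\<phi> k)) \<le> Q * (1 + B)" for k
  proof -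
    have "p_mass ?M p (gradient (\<phi> k)) \<le> Q * (p_mass ?M p (\<lambda>x. gradient (\<phi> k) x - snd (z k x)) + p_mass ?M p (\<lambda>x. snd (z k x)))"
      using p_mass_add_le[OF p0 w2(1)[of k] pow_integrable_fst_snd(2)[OF p0 zi[of k]]] by (simp add: Q_def)
    also have "\<dots> \<le> Q * (1 + B)"
    proof -
      have "1 / real (Suc k) \<le> 1" by simp
      then show ?thesis using w2(2)[of k] B[of k] Q by (intro mult_left_mono add_mono) linarith+
    qed
    finally show ?thesis using ti(5) by simp
  qed
  obtain r where r: "strict_mono (r :: nat \<Rightarrow> nat)" "p_cauchy ?M p (\<lambda>k. \<phi> (r k))"
    by (rule test_functions_compactness[where \<phi>=\<phi>, OF p \<Omega>(2) domain_measurable(2) phi(1) grad_le])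
  have "p_cauchy ?M p (\<lambda>k x. fst (z (r k) x))"
  proof (rule p_cauchy_approx[OF p0 pow_integrable_fst_snd(1)[OF p0 zi]])
    fix \<delta> :: real assume d: "0 < \<delta>"
    obtain N where N: "1 / real (Suc N) < \<delta>" using nat_approx_posE[OF d] by blast
    have "p_mass ?M p (\<lambda>x. fst (z (r k) x) - \<phi> (r k) x) < \<delta>" if "N \<le> k" for k
    proof -
      have "N \<le> r k" using that seq_suble[OF r(1), of k] by linarith
      then have "1 / real (Suc (r k)) \<le> 1 / real (Suc N)" by (simp add: field_simps)
      then show ?thesis using N w1[of "r k"] by linarith
    qed
    then show "\<exists>h. (\<forall>k. pow_integrable ?M p (h k)) \<and> p_cauchy ?M p h \<and>
        (\<exists>K. \<forall>k\<ge>K. p_mass ?M p (\<lambda>x. fst (z (r k) x) - h k x) < \<delta>)"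
      using r(2) ti(1) by (intro exI[of _ "\<lambda>k. \<phi> (r k)"]) blast
  qed
  then show ?thesis using that r(1) by blast
qed

end

section \<open>Lower semicontinuity\<close>

text \<open>Beyond the \<open>T\<close> with \<open>T\<^sup>p\<^sup>-\<^sup>q = K / \<epsilon>\<close> the power of order \<open>p\<close> dominates; up to \<open>T\<close> the left-hand
  side is bounded.\<close>

lemma young_absorb:
  fixes K q p \<epsilon> :: real
  assumes K: "0 \<le> K" and q: "1 \<le> q" "q < p" and e: "0 < \<epsilon>"
  obtains C where "0 \<le> C" "\<And>t. 0 \<le> t \<Longrightarrow> K * t powr q \<le> \<epsilon> * t powr p + C"
proof -
  define T where "T = (K / \<epsilon>) powr (1 / (p - q))"
  have "K * t powr q \<le> \<epsilon> * t powr p + K * T powr q" if t: "0 \<le> t" for t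
  proof (cases "t \<le> T")
    case True
    then have "K * t powr q \<le> K * T powr q" using K q t by (intro mult_left_mono powr_mono2) auto
    then show ?thesis using e by (simp add: add_increasing)
  next
    case False
    have "T powr (p - q) = K / \<epsilon>" using K e q by (simp add: T_def powr_powr)
    then have "K = \<epsilon> * T powr (p - q)" using e by simp
    also have "\<dots> \<le> \<epsilon> * t powr (p - q)"
      using False q e by (intro mult_left_mono powr_mono2) (auto simp: T_def)
    finally have "K \<le> \<epsilon> * t powr (p - q)" .
    then have "K * t powr q \<le> \<epsilon> * t powr (p - q) * t powr q" by (intro mult_right_mono) auto
    also have "\<dots> = \<epsilon> * t powr p" by (simp add: powr_add[symmetric] mult.assoc)
    finally show ?thesis using K by (simp add: add_increasing2)
  qed
  then show ?thesis using that[of "K * T powr q"] K by simp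
qed

lemma extended_integral_integrable:
  assumes "integrable M g"
  shows "extended_integral M g = ereal (\<integral>x. g x \<partial>M)"
proof -
  have fin: "(\<integral>\<^sup>+x. ennreal (g x) \<partial>M) < \<infinity>" "(\<integral>\<^sup>+x. ennreal (- g x) \<partial>M) < \<infinity>"
    using assms by (auto simp: real_integrable_def less_top)
  have e: "enn2ereal a = ereal (enn2real a)" if "a < \<infinity>" for a
    using that by (cases a) (auto simp: enn2ereal_ennreal)
  show ?thesis
    unfolding extended_integral_def e[OF fin(1)] e[OF fin(2)]
    by (simp add: real_lebesgue_integral_def[OF assms])
qed

lemma extended_integral_cong_AE:
  assumes "AE x in M. g x = h x"
  shows "extended_integral M g = extended_integral M h"
proof -
  have "(\<integral>\<^sup>+x. ennreal (g x) \<partial>M) = (\<integral>\<^sup>+x. ennreal (h x) \<partial>M)"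
    "(\<integral>\<^sup>+x. ennreal (- g x) \<partial>M) = (\<integral>\<^sup>+x. ennreal (- h x) \<partial>M)"
    using assms by (auto intro!: nn_integral_cong_AE elim: eventually_mono)
  then show ?thesis by (simp add: extended_integral_def)
qed

lemma extended_integral_finite_imp_integrable:
  assumes g: "g \<in> borel_measurable M" and l: "integrable M l" "AE x in M. l x \<le> g x"
    and fin: "extended_integral M g < \<infinity>"
  shows "integrable M g"
proof -
  have "(\<integral>\<^sup>+x. ennreal (- g x) \<partial>M) \<le> (\<integral>\<^sup>+x. ennreal (norm (l x)) \<partial>M)"
    using l(2) by (intro nn_integral_mono_AE) (auto elim!: eventually_mono intro!: ennreal_leI)
  also have "\<dots> < \<infinity>" using l(1) by (simp add: integrable_iff_bounded)
  finally have neg: "(\<integral>\<^sup>+x. ennreal (- g x) \<partial>M) < \<infinity>" .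
  have "(\<integral>\<^sup>+x. ennreal (g x) \<partial>M) < \<infinity>"
  proof (rule ccontr)
    assume "\<not> ?thesis"
    then have "(\<integral>\<^sup>+x. ennreal (g x) \<partial>M) = \<infinity>" by (metis infinity_ennreal_def top.not_eq_extremum)
    then have "extended_integral M g = \<infinity>"
      using neg by (simp add: extended_integral_def)
    then show False using fin by simp
  qed
  then show ?thesis using neg g by (simp add: real_integrable_def less_top)
qed

lemma tail_weights_nonneg: "tail_weights j n w \<Longrightarrow> 0 \<le> w k"
  and tail_weights_sum: "tail_weights j n w \<Longrightarrow> (\<Sum>k\<in>{j..n}. w k) = 1"
  by (auto simp: tail_weights_def)

lemma tail_weights_nonempty: "tail_weights j n w \<Longrightarrow> {j..n} \<noteq> {}"
  unfolding tail_weights_def by (metis sum.empty zero_neq_one)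

lemma tail_combination_tendsto:
  fixes a :: "nat \<Rightarrow> 'b::real_normed_vector"
  assumes w: "\<And>j. tail_weights j (n j) (w j)" and a: "a \<longlonglongrightarrow> l"
  shows "(\<lambda>j. \<Sum>k\<in>{j..n j}. w j k *\<^sub>R a k) \<longlonglongrightarrow> l"
proof (rule LIMSEQ_I)
  fix e :: real assume e: "0 < e"
  obtain N where N: "\<And>k. N \<le> k \<Longrightarrow> norm (a k - l) < e / 2"
    using LIMSEQ_D[OF a, of "e / 2"] e by auto
  have "norm ((\<Sum>k\<in>{j..n j}. w j k *\<^sub>R a k) - l) < e" if "N \<le> j" for j
  proof -
    have "(\<Sum>k\<in>{j..n j}. w j k *\<^sub>R a k) - l = (\<Sum>k\<in>{j..n j}. w j k *\<^sub>R a k) - (\<Sum>k\<in>{j..n j}. w j k) *\<^sub>R l"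
      by (simp add: tail_weights_sum[OF w])
    also have "\<dots> = (\<Sum>k\<in>{j..n j}. w j k *\<^sub>R (a k - l))"
      by (simp add: scaleR_diff_right sum_subtractf scaleR_left.sum)
    also have "norm \<dots> \<le> (\<Sum>k\<in>{j..n j}. w j k * (e / 2))"
    proof (rule sum_norm_le)
      fix k assume "k \<in> {j..n j}"
      then have "norm (a k - l) \<le> e / 2" using N[of k] that by simp
      then show "norm (w j k *\<^sub>R (a k - l)) \<le> w j k * (e / 2)"
        using tail_weights_nonneg[OF w, of j k] by (simp only: norm_scaleR abs_of_nonneg mult_left_mono)
    qed
    also have "\<dots> = e / 2"
      by (simp only: sum_distrib_right[symmetric] tail_weights_sum[OF w] mult_1_left)
    finally show ?thesis using e by linarith
  qed
  then show "\<exists>N. \<forall>j\<ge>N. norm ((\<Sum>k\<in>{j..n j}. w j k *\<^sub>R a k) - l) < e" by blast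
qed

lemma composed_integrand_measurable:
  fixes f :: "real^'n \<Rightarrow> real^'d \<Rightarrow> real^'n^'d \<Rightarrow> real"
  assumes f: "continuous_on (closure \<Omega> \<times> UNIV \<times> UNIV) (\<lambda>(x, u, \<xi>). f x u \<xi>)"
    and u: "u \<in> borel_measurable (lebesgue_on \<Omega>)" and U: "U \<in> borel_measurable (lebesgue_on \<Omega>)"
  shows "(\<lambda>x. f x (u x) (U x)) \<in> borel_measurable (lebesgue_on \<Omega>)"
proof -
  let ?A = "closure \<Omega> \<times> (UNIV :: (real^'d) set) \<times> (UNIV :: (real^'n^'d) set)"
  define F where "F z = indicator ?A z *\<^sub>R (case z of (x, u, \<xi>) \<Rightarrow> f x u \<xi>)" for z
  have "closed ?A" by (intro closed_Times) auto
  then have F: "F \<in> borel_measurable borel"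
    unfolding F_def[abs_def] by (intro borel_measurable_continuous_on_indicator f) auto
  have "(\<lambda>x. x) \<in> borel_measurable (lebesgue_on \<Omega>)"
    by (intro borel_measurable_lebesgue_on) simp
  then have "(\<lambda>x. (x, u x, U x)) \<in> borel_measurable (lebesgue_on \<Omega>)"
    by (intro borel_measurable_Pair u U)
  then have "(\<lambda>x. F (x, u x, U x)) \<in> borel_measurable (lebesgue_on \<Omega>)"
    by (rule measurable_compose[OF _ F])
  moreover have "F (x, u x, U x) = f x (u x) (U x)" if "x \<in> space (lebesgue_on \<Omega>)" for x
    using that closure_subset[of \<Omega>] by (auto simp: F_def space_restrict_space)
  ultimately show ?thesis
    using measurable_cong[of "lebesgue_on \<Omega>" "\<lambda>x. F (x, u x, U x)" "\<lambda>x. f x (u x) (U x)" borel] by blast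
qed

text \<open>For fixed \<open>x\<close> the integrand is uniformly continuous on compact sets, so convergence of the second
  argument is felt uniformly for \<open>\<xi>\<close> in a ball.\<close>

lemma integrand_locally_uniform:
  fixes f :: "real^'n \<Rightarrow> real^'d \<Rightarrow> real^'n^'d \<Rightarrow> real"
  assumes f: "continuous_on (closure \<Omega> \<times> UNIV \<times> UNIV) (\<lambda>(x, u, \<xi>). f x u \<xi>)"
    and x: "x \<in> \<Omega>" and w: "w \<longlonglongrightarrow> v" and e: "0 < e"
  shows "\<exists>N. \<forall>k\<ge>N. \<forall>\<xi>. norm \<xi> \<le> T \<longrightarrow> \<bar>f x (w k) \<xi> - f x v \<xi>\<bar> < e"
proof -
  define g where "g = (\<lambda>z. f x (fst z) (snd z))"
  have cont: "continuous_on UNIV g"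
  proof -
    have "continuous_on UNIV (\<lambda>z :: (real^'d) \<times> (real^'n^'d). (x, fst z, snd z))"
      by (intro continuous_intros)
    moreover have "(\<lambda>z :: (real^'d) \<times> (real^'n^'d). (x, fst z, snd z)) ` UNIV \<subseteq> closure \<Omega> \<times> UNIV \<times> UNIV"
      using x closure_subset[of \<Omega>] by auto
    ultimately have "continuous_on UNIV (\<lambda>z. (\<lambda>(x, u, \<xi>). f x u \<xi>) (x, fst z, snd z))"
      by (rule continuous_on_compose2[OF f])
    then show ?thesis by (simp add: g_def case_prod_unfold)
  qed
  define S :: "((real^'d) \<times> (real^'n^'d)) set" where "S = cball v 1 \<times> cball 0 T"
  have "uniformly_continuous_on S g"
    by (rule compact_uniformly_continuous[OF continuous_on_subset[OF cont subset_UNIV]])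
       (simp add: S_def compact_Times)
  then obtain d where d: "0 < d"
    "\<And>y z. y \<in> S \<Longrightarrow> z \<in> S \<Longrightarrow> dist z y < d \<Longrightarrow> dist (g z) (g y) < e"
    using e unfolding uniformly_continuous_on_def by blast
  have "0 < min d 1" using d(1) by simp
  then obtain N where N: "\<And>k. N \<le> k \<Longrightarrow> norm (w k - v) < min d 1" using LIMSEQ_D[OF w] by blast
  have "\<bar>f x (w k) \<xi> - f x v \<xi>\<bar> < e" if "N \<le> k" "norm \<xi> \<le> T" for k \<xi>
  proof -
    have "dist (g (w k, \<xi>)) (g (v, \<xi>)) < e"
    proof (rule d(2))
      show "(v, \<xi>) \<in> S" using that by (simp add: S_def)
      show "(w k, \<xi>) \<in> S" using that N[of k] by (simp add: S_def dist_norm norm_minus_commute)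
      show "dist (w k, \<xi>) (v, \<xi>) < d" using N[of k] that by (simp add: dist_prod_def dist_norm)
    qed
    then show ?thesis by (simp add: g_def dist_real_def)
  qed
  then show ?thesis by blast
qed

text \<open>Replaces \<open>u k\<close> by its limit in the second argument although \<open>U k\<close> does not converge.  Where
  \<open>norm (U k x) \<le> T\<close>, the difference tends to \<open>0\<close> pointwise; the remaining set has measure at most
  \<open>B / T\<^sup>p\<close>.  So the difference, truncated at \<open>1\<close>, tends to \<open>0\<close> in the mean, and a subsequence does so
  almost everywhere.\<close>

lemma integrand_difference_AE_subseq:
  fixes f :: "real^'n \<Rightarrow> real^'d \<Rightarrow> real^'n^'d \<Rightarrow> real"
  assumes p: "1 < p" and \<Omega>: "open \<Omega>" "bounded \<Omega>"
    and f: "continuous_on (closure \<Omega> \<times> UNIV \<times> UNIV) (\<lambda>(x, u, \<xi>). f x u \<xi>)"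
    and u: "\<And>k. u k \<in> borel_measurable (lebesgue_on \<Omega>)" "v \<in> borel_measurable (lebesgue_on \<Omega>)"
    and lim: "AE x in lebesgue_on \<Omega>. (\<lambda>k. u k x) \<longlonglongrightarrow> v x"
    and U: "\<And>k. pow_integrable (lebesgue_on \<Omega>) p (U k)" "\<And>k. p_mass (lebesgue_on \<Omega>) p (U k) \<le> B"
  obtains r where "strict_mono (r :: nat \<Rightarrow> nat)"
    "AE x in lebesgue_on \<Omega>. (\<lambda>k. f x (u (r k) x) (U (r k) x) - f x (v x) (U (r k) x)) \<longlonglongrightarrow> 0"
proof -
  let ?M = "lebesgue_on \<Omega>"
  interpret finite_measure ?M by (rule domain_measurable(3)[OF p \<Omega>])
  note Um = pow_integrable_measurable[OF U(1)]
  define D where "D k x = f x (u k x) (U k x) - f x (v x) (U k x)" for k x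
  define d where "d k x = min 1 \<bar>D k x\<bar>" for k x
  have Dm [measurable]: "D k \<in> borel_measurable ?M" for k
    unfolding D_def[abs_def]
    by (intro borel_measurable_diff composed_integrand_measurable[OF f] u Um)
  have dm [measurable]: "d k \<in> borel_measurable ?M" for k unfolding d_def[abs_def] by measurable
  have d01: "0 \<le> d k x" "d k x \<le> 1" for k x by (auto simp: d_def)
  have di: "integrable ?M (d k)" for k
    by (rule integrable_const_bound[where B=1]) (use d01 in auto)
  have B0: "0 \<le> B" using U(2) p_mass_nonneg by (meson order_trans)
  have "(\<lambda>k. \<integral>x. norm (d k x) \<partial>?M) \<longlonglongrightarrow> 0"
  proof (rule LIMSEQ_I)
    fix e :: real assume e: "0 < e"
    \<comment> \<open>Chosen so that the set where \<open>norm (U k x) > T\<close> has measure below \<open>e / 2\<close>.\<close>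
    define T where "T = ((B + 1) * 2 / e) powr (1 / p)"
    have T: "0 < T" "T powr p = (B + 1) * 2 / e" using e B0 p by (auto simp: T_def powr_powr)
    define c where "c k x = d k x * indicator {x. norm (U k x) \<le> T} x" for k x
    have cm [measurable]: "c k \<in> borel_measurable ?M" for k
    proof -
      have "(\<lambda>x. indicator {y. norm y \<le> T} (U k x) :: real) \<in> borel_measurable ?M"
        by (rule measurable_compose[OF Um]) measurable
      then have "(\<lambda>x. d k x * indicator {y. norm y \<le> T} (U k x)) \<in> borel_measurable ?M" by measurable
      then show ?thesis by (simp add: c_def[abs_def] indicator_def)
    qed
    have "(\<lambda>k. \<integral>x. c k x \<partial>?M) \<longlonglongrightarrow> (\<integral>x. 0 \<partial>?M)"
    proof (rule integral_dominated_convergence[where w="\<lambda>x. 1"])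
      show "AE x in ?M. (\<lambda>k. c k x) \<longlonglongrightarrow> 0"
      proof (use lim AE_space in eventually_elim)
        fix x assume x: "(\<lambda>k. u k x) \<longlonglongrightarrow> v x" "x \<in> space ?M"
        then have x\<Omega>: "x \<in> \<Omega>" by (simp add: space_restrict_space)
        show "(\<lambda>k. c k x) \<longlonglongrightarrow> 0"
        proof (rule LIMSEQ_I)
          fix \<eta> :: real assume eta: "0 < \<eta>"
          obtain N where N: "\<And>k \<xi>. N \<le> k \<Longrightarrow> norm \<xi> \<le> T \<Longrightarrow> \<bar>f x (u k x) \<xi> - f x (v x) \<xi>\<bar> < \<eta>"
            using integrand_locally_uniform[OF f x\<Omega> x(1) eta] by blast
          have "norm (c k x - 0) < \<eta>" if "N \<le> k" for k
          proof (cases "norm (U k x) \<le> T")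
            case True
            have "c k x \<le> \<bar>D k x\<bar>" using True by (simp add: c_def d_def)
            also have "\<dots> < \<eta>" using N[OF that True] by (simp add: D_def)
            finally show ?thesis using d01[of k x] True by (simp add: c_def)
          qed (use eta in \<open>simp add: c_def\<close>)
          then show "\<exists>N. \<forall>k\<ge>N. norm (c k x - 0) < \<eta>" by blast
        qed
      qed
      show "AE x in ?M. norm (c k x) \<le> 1" for k
        using d01 by (intro AE_I2) (auto simp: c_def indicator_def abs_of_nonneg)
    qed auto
    then have c0: "(\<lambda>k. \<integral>x. c k x \<partial>?M) \<longlonglongrightarrow> 0" by simp
    have "0 < e / 2" using e by simp
    then obtain N where N: "\<And>k. N \<le> k \<Longrightarrow> (\<integral>x. c k x \<partial>?M) < e / 2"
      using order_tendstoD(2)[OF c0] unfolding eventually_sequentially by blast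
    have "(\<integral>x. norm (d k x) \<partial>?M) < e" if "N \<le> k" for k
    proof -
      have ci: "integrable ?M (c k)"
        by (rule integrable_const_bound[where B=1])
           (use d01 in \<open>auto intro!: AE_I2 simp: c_def indicator_def abs_of_nonneg\<close>)
      have "(\<integral>x. norm (d k x) \<partial>?M) \<le> (\<integral>x. c k x + norm (U k x) powr p / T powr p \<partial>?M)"
      proof (rule integral_mono)
        show "integrable ?M (\<lambda>x. norm (d k x))" using di by simp
        show "integrable ?M (\<lambda>x. c k x + norm (U k x) powr p / T powr p)"
          using ci pow_integrable_integrable[OF U(1)] by simp
        fix x
        show "norm (d k x) \<le> c k x + norm (U k x) powr p / T powr p"
        proof (cases "norm (U k x) \<le> T")
          case True
          then show ?thesis using d01[of k x] by (simp add: c_def)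
        next
          case False
          then have "T powr p \<le> norm (U k x) powr p" using T p by (intro powr_mono2) auto
          then have "1 \<le> norm (U k x) powr p / T powr p" using T(1) by (simp add: field_simps)
          then show ?thesis using False d01[of k x] by (simp add: c_def)
        qed
      qed
      also have "\<dots> = (\<integral>x. c k x \<partial>?M) + p_mass ?M p (U k) / T powr p"
        using ci pow_integrable_integrable[OF U(1)] by (simp add: p_mass_def)
      also have "\<dots> < e / 2 + e / 2"
      proof (rule add_strict_mono)
        show "(\<integral>x. c k x \<partial>?M) < e / 2" by (rule N[OF that])
        have "p_mass ?M p (U k) / T powr p < (B + 1) / T powr p"
          using U(2)[of k] T(1) by (intro divide_strict_right_mono) auto
        also have "\<dots> = e / 2"
        proof -
          have "B + 1 \<noteq> 0" using B0 by simp
          then show ?thesis unfolding T(2) by (simp add: divide_simps)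
        qed
        finally show "p_mass ?M p (U k) / T powr p < e / 2" .
      qed
      finally show ?thesis by simp
    qed
    then show "\<exists>N. \<forall>k\<ge>N. norm ((\<integral>x. norm (d k x) \<partial>?M) - 0) < e" by auto
  qed
  then obtain r where r: "strict_mono (r :: nat \<Rightarrow> nat)" "AE x in ?M. (\<lambda>k. d (r k) x) \<longlonglongrightarrow> 0"
    using tendsto_L1_AE_subseq[of ?M d] di by blast
  have "AE x in ?M. (\<lambda>k. D (r k) x) \<longlonglongrightarrow> 0"
  proof (use r(2) in eventually_elim)
    fix x assume x: "(\<lambda>k. d (r k) x) \<longlonglongrightarrow> 0"
    have "eventually (\<lambda>k. d (r k) x < 1) sequentially" using order_tendstoD(2)[OF x] by simp
    then have "eventually (\<lambda>k. d (r k) x = norm (D (r k) x)) sequentially"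
      by eventually_elim (auto simp: d_def min_def split: if_splits)
    then have "(\<lambda>k. norm (D (r k) x)) \<longlonglongrightarrow> 0"
      by (rule Lim_transform_eventually[OF x])
    then show "(\<lambda>k. D (r k) x) \<longlonglongrightarrow> 0" by (rule tendsto_norm_zero_cancel)
  qed
  then show ?thesis using that r(1) unfolding D_def by blast
qed

text \<open>Convexity bounds \<open>f\<close> at \<open>v x\<close> and a convex combination of the \<open>U k x\<close> by the combination of
  the values \<open>f x (u k x) (U k x)\<close>, up to the error \<open>R\<close> that stems from replacing \<open>u k\<close> by \<open>v\<close>.  The
  error tends to \<open>0\<close> because the weights move to infinity.  Fatou's lemma then compares the
  integrals; it needs nonnegative integrands, which are obtained by adding \<open>\<epsilon> norm (u k x)\<^sup>p + C - c2 x\<close>.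
  As the masses of \<open>u k\<close> are bounded by \<open>B\<close>, this costs at most \<open>\<epsilon> B\<close> in the limit, with \<open>\<epsilon>\<close> arbitrary.\<close>

theorem integral_lower_semicontinuity:
  fixes f :: "real^'n \<Rightarrow> real^'d \<Rightarrow> real^'n^'d \<Rightarrow> real"
  assumes p: "1 < p" and \<Omega>: "open \<Omega>" "bounded \<Omega>"
    and f: "continuous_on (closure \<Omega> \<times> UNIV \<times> UNIV) (\<lambda>(x, u, \<xi>). f x u \<xi>)"
    and conv: "\<And>x u. x \<in> \<Omega> \<Longrightarrow> convex_on UNIV (\<lambda>\<xi>. f x u \<xi>)"
    and q: "1 \<le> q" "q < p" and K: "0 \<le> K" and c2: "integrable (lebesgue_on \<Omega>) c2"
    and growth: "\<And>x u \<xi>. x \<in> \<Omega> \<Longrightarrow> - K * norm u powr q + c2 x \<le> f x u \<xi>"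
    and u: "\<And>k. pow_integrable (lebesgue_on \<Omega>) p (u k)" "\<And>k. p_mass (lebesgue_on \<Omega>) p (u k) \<le> B"
      "pow_integrable (lebesgue_on \<Omega>) p v"
    and U: "\<And>k. U k \<in> borel_measurable (lebesgue_on \<Omega>)" "V \<in> borel_measurable (lebesgue_on \<Omega>)"
    and D: "AE x in lebesgue_on \<Omega>. (\<lambda>k. f x (u k x) (U k x) - f x (v x) (U k x)) \<longlonglongrightarrow> 0"
    and w: "\<And>j. tail_weights j (n j) (w j)" and s: "strict_mono (s :: nat \<Rightarrow> nat)"
    and V: "AE x in lebesgue_on \<Omega>. (\<lambda>i. tail_combination U (s i) (n (s i)) (w (s i)) x) \<longlonglongrightarrow> V x"
    and I: "\<And>k. integrable (lebesgue_on \<Omega>) (\<lambda>x. f x (u k x) (U k x))"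
      "(\<lambda>k. \<integral>x. f x (u k x) (U k x) \<partial>lebesgue_on \<Omega>) \<longlonglongrightarrow> m"
  shows "integrable (lebesgue_on \<Omega>) (\<lambda>x. f x (v x) (V x))"
    and "(\<integral>x. f x (v x) (V x) \<partial>lebesgue_on \<Omega>) \<le> m"
proof -
  let ?M = "lebesgue_on \<Omega>"
  interpret finite_measure ?M by (rule domain_measurable(3)[OF p \<Omega>])
  have in\<Omega>: "x \<in> \<Omega>" if "x \<in> space ?M" for x using that by (simp add: space_restrict_space)
  have B0: "0 \<le> B" using u(2) p_mass_nonneg by (meson order_trans)
  have fV: "(\<lambda>x. f x (v x) (V x)) \<in> borel_measurable ?M"
    by (rule composed_integrand_measurable[OF f pow_integrable_measurable[OF u(3)] U(2)])
  have key: "integrable ?M (\<lambda>x. f x (v x) (V x)) \<and> (\<integral>x. f x (v x) (V x) \<partial>?M) \<le> m + \<epsilon> + \<epsilon> * B"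
    if e: "0 < \<epsilon>" for \<epsilon>
  proof -
    obtain C where C: "0 \<le> C" "\<And>t. 0 \<le> t \<Longrightarrow> K * t powr q \<le> \<epsilon> * t powr p + C"
      by (rule young_absorb[OF K q e]) blast
    define \<psi> where "\<psi> x = C - c2 x" for x
    have psi: "integrable ?M \<psi>" using c2 by (simp add: \<psi>_def[abs_def])
    have lower: "0 \<le> f x a \<xi> + \<epsilon> * norm a powr p + \<psi> x" if "x \<in> \<Omega>" for x a \<xi>
      using growth[OF that, of a \<xi>] C(2)[of "norm a"] by (simp add: \<psi>_def)
    define P where "P k x = f x (u k x) (U k x) + \<epsilon> * norm (u k x) powr p + \<psi> x" for k x
    have Pi: "integrable ?M (P k)" for k
      unfolding P_def[abs_def] using I(1) pow_integrable_integrable[OF u(1)] psi by simp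
    have P0: "0 \<le> P k x" if "x \<in> \<Omega>" for k x unfolding P_def by (rule lower[OF that])
    have P_int: "(\<integral>x. P k x \<partial>?M) = (\<integral>x. f x (u k x) (U k x) \<partial>?M) + \<epsilon> * p_mass ?M p (u k) + (\<integral>x. \<psi> x \<partial>?M)" for k
      unfolding P_def using I(1) pow_integrable_integrable[OF u(1)] psi by (simp add: p_mass_def)
    define Y where "Y j x = (\<Sum>k\<in>{j..n j}. w j k * P k x)" for j x
    have Yi: "integrable ?M (Y j)" for j unfolding Y_def[abs_def] using Pi by simp
    have Y0: "0 \<le> Y j x" if "x \<in> \<Omega>" for j x
      unfolding Y_def using P0[OF that] tail_weights_nonneg[OF w] by (intro sum_nonneg mult_nonneg_nonneg)
    define A where "A = m + \<epsilon> + \<epsilon> * B + (\<integral>x. \<psi> x \<partial>?M)"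
    have "eventually (\<lambda>k. (\<integral>x. f x (u k x) (U k x) \<partial>?M) < m + \<epsilon>) sequentially"
      using order_tendstoD(2)[OF I(2)] e by simp
    then obtain N where N: "\<And>k. N \<le> k \<Longrightarrow> (\<integral>x. f x (u k x) (U k x) \<partial>?M) < m + \<epsilon>"
      unfolding eventually_sequentially by blast
    have Y_le: "(\<integral>x. Y j x \<partial>?M) \<le> A" if "N \<le> j" for j
    proof -
      have "(\<integral>x. Y j x \<partial>?M) = (\<Sum>k\<in>{j..n j}. w j k * (\<integral>x. P k x \<partial>?M))"
        unfolding Y_def using Pi by simp
      also have "\<dots> \<le> (\<Sum>k\<in>{j..n j}. w j k * A)"
      proof (intro sum_mono mult_left_mono tail_weights_nonneg[OF w])
        fix k assume "k \<in> {j..n j}"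
        then have "(\<integral>x. f x (u k x) (U k x) \<partial>?M) < m + \<epsilon>" using N that by simp
        moreover have "\<epsilon> * p_mass ?M p (u k) \<le> \<epsilon> * B" using u(2) e by (intro mult_left_mono) auto
        ultimately show "(\<integral>x. P k x \<partial>?M) \<le> A" unfolding P_int A_def by linarith
      qed
      also have "\<dots> = A" by (simp add: tail_weights_sum[OF w] flip: sum_distrib_right)
      finally show ?thesis .
    qed
    define g where "g x = f x (v x) (V x) + \<psi> x" for x
    have gm: "g \<in> borel_measurable ?M" unfolding g_def[abs_def] using fV psi by simp
    have "(\<integral>\<^sup>+x. ennreal (g x) \<partial>?M) \<le> (\<integral>\<^sup>+x. liminf (\<lambda>i. ennreal (Y (s i) x)) \<partial>?M)"
    proof (rule nn_integral_mono_AE, use D V AE_space in eventually_elim)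
      fix x assume Dx: "(\<lambda>k. f x (u k x) (U k x) - f x (v x) (U k x)) \<longlonglongrightarrow> 0"
        and Vx: "(\<lambda>i. tail_combination U (s i) (n (s i)) (w (s i)) x) \<longlonglongrightarrow> V x" and "x \<in> space ?M"
      then have x: "x \<in> \<Omega>" by (simp add: in\<Omega>)
      define R where "R j = (\<Sum>k\<in>{j..n j}. w j k *\<^sub>R (f x (u k x) (U k x) - f x (v x) (U k x)))" for j
      have R0: "(\<lambda>i. R (s i)) \<longlonglongrightarrow> 0"
        using LIMSEQ_subseq_LIMSEQ[OF tail_combination_tendsto[OF w Dx] s] by (simp add: R_def o_def)
      have YR: "f x (v x) (tail_combination U j (n j) (w j) x) + R j + \<psi> x \<le> Y j x" for j
      proof -
        have "f x (v x) (tail_combination U j (n j) (w j) x) \<le> (\<Sum>k\<in>{j..n j}. w j k * f x (v x) (U k x))"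
          unfolding tail_combination_def
          by (rule convex_on_sum[OF _ tail_weights_nonempty[OF w] conv[OF x] tail_weights_sum[OF w]])
             (auto intro: tail_weights_nonneg[OF w])
        moreover have "(\<Sum>k\<in>{j..n j}. w j k * f x (v x) (U k x)) + R j = (\<Sum>k\<in>{j..n j}. w j k * f x (u k x) (U k x))"
          unfolding R_def by (simp add: right_diff_distrib sum_subtractf)
        moreover have "\<psi> x = (\<Sum>k\<in>{j..n j}. w j k * \<psi> x)"
          by (simp add: tail_weights_sum[OF w] flip: sum_distrib_right)
        moreover have "(\<Sum>k\<in>{j..n j}. w j k * f x (u k x) (U k x)) + (\<Sum>k\<in>{j..n j}. w j k * \<psi> x) \<le> Y j x"
          unfolding Y_def sum.distrib[symmetric] P_def distrib_left[symmetric]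
          using tail_weights_nonneg[OF w] e by (intro sum_mono mult_left_mono) auto
        ultimately show ?thesis by linarith
      qed
      have fcont: "continuous_on UNIV (\<lambda>\<xi>. f x (v x) \<xi>)"
      proof -
        have "continuous_on UNIV (\<lambda>\<xi> :: real^'n^'d. (x, v x, \<xi>))" by (intro continuous_intros)
        moreover have "(\<lambda>\<xi> :: real^'n^'d. (x, v x, \<xi>)) ` UNIV \<subseteq> closure \<Omega> \<times> UNIV \<times> UNIV"
          using x closure_subset[of \<Omega>] by auto
        ultimately have "continuous_on UNIV (\<lambda>\<xi>. (\<lambda>(x, u, \<xi>). f x u \<xi>) (x, v x, \<xi>))"
          by (rule continuous_on_compose2[OF f])
        then show ?thesis by simp
      qed
      have "(\<lambda>i. f x (v x) (tail_combination U (s i) (n (s i)) (w (s i)) x)) \<longlonglongrightarrow> f x (v x) (V x)"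
        by (rule continuous_on_tendsto_compose[OF fcont Vx]) auto
      then have "(\<lambda>i. f x (v x) (tail_combination U (s i) (n (s i)) (w (s i)) x) + R (s i) + \<psi> x) \<longlonglongrightarrow> f x (v x) (V x) + 0 + \<psi> x"
        by (intro tendsto_add R0 tendsto_const)
      then have "(\<lambda>i. ennreal (f x (v x) (tail_combination U (s i) (n (s i)) (w (s i)) x) + R (s i) + \<psi> x)) \<longlonglongrightarrow> ennreal (g x)"
        unfolding g_def by (intro tendsto_ennrealI) simp
      then have "ennreal (g x) = liminf (\<lambda>i. ennreal (f x (v x) (tail_combination U (s i) (n (s i)) (w (s i)) x) + R (s i) + \<psi> x))"
        by (intro lim_imp_Liminf[symmetric]) auto
      also have "\<dots> \<le> liminf (\<lambda>i. ennreal (Y (s i) x))"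
        using YR by (intro Liminf_mono always_eventually allI ennreal_leI)
      finally show "ennreal (g x) \<le> liminf (\<lambda>i. ennreal (Y (s i) x))" .
    qed
    also have "\<dots> \<le> liminf (\<lambda>i. \<integral>\<^sup>+x. ennreal (Y (s i) x) \<partial>?M)"
      using Yi by (intro nn_integral_liminf) auto
    also have "\<dots> \<le> ennreal A"
    proof (rule Liminf_le)
      have "eventually (\<lambda>i. N \<le> s i) sequentially"
        unfolding eventually_sequentially by (intro exI[of _ N]) (meson le_trans s seq_suble)
      then show "\<forall>\<^sub>F i in sequentially. (\<integral>\<^sup>+x. ennreal (Y (s i) x) \<partial>?M) \<le> ennreal A"
      proof eventually_elim
        case (elim i)
        have "(\<integral>\<^sup>+x. ennreal (Y (s i) x) \<partial>?M) = ennreal (\<integral>x. Y (s i) x \<partial>?M)"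
          using Yi Y0 in\<Omega> by (intro nn_integral_eq_integral) (auto intro!: AE_I2)
        then show ?case using Y_le[OF elim] by (simp add: ennreal_leI)
      qed
    qed simp
    finally have gA: "(\<integral>\<^sup>+x. ennreal (g x) \<partial>?M) \<le> ennreal A" .
    have A0: "0 \<le> A"
    proof -
      have "0 \<le> (\<integral>x. Y N x \<partial>?M)" using Y0 in\<Omega> by (intro integral_nonneg_AE AE_I2) blast
      then show ?thesis using Y_le[OF le_refl] by linarith
    qed
    have "(\<integral>\<^sup>+x. ennreal (- g x) \<partial>?M) \<le> (\<integral>\<^sup>+x. ennreal (\<epsilon> * norm (v x) powr p) \<partial>?M)"
    proof (rule nn_integral_mono_AE, rule AE_I2)
      fix x assume "x \<in> space ?M"
      then have "0 \<le> f x (v x) (V x) + \<epsilon> * norm (v x) powr p + \<psi> x" by (intro lower in\<Omega>)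
      then show "ennreal (- g x) \<le> ennreal (\<epsilon> * norm (v x) powr p)"
        unfolding g_def by (intro ennreal_leI) linarith
    qed
    also have "\<dots> < \<infinity>"
    proof -
      have "integrable ?M (\<lambda>x. \<epsilon> * norm (v x) powr p)" using pow_integrable_integrable[OF u(3)] by simp
      then have "(\<integral>\<^sup>+x. ennreal (norm (\<epsilon> * norm (v x) powr p)) \<partial>?M) < \<infinity>" by (simp only: integrable_iff_bounded)
      then show ?thesis using e by (simp add: abs_of_nonneg)
    qed
    finally have neg: "(\<integral>\<^sup>+x. ennreal (- g x) \<partial>?M) < \<infinity>" .
    have gi: "integrable ?M g"
      using gm gA neg le_less_trans[OF gA ennreal_less_top] by (simp add: real_integrable_def less_top)
    have "(\<integral>x. g x \<partial>?M) \<le> enn2real (\<integral>\<^sup>+x. ennreal (g x) \<partial>?M)"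
      by (simp add: real_lebesgue_integral_def[OF gi])
    also have "\<dots> \<le> A" using gA A0 by (metis enn2real_ennreal enn2real_mono ennreal_less_top)
    finally have g_le: "(\<integral>x. g x \<partial>?M) \<le> A" .
    have fg: "f x (v x) (V x) = g x - \<psi> x" for x by (simp add: g_def)
    have "integrable ?M (\<lambda>x. f x (v x) (V x))" unfolding fg using gi psi by simp
    moreover have "(\<integral>x. f x (v x) (V x) \<partial>?M) \<le> m + \<epsilon> + \<epsilon> * B"
      unfolding fg using gi psi g_le by (simp add: A_def)
    ultimately show ?thesis by blast
  qed
  show "integrable ?M (\<lambda>x. f x (v x) (V x))" using key[of 1] by simp
  show "(\<integral>x. f x (v x) (V x) \<partial>?M) \<le> m"
  proof (rule field_le_epsilon)
    fix e :: real assume e: "0 < e"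
    have "0 < e / (1 + B)" using e B0 by simp
    from conjunct2[OF key[OF this]] have "(\<integral>x. f x (v x) (V x) \<partial>?M) \<le> m + (e / (1 + B)) * (1 + B)"
      by (simp only: distrib_left mult_1_right add.assoc)
    also have "(e / (1 + B)) * (1 + B) = e" using B0 by simp
    finally show "(\<integral>x. f x (v x) (V x) \<partial>?M) \<le> m + e" .
  qed
qed

section \<open>Existence of minimizers\<close>

theorem corollary1p3:
  fixes p :: real
    and \<Omega> :: "(real^'n) set"
    and u0 :: "real^'n \<Rightarrow> real^'d"
    and f :: "real^'n \<Rightarrow> real^'d \<Rightarrow> real^'n^'d \<Rightarrow> real"
  assumes "1 < p"
    and "bounded_lipschitz_domain \<Omega>"
    and "u0 \<in> sobolev p \<Omega>"
    and "continuous_on (closure \<Omega> \<times> UNIV \<times> UNIV) (\<lambda>(x, u, \<xi>). f x u \<xi>)"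
    and "p_growth p \<Omega> f"
    and "\<And>x u. x \<in> \<Omega> \<Longrightarrow> convex_on UNIV (\<lambda>\<xi>. f x u \<xi>)"
    and "\<exists>w\<in>affine_sobolev0 p \<Omega> u0. energy \<Omega> f w < \<infinity>"
    and "\<And>w. w \<in> affine_sobolev0 p \<Omega> u0 \<Longrightarrow> energy \<Omega> f w > - \<infinity>"
  shows "\<exists>u\<in>affine_sobolev0 p \<Omega> u0.
           energy \<Omega> f u = (INF w\<in>affine_sobolev0 p \<Omega> u0. energy \<Omega> f w)"
proof -
  note p = assms(1) and f = assms(4) and conv = assms(6)
  have \<Omega>: "open \<Omega>" "bounded \<Omega>" using assms(2) by (auto simp: bounded_lipschitz_domain_def)
  let ?M = "lebesgue_on \<Omega>"
  have p0: "0 \<le> p" using p by simp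
  note dm = domain_measurable[OF p \<Omega>]
  define U0 where "U0 = weak_gradient \<Omega> u0"
  note u0 = sobolev_weak_gradient[OF \<Omega>(1) assms(3), folded U0_def]
  obtain q c0 c1 c2 where q: "1 \<le> q" "q < p" and c0: "0 < c0" and c2: "integrable ?M c2"
    and gr: "\<And>x u \<xi>. x \<in> closure \<Omega> \<Longrightarrow> c0 * norm \<xi> powr p + c1 * norm u powr q + c2 x \<le> f x u \<xi>"
    using assms(5) unfolding p_growth_def by blast
  define K where "K = \<bar>c1\<bar>"
  have K: "0 \<le> K" by (simp add: K_def)
  have growth: "c0 * norm \<xi> powr p - K * norm u powr q + c2 x \<le> f x u \<xi>" if "x \<in> \<Omega>" for x u \<xi>
  proof -
    have "- K * norm u powr q \<le> c1 * norm u powr q" by (intro mult_right_mono) (auto simp: K_def)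
    then show ?thesis using gr[of x \<xi> u] that closure_subset[of \<Omega>] by auto
  qed
  \<comment> \<open>Everything is expressed through pairs \<open>z\<close> of \<open>h \<in> W\<^sub>0\<^sup>1\<^sup>,\<^sup>p\<close> and its gradient; \<open>u z\<close> is the competitor \<open>u0 + h\<close> and \<open>U z\<close> its gradient.\<close>
  define T :: "(real^'n \<Rightarrow> (real^'d) \<times> (real^'n^'d)) set" where "T = sobolev0_pairs p \<Omega>"
  define u where "u z x = u0 x + fst (z x)" for z :: "real^'n \<Rightarrow> (real^'d) \<times> (real^'n^'d)" and x
  define U where "U z x = U0 x + snd (z x)" for z :: "real^'n \<Rightarrow> (real^'d) \<times> (real^'n^'d)" and x
  define F where "F z x = f x (u z x) (U z x)" for z x
  have zi: "pow_integrable ?M p z" if "z \<in> T" for z using that by (simp add: T_def sobolev0_pairs_def)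
  have ui: "pow_integrable ?M p (u z)" "pow_integrable ?M p (U z)" if "z \<in> T" for z
    unfolding u_def[abs_def] U_def[abs_def]
    by (intro pow_integrable_add p0 u0 pow_integrable_fst_snd[OF p0 zi[OF that]])+
  have Fm: "F z \<in> borel_measurable ?M" if "z \<in> T" for z
    unfolding F_def[abs_def]
    by (intro composed_integrand_measurable[OF f] pow_integrable_measurable[OF ui(1)[OF that]]
        pow_integrable_measurable[OF ui(2)[OF that]])
  have in\<Omega>: "x \<in> \<Omega>" if "x \<in> space ?M" for x using that by (simp add: space_restrict_space)

  have T_energy: "u z \<in> affine_sobolev0 p \<Omega> u0 \<and> energy \<Omega> f (u z) = extended_integral ?M (F z)" if z: "z \<in> T" for z
  proof
    have "(\<lambda>x. fst (z x)) \<in> sobolev0 p \<Omega>"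
      using z unfolding T_def by (rule sobolev0_pairs_imp_sobolev0[OF p \<Omega>])
    then show "u z \<in> affine_sobolev0 p \<Omega> u0"
      unfolding affine_sobolev0_def u_def[abs_def] mem_Collect_eq
      by (intro exI[of _ "\<lambda>x. fst (z x)"] conjI refl)
    have "has_weak_gradient \<Omega> (\<lambda>x. fst (z x)) (\<lambda>x. snd (z x))"
      using z unfolding T_def by (rule sobolev0_pairs_has_weak_gradient[OF p \<Omega>])
    then have "has_weak_gradient \<Omega> (u z) (U z)"
      unfolding u_def[abs_def] U_def[abs_def] by (rule has_weak_gradient_add[OF dm(1) u0(1)])
    then have "AE x in ?M. U z x = weak_gradient \<Omega> (u z) x" by (rule weak_gradient_eq_AE[OF \<Omega>(1)])
    then have "AE x in ?M. f x (u z x) (weak_gradient \<Omega> (u z) x) = F z x"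
      by eventually_elim (simp add: F_def)
    then show "energy \<Omega> f (u z) = extended_integral ?M (F z)"
      unfolding energy_def by (rule extended_integral_cong_AE)
  qed
  have W_T: "\<exists>z\<in>T. w = u z" if W: "w \<in> affine_sobolev0 p \<Omega> u0" for w
  proof -
    have "\<exists>h. w = (\<lambda>x. u0 x + h x) \<and> h \<in> sobolev0 p \<Omega>"
      using W unfolding affine_sobolev0_def mem_Collect_eq .
    then obtain h where h: "w = (\<lambda>x. u0 x + h x)" "h \<in> sobolev0 p \<Omega>" by (elim exE conjE)
    have "(\<lambda>x. (h x, weak_gradient \<Omega> h x)) \<in> T"
      unfolding T_def by (rule sobolev0_imp_sobolev0_pairs[OF p \<Omega> h(2)])
    moreover have "w = u (\<lambda>x. (h x, weak_gradient \<Omega> h x))" using h(1) by (simp add: u_def[abs_def])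
    ultimately show ?thesis by (intro bexI)
  qed

  have F_integrable: "integrable ?M (F z)" if z: "z \<in> T" and fin: "extended_integral ?M (F z) < \<infinity>" for z
  proof -
    obtain C where C: "0 \<le> C" "\<And>t. 0 \<le> t \<Longrightarrow> K * t powr q \<le> 1 * t powr p + C"
      by (rule young_absorb[OF K q zero_less_one]) blast
    show ?thesis
    proof (rule extended_integral_finite_imp_integrable[OF Fm[OF z] _ _ fin])
      interpret finite_measure ?M by (rule dm(3))
      show "integrable ?M (\<lambda>x. c2 x - (norm (u z x) powr p + C))"
        using c2 pow_integrable_integrable[OF ui(1)[OF z]] by simp
      show "AE x in ?M. c2 x - (norm (u z x) powr p + C) \<le> F z x"
      proof (rule AE_I2)
        fix x assume "x \<in> space ?M"
        then have x: "x \<in> \<Omega>" by (rule in\<Omega>)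
        have "0 \<le> c0 * norm (U z x) powr p" using c0 by simp
        then show "c2 x - (norm (u z x) powr p + C) \<le> F z x"
          using growth[OF x, of "U z x" "u z x"] C(2)[of "norm (u z x)"] by (simp add: F_def)
      qed
    qed
  qed

  obtain P where P: "0 < P" "\<And>z. z \<in> T \<Longrightarrow> p_mass ?M p (\<lambda>x. fst (z x)) \<le> P * p_mass ?M p (\<lambda>x. snd (z x))"
    unfolding T_def by (rule sobolev0_pairs_poincare[OF p \<Omega>, where 'd='d]) blast
  define Q :: real where "Q = 2 powr p"
  have Q: "0 < Q" by (simp add: Q_def)
  define a0 A0 where "a0 = p_mass ?M p u0" and "A0 = p_mass ?M p U0"
  have snd_le: "p_mass ?M p (\<lambda>x. snd (z x)) \<le> Q * (p_mass ?M p (U z) + A0)" if z: "z \<in> T" for z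
  proof -
    have "snd (z x) = U z x - U0 x" for x by (simp add: U_def)
    then have "p_mass ?M p (\<lambda>x. snd (z x)) = p_mass ?M p (\<lambda>x. U z x + (-1) *\<^sub>R U0 x)" by simp
    also have "\<dots> \<le> Q * (p_mass ?M p (U z) + p_mass ?M p (\<lambda>x. (-1) *\<^sub>R U0 x))"
      unfolding Q_def by (rule p_mass_add_le[OF p0 ui(2)[OF z] pow_integrable_scaleR[OF u0(2)]])
    also have "p_mass ?M p (\<lambda>x. (-1) *\<^sub>R U0 x) = A0" unfolding p_mass_scaleR A0_def by simp
    finally show ?thesis .
  qed
  have u_le: "p_mass ?M p (u z) \<le> Q * (a0 + P * (Q * (p_mass ?M p (U z) + A0)))" if z: "z \<in> T" for z
  proof -
    have "p_mass ?M p (u z) \<le> Q * (a0 + p_mass ?M p (\<lambda>x. fst (z x)))"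
      unfolding Q_def a0_def u_def[abs_def]
      by (rule p_mass_add_le[OF p0 u0(3) pow_integrable_fst_snd(1)[OF p0 zi[OF z]]])
    also have "\<dots> \<le> Q * (a0 + P * (Q * (p_mass ?M p (U z) + A0)))"
    proof (intro mult_left_mono add_left_mono)
      have "p_mass ?M p (\<lambda>x. fst (z x)) \<le> P * p_mass ?M p (\<lambda>x. snd (z x))" by (rule P(2)[OF z])
      also have "\<dots> \<le> P * (Q * (p_mass ?M p (U z) + A0))" using snd_le[OF z] P(1) by (intro mult_left_mono) auto
      finally show "p_mass ?M p (\<lambda>x. fst (z x)) \<le> P * (Q * (p_mass ?M p (U z) + A0))" .
    qed (use Q in simp)
    finally show ?thesis .
  qed

  obtain E0 where coercive: "\<And>z. z \<in> T \<Longrightarrow> integrable ?M (F z) \<Longrightarrow> c0 / 2 * p_mass ?M p (U z) - E0 \<le> (\<integral>x. F z x \<partial>?M)"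
  proof -
    interpret finite_measure ?M by (rule dm(3))
    \<comment> \<open>With this \<open>\<epsilon>\<close> the lower-order term costs at most half of the gradient term, by the Poincare inequality.\<close>
    define \<epsilon> where "\<epsilon> = c0 / (2 * (Q * P * Q))"
    have e: "0 < \<epsilon>" using c0 Q P(1) by (simp add: \<epsilon>_def)
    obtain C where C: "0 \<le> C" "\<And>t. 0 \<le> t \<Longrightarrow> K * t powr q \<le> \<epsilon> * t powr p + C"
      by (rule young_absorb[OF K q e]) blast
    define c where "c = (\<integral>x. c2 x - C \<partial>?M)"
    define E0 where "E0 = \<epsilon> * (Q * (a0 + P * (Q * A0))) - c"
    have "c0 / 2 * p_mass ?M p (U z) - E0 \<le> (\<integral>x. F z x \<partial>?M)" if z: "z \<in> T" and F: "integrable ?M (F z)" for z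
    proof -
      note i = pow_integrable_integrable[OF ui(1)[OF z]] pow_integrable_integrable[OF ui(2)[OF z]]
      have "c0 * p_mass ?M p (U z) - \<epsilon> * p_mass ?M p (u z) + c
         = (\<integral>x. c0 * norm (U z x) powr p - \<epsilon> * norm (u z x) powr p + (c2 x - C) \<partial>?M)"
        using i c2 by (simp add: p_mass_def c_def)
      also have "\<dots> \<le> (\<integral>x. F z x \<partial>?M)"
      proof (rule integral_mono[OF _ F])
        show "integrable ?M (\<lambda>x. c0 * norm (U z x) powr p - \<epsilon> * norm (u z x) powr p + (c2 x - C))"
          using i c2 by simp
        fix x assume "x \<in> space ?M"
        then have x: "x \<in> \<Omega>" by (rule in\<Omega>)
        show "c0 * norm (U z x) powr p - \<epsilon> * norm (u z x) powr p + (c2 x - C) \<le> F z x"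
          using growth[OF x, of "U z x" "u z x"] C(2)[of "norm (u z x)"] by (simp add: F_def)
      qed
      finally have 1: "c0 * p_mass ?M p (U z) - \<epsilon> * p_mass ?M p (u z) + c \<le> (\<integral>x. F z x \<partial>?M)" .
      have "\<epsilon> * p_mass ?M p (u z) \<le> \<epsilon> * (Q * (a0 + P * (Q * (p_mass ?M p (U z) + A0))))"
        using u_le[OF z] e by (intro mult_left_mono) auto
      also have "\<dots> = \<epsilon> * (Q * P * Q) * p_mass ?M p (U z) + \<epsilon> * (Q * (a0 + P * (Q * A0)))"
        by (simp add: algebra_simps)
      also have "\<epsilon> * (Q * P * Q) = c0 / 2" using Q P(1) by (simp add: \<epsilon>_def)
      finally have 2: "\<epsilon> * p_mass ?M p (u z) \<le> c0 / 2 * p_mass ?M p (U z) + (E0 + c)" by (simp add: E0_def)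
      have 3: "c0 * p_mass ?M p (U z) = c0 / 2 * p_mass ?M p (U z) + c0 / 2 * p_mass ?M p (U z)" by simp
      from 1 2 3 show ?thesis by linarith
    qed
    then show ?thesis by (rule that)
  qed

  \<comment> \<open>Energies equal to \<open>\<infinity>\<close> are left out, so that the infimum is a real number.\<close>
  define S where "S = {\<integral>x. F z x \<partial>?M | z. z \<in> T \<and> integrable ?M (F z)}"
  define m where "m = Inf S"
  have S_ne: "S \<noteq> {}"
  proof -
    obtain w where w: "w \<in> affine_sobolev0 p \<Omega> u0" "energy \<Omega> f w < \<infinity>" using assms(7) by blast
    obtain z where z: "z \<in> T" "w = u z" using W_T[OF w(1)] by (elim bexE)
    have "integrable ?M (F z)" using F_integrable[OF z(1)] T_energy[OF z(1)] w(2) z(2) by simp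
    then show ?thesis using z(1) unfolding S_def by blast
  qed
  have S_bdd: "bdd_below S"
  proof (rule bdd_belowI[of _ "- E0"])
    fix v assume "v \<in> S"
    then obtain z where z: "v = (\<integral>x. F z x \<partial>?M)" "z \<in> T" "integrable ?M (F z)" unfolding S_def by blast
    have "0 \<le> c0 / 2 * p_mass ?M p (U z)" using c0 by simp
    then show "- E0 \<le> v" using coercive[OF z(2,3)] z(1) by linarith
  qed
  have ex: "\<exists>z. z \<in> T \<and> integrable ?M (F z) \<and> (\<integral>x. F z x \<partial>?M) < m + 1 / real (Suc k)" for k
  proof -
    have "Inf S < m + 1 / real (Suc k)" by (simp add: m_def)
    then obtain v where "v \<in> S" "v < m + 1 / real (Suc k)" using cInf_lessD[OF S_ne] by blast
    then show ?thesis unfolding S_def by blast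
  qed
  define z where "z k = (SOME z. z \<in> T \<and> integrable ?M (F z) \<and> (\<integral>x. F z x \<partial>?M) < m + 1 / real (Suc k))" for k
  have z: "z k \<in> T" "integrable ?M (F (z k))" "(\<integral>x. F (z k) x \<partial>?M) < m + 1 / real (Suc k)" for k
    using someI_ex[OF ex[of k]] unfolding z_def by blast+
  have m_le: "m \<le> (\<integral>x. F y x \<partial>?M)" if "y \<in> T" "integrable ?M (F y)" for y
    unfolding m_def using that by (intro cInf_lower S_bdd) (auto simp: S_def)
  have lim_m: "(\<lambda>k. \<integral>x. F (z k) x \<partial>?M) \<longlonglongrightarrow> m"
  proof (rule tendsto_sandwich[OF _ _ tendsto_const])
    have "(\<lambda>k. m + 1 / real (Suc k)) \<longlonglongrightarrow> m + 0"
      by (intro tendsto_add tendsto_const LIMSEQ_Suc[OF lim_const_over_n])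
    then show "(\<lambda>k. m + 1 / real (Suc k)) \<longlonglongrightarrow> m" by simp
  qed (use m_le z in \<open>auto intro!: always_eventually less_imp_le\<close>)

  \<comment> \<open>Coercivity bounds the whole minimizing sequence.\<close>
  define B where "B = (m + 1 + E0) * 2 / c0"
  have UB: "p_mass ?M p (U (z k)) \<le> B" for k
  proof -
    have "1 / real (Suc k) \<le> 1" by simp
    then have "c0 / 2 * p_mass ?M p (U (z k)) \<le> m + 1 + E0"
      using coercive[OF z(1,2)[of k]] z(3)[of k] by linarith
    then show ?thesis using c0 by (simp add: B_def field_simps)
  qed
  define B1 where "B1 = Q * (B + A0)"
  have sndB: "p_mass ?M p (\<lambda>x. snd (z k x)) \<le> B1" for k
  proof -
    have "p_mass ?M p (\<lambda>x. snd (z k x)) \<le> Q * (p_mass ?M p (U (z k)) + A0)" by (rule snd_le[OF z(1)])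
    also have "\<dots> \<le> B1" unfolding B1_def using UB[of k] Q by (intro mult_left_mono) auto
    finally show ?thesis .
  qed
  define B2 where "B2 = Q * (a0 + P * B1)"
  have uB: "p_mass ?M p (u (z k)) \<le> B2" for k
  proof -
    have "p_mass ?M p (u (z k)) \<le> Q * (a0 + P * (Q * (p_mass ?M p (U (z k)) + A0)))" by (rule u_le[OF z(1)])
    also have "\<dots> \<le> B2" unfolding B2_def B1_def using UB[of k] Q P(1) by (intro mult_left_mono add_left_mono add_right_mono) auto
    finally show ?thesis .
  qed
  define B3 where "B3 = Q * (P * B1 + B1)"
  have zB: "p_mass ?M p (z k) \<le> B3" for k
  proof -
    have "p_mass ?M p (\<lambda>x. (fst (z k x), snd (z k x))) \<le> Q * (p_mass ?M p (\<lambda>x. fst (z k x)) + p_mass ?M p (\<lambda>x. snd (z k x)))"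
      unfolding Q_def by (intro pow_integrable_Pair p0 pow_integrable_fst_snd[OF p0 zi[OF z(1)]])
    also have "\<dots> \<le> B3" unfolding B3_def
    proof (intro mult_left_mono add_mono sndB)
      have "p_mass ?M p (\<lambda>x. fst (z k x)) \<le> P * p_mass ?M p (\<lambda>x. snd (z k x))" by (rule P(2)[OF z(1)])
      also have "\<dots> \<le> P * B1" using sndB[of k] P(1) by (intro mult_left_mono) auto
      finally show "p_mass ?M p (\<lambda>x. fst (z k x)) \<le> P * B1" .
    qed (use Q in simp)
    finally show ?thesis by simp
  qed

  \<comment> \<open>The functions converge along a subsequence.  The subsequence for the integrand differences is taken before the convex combinations are formed, since the latter use all indices of the sequence.\<close>
  obtain r1 where r1: "strict_mono (r1 :: nat \<Rightarrow> nat)" "p_cauchy ?M p (\<lambda>k x. fst (z (r1 k) x))"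
    by (rule sobolev0_pairs_compact[where z=z, OF p \<Omega> z(1)[unfolded T_def] sndB])
  obtain r2 h where r2: "strict_mono (r2 :: nat \<Rightarrow> nat)" and h: "pow_integrable ?M p h"
    and lim_h: "AE x in ?M. (\<lambda>k. fst (z (r1 (r2 k)) x)) \<longlonglongrightarrow> h x"
    by (rule p_cauchy_limit[OF dm(3) p pow_integrable_fst_snd(1)[OF p0 zi[OF z(1)]] r1(2)]) blast
  define v where "v x = u0 x + h x" for x
  have vi: "pow_integrable ?M p v" unfolding v_def[abs_def] by (rule pow_integrable_add[OF p0 u0(3) h])
  have lim_u: "AE x in ?M. (\<lambda>k. u (z (r1 (r2 k))) x) \<longlonglongrightarrow> v x"
    using lim_h by eventually_elim (auto simp: u_def v_def intro: tendsto_intros)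
  obtain r3 where r3: "strict_mono (r3 :: nat \<Rightarrow> nat)"
    "AE x in ?M. (\<lambda>k. f x (u (z (r1 (r2 (r3 k)))) x) (U (z (r1 (r2 (r3 k)))) x) - f x (v x) (U (z (r1 (r2 (r3 k)))) x)) \<longlonglongrightarrow> 0"
    by (rule integrand_difference_AE_subseq[where u="\<lambda>k. u (z (r1 (r2 k)))" and U="\<lambda>k. U (z (r1 (r2 k)))", OF p \<Omega> f pow_integrable_measurable[OF ui(1)[OF z(1)]]
          pow_integrable_measurable[OF vi] lim_u ui(2)[OF z(1)] UB]) blast
  define y where "y k = z (r1 (r2 (r3 k)))" for k
  have sm: "strict_mono (\<lambda>k. r1 (r2 (r3 k)))"
    using r1(1) r2 r3(1) by (simp add: strict_mono_def)
  have y: "y k \<in> T" "integrable ?M (F (y k))" "p_mass ?M p (u (y k)) \<le> B2" "p_mass ?M p (y k) \<le> B3" for k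
    by (simp_all add: y_def z uB zB)
  have lim_Fy: "(\<lambda>k. \<integral>x. F (y k) x \<partial>?M) \<longlonglongrightarrow> m"
    using LIMSEQ_subseq_LIMSEQ[OF lim_m sm] by (simp add: y_def o_def)
  have lim_y: "AE x in ?M. (\<lambda>k. fst (y k x)) \<longlonglongrightarrow> h x"
    using lim_h by eventually_elim (use LIMSEQ_subseq_LIMSEQ[OF _ r3(1)] in \<open>fastforce simp: y_def o_def\<close>)

  obtain n w where w: "\<And>j. tail_weights j (n j) (w j)"
    and cau: "p_cauchy ?M p (\<lambda>j. tail_combination y j (n j) (w j))"
    by (rule bounded_tail_combinations_cauchy[where z=y, OF p zi[OF y(1)] y(4)]) (rule that)
  define Y where "Y j = tail_combination y j (n j) (w j)" for j
  have YT: "Y j \<in> T" for j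
    unfolding Y_def tail_combination_def[abs_def] T_def
    by (intro sobolev0_pairs_sum[OF p \<Omega>] sobolev0_pairs_scaleR[OF p \<Omega>] y(1)[unfolded T_def]
        tail_weights_nonempty[OF w]) auto
  obtain s Z where s: "strict_mono (s :: nat \<Rightarrow> nat)" and Zi: "pow_integrable ?M p Z"
    and lim_Z: "AE x in ?M. (\<lambda>i. Y (s i) x) \<longlonglongrightarrow> Z x"
    and mass_Z: "(\<lambda>j. p_mass ?M p (\<lambda>x. Y j x - Z x)) \<longlonglongrightarrow> 0"
    by (rule p_cauchy_limit[where g=Y, OF dm(3) p zi[OF YT] cau[folded Y_def]])
  have ZT: "Z \<in> T"
    unfolding T_def
  proof (rule sobolev0_pairs_closed[OF p \<Omega> Zi])
    fix \<eta> :: real assume "0 < \<eta>"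
    then have "eventually (\<lambda>j. p_mass ?M p (\<lambda>x. Y j x - Z x) < \<eta>) sequentially"
      using order_tendstoD(2)[OF mass_Z] by blast
    then obtain j where "p_mass ?M p (\<lambda>x. Y j x - Z x) < \<eta>" unfolding eventually_sequentially by blast
    then have "p_mass ?M p (\<lambda>x. Z x - Y j x) < \<eta>" by (simp only: p_mass_minus_commute[of ?M p Z])
    then show "\<exists>y\<in>sobolev0_pairs p \<Omega>. p_mass ?M p (\<lambda>x. Z x - y x) < \<eta>"
      using YT[of j] unfolding T_def by blast
  qed
  \<comment> \<open>Convex combinations of a convergent sequence with weights moving to infinity have the same limit.\<close>
  have hZ: "AE x in ?M. v x = u Z x"
  proof (use lim_y lim_Z in eventually_elim)
    fix x assume 1: "(\<lambda>k. fst (y k x)) \<longlonglongrightarrow> h x" and 2: "(\<lambda>i. Y (s i) x) \<longlonglongrightarrow> Z x"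
    have "(\<lambda>j. \<Sum>k\<in>{j..n j}. w j k *\<^sub>R fst (y k x)) \<longlonglongrightarrow> h x" by (rule tail_combination_tendsto[OF w 1])
    then have "(\<lambda>j. fst (Y j x)) \<longlonglongrightarrow> h x" by (simp add: Y_def tail_combination_def fst_sum)
    then have "(\<lambda>i. fst (Y (s i) x)) \<longlonglongrightarrow> h x" using LIMSEQ_subseq_LIMSEQ[OF _ s] by (fastforce simp: o_def)
    moreover have "(\<lambda>i. fst (Y (s i) x)) \<longlonglongrightarrow> fst (Z x)" using 2 by (rule tendsto_fst)
    ultimately have "h x = fst (Z x)" by (rule LIMSEQ_unique)
    then show "v x = u Z x" by (simp add: v_def u_def)
  qed
  have lim_U: "AE x in ?M. (\<lambda>i. tail_combination (\<lambda>k. U (y k)) (s i) (n (s i)) (w (s i)) x) \<longlonglongrightarrow> U Z x"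
  proof (use lim_Z in eventually_elim)
    fix x assume "(\<lambda>i. Y (s i) x) \<longlonglongrightarrow> Z x"
    then have "(\<lambda>i. U0 x + snd (Y (s i) x)) \<longlonglongrightarrow> U Z x" unfolding U_def by (intro tendsto_intros)
    moreover have "tail_combination (\<lambda>k. U (y k)) j (n j) (w j) x = U0 x + snd (Y j x)" for j
      by (simp add: tail_combination_def U_def Y_def scaleR_add_right sum.distrib snd_sum
          tail_weights_sum[OF w] flip: scaleR_left.sum)
    ultimately show "(\<lambda>i. tail_combination (\<lambda>k. U (y k)) (s i) (n (s i)) (w (s i)) x) \<longlonglongrightarrow> U Z x" by simp
  qed
  have low: "- K * norm a powr q + c2 x \<le> f x a \<xi>" if "x \<in> \<Omega>" for x a \<xi>
  proof -
    have "0 \<le> c0 * norm \<xi> powr p" using c0 by simp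
    then show ?thesis using growth[OF that, of \<xi> a] by simp
  qed
  note lsc = integral_lower_semicontinuity[where u="\<lambda>k. u (y k)" and U="\<lambda>k. U (y k)" and v=v and V="U Z",
      OF p \<Omega> f conv q K c2 low ui(1)[OF y(1)] y(3) vi pow_integrable_measurable[OF ui(2)[OF y(1)]]
      pow_integrable_measurable[OF ui(2)[OF ZT]] r3(2)[folded y_def] w s lim_U
      y(2)[unfolded F_def] lim_Fy[unfolded F_def]]
  have ae: "AE x in ?M. f x (v x) (U Z x) = F Z x" using hZ by eventually_elim (simp add: F_def)
  have vm: "(\<lambda>x. f x (v x) (U Z x)) \<in> borel_measurable ?M" using lsc(1) by (rule borel_measurable_integrable)
  have FZ: "integrable ?M (F Z)"
    using lsc(1) integrable_cong_AE[OF vm Fm[OF ZT] ae] by blast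
  have "(\<integral>x. F Z x \<partial>?M) = (\<integral>x. f x (v x) (U Z x) \<partial>?M)"
    by (rule integral_cong_AE[OF vm Fm[OF ZT] ae, symmetric])
  then have FZ_le: "(\<integral>x. F Z x \<partial>?M) \<le> m" using lsc(2) by simp
  have EZ: "energy \<Omega> f (u Z) \<le> ereal m"
    using T_energy[OF ZT] extended_integral_integrable[OF FZ] FZ_le by simp
  have min: "energy \<Omega> f (u Z) \<le> energy \<Omega> f w" if W: "w \<in> affine_sobolev0 p \<Omega> u0" for w
  proof (cases "energy \<Omega> f w < \<infinity>")
    case True
    obtain x where x: "x \<in> T" "w = u x" using W_T[OF W] by (elim bexE)
    have Fx: "integrable ?M (F x)" using F_integrable[OF x(1)] T_energy[OF x(1)] True x(2) by simp
    then have "energy \<Omega> f w = ereal (\<integral>a. F x a \<partial>?M)"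
      using T_energy[OF x(1)] x(2) extended_integral_integrable by simp
    then show ?thesis using EZ m_le[OF x(1) Fx] by (metis ereal_less_eq(3) order_trans)
  qed simp
  show ?thesis
  proof (rule bexI)
    show "u Z \<in> affine_sobolev0 p \<Omega> u0" using T_energy[OF ZT] by blast
    then show "energy \<Omega> f (u Z) = (INF w\<in>affine_sobolev0 p \<Omega> u0. energy \<Omega> f w)"
      using min by (intro antisym INF_greatest INF_lower)
  qed
qed

end
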